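(* Let $q$ be a prime power, $n\ge 1$, let $M=M(q,n)$ be the matroid on the finite projective space $E=\mathbb{P}^{n-1}(\mathbb{F}_q)$ given by linear independence, let $k$ be a field of characteristic zero, and let $Q=k[X_e\mid e\in E]$, $\Phi_M$, $\Lambda_M$, $J_M=(\Lambda_M)$ and $A_M=Q/\operatorname{Ann}_Q\Phi_M$ be as defined in the context. Then: (1) The algebra $A_{M(q,n)}$ has the strong Lefschetz property. (2) The ideal $\operatorname{Ann}_Q \Phi_{M(q,n)}$ is generated by $\Lambda_{M(q,n)}$, i.e. $\operatorname{Ann}_Q \Phi_{M(q,n)}=J_{M(q,n)}$. In particular it is a binomial ideal. (3) The Hilbert series satisfies $\operatorname{Hilb}(Q/\operatorname{Ann}_Q\Phi_{M(q,n)},t)=\sum_{i=0}^n \binom{n}{i}_q t^i$, where $\binom{n}{i}_q$ are the $q$-binomial coefficients. (4) The vector space lattice $V(q,n)$, consisting of all linear subspaces of $\mathbb{F}_q^n$ ordered by inclusion, has the Sperner property.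
   Context: A matroid $M=(E,\mathcal{F})$ is a finite set $E$ with its system $\mathcal{F}\subset 2^E$ of independent sets; $\mathcal{B}$ is the set of bases (maximal independent sets), $r(S)=\max\{\#F: F\in\mathcal{F},F\subset S\}$ is the rank function, $\sigma(S)=\{y\in E: r(S\cup\{y\})=r(S)\}$ is the closure, and $S\sim T$ means $\sigma(S)=\sigma(T)$. The matroid $M(q,n)$ has ground set $E=\mathbb{P}^{n-1}(\mathbb{F}_q)$, and $F\subset E$ is independent iff its points are linearly independent over $\mathbb{F}_q$. Let $k$ be a field of characteristic zero. Put $x_S=\prod_{e\in S}x_e$ and $\Phi_M=\sum_{B\in\mathcal{B}}x_B\in k[x_e\mid e\in E]$. Let $Q=k[X_e\mid e\in E]$, acting on $k[x_e\mid e\in E]$ by $X_e=\partial/\partial x_e$, and put $X_S=\prod_{e\in S}X_e$. $\operatorname{Ann}_Q\Phi_M=\{\varphi\in Q:\varphi\cdot\Phi_M=0\}$ and $A_M=Q/\operatorname{Ann}_Q\Phi_M$, a graded algebra. Let $$\Lambda_M=\{X_e^2\mid e\in E\}\cup\{X_S\mid S\subset E,\ S\notin\mathcal{F}\}\cup\{X_A-X_{A'}\mid A,A'\in\mathcal{F},A\sim A'\}\subset Q,$$ and let $J_M$ be the ideal of $Q$ generated by $\Lambda_M$. A graded Artinian algebra $A=\bigoplus_{d=0}^D A_d$ with $A_D\ne0$ has the strong Lefschetz property (in the narrow sense) if there is $L\in A_1$ such that multiplication by $L^{D-2i}:A_i\to A_{D-i}$ is bijective for $i=0,\ldots,[D/2]$.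 A finite ranked poset $P=\bigcup_{i\ge0}P_i$ with level sets $P_i$ has the Sperner property if the maximal cardinality of an antichain of $P$ equals $\max_i\#P_i$. The rank in $V(q,n)$ is the dimension. *)

theory Defs
  imports
    "HOL-Analysis.Cartesian_Space"
    "HOL-Library.Poly_Mapping"
    "HOL-Algebra.Embedded_Algebras"
    "HOL-Algebra.QuotRing"
    "HOL-Computational_Algebra.Formal_Power_Series"
begin

section \<open>Matroids\<close>

text \<open>A matroid is given by its ground set \<open>E\<close> and its system \<open>\<F>\<close> of independent sets.\<close>

locale matroid =
  fixes E :: "'e set" and \<F> :: "'e set set"
  assumes finite_ground: "finite E"
    and indep_subset_ground: "F \<in> \<F> \<Longrightarrow> F \<subseteq> E"
    and empty_indep: "{} \<in> \<F>"
    and indep_subset: "\<lbrakk>F \<in> \<F>; G \<subseteq> F\<rbrakk> \<Longrightarrow> G \<in> \<F>"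
    and indep_augment: "\<lbrakk>F \<in> \<F>; G \<in> \<F>; card F < card G\<rbrakk> \<Longrightarrow> \<exists>x\<in>G - F. insert x F \<in> \<F>"

definition bases :: "'e set set \<Rightarrow> 'e set set" where
  "bases \<F> = {B \<in> \<F>. \<forall>F\<in>\<F>. B \<subseteq> F \<longrightarrow> F = B}"

definition matroid_rank :: "'e set set \<Rightarrow> 'e set \<Rightarrow> nat" where
  "matroid_rank \<F> S = Max (card ` {F \<in> \<F>. F \<subseteq> S})"

definition matroid_closure :: "'e set \<Rightarrow> 'e set set \<Rightarrow> 'e set \<Rightarrow> 'e set" where
  "matroid_closure E \<F> S = {y \<in> E. matroid_rank \<F> (S \<union> {y}) = matroid_rank \<F> S}"

definition matroid_equiv :: "'e set \<Rightarrow> 'e set set \<Rightarrow> 'e set \<Rightarrow> 'e set \<Rightarrow> bool" where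
  "matroid_equiv E \<F> S T \<longleftrightarrow> matroid_closure E \<F> S = matroid_closure E \<F> T"


section \<open>The matroid of a finite projective space\<close>

text \<open>
  The points of the projective space of \<open>'f^'n\<close> are the one-dimensional subspaces. A set of
  points is independent iff representing vectors of its points are linearly independent; this
  does not depend on the choice of representatives (\<open>proj_indep_iff_all\<close> below), and
  distinct points have distinct representatives, so that independence of the set \<open>v ` F\<close>
  is independence of the family \<open>v\<close>.
\<close>

definition proj_space :: "('f::field ^ 'n::finite) set set" where
  "proj_space = {p. vec.subspace p \<and> vec.dim p = 1}"

definition proj_indep :: "('f::field ^ 'n::finite) set set set" where
  "proj_indep = {F. F \<subseteq> proj_space \<and>
     (\<exists>v. (\<forall>p\<in>F. v p \<in> p \<and> v p \<noteq> 0) \<and> vec.independent (v ` F))}"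


section \<open>Polynomials and the action by differentiation\<close>

text \<open>
  Monomials are finitely supported exponent functions, and polynomials are finitely supported
  coefficient functions on monomials. The same type serves for \<open>k[x\<^sub>e]\<close> and for the ring
  \<open>k[X\<^sub>e]\<close> of differential operators with constant coefficients.
\<close>

type_synonym ('e, 'k) mpoly = "('e \<Rightarrow>\<^sub>0 nat) \<Rightarrow>\<^sub>0 'k"

definition mconst :: "'k::comm_ring_1 \<Rightarrow> ('e, 'k) mpoly" where
  "mconst c = Poly_Mapping.single 0 c"

definition mvar :: "'e \<Rightarrow> ('e, 'k::comm_ring_1) mpoly" where
  "mvar e = Poly_Mapping.single (Poly_Mapping.single e 1) 1"

definition mvars_prod :: "'e set \<Rightarrow> ('e, 'k::comm_ring_1) mpoly" where
  "mvars_prod S = (\<Prod>e\<in>S. mvar e)"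

definition poly_ring :: "'e set \<Rightarrow> ('e, 'k::comm_ring_1) mpoly ring" where
  "poly_ring E = \<lparr>carrier = {p. \<forall>m\<in>Poly_Mapping.keys p. Poly_Mapping.keys m \<subseteq> E},
     monoid.mult = (*), one = 1, zero = 0, add = (+)\<rparr>"

definition mdeg :: "('e \<Rightarrow>\<^sub>0 nat) \<Rightarrow> nat" where
  "mdeg m = (\<Sum>e\<in>Poly_Mapping.keys m. Poly_Mapping.lookup m e)"

definition homogeneous :: "nat \<Rightarrow> ('e, 'k::comm_ring_1) mpoly \<Rightarrow> bool" where
  "homogeneous d p \<longleftrightarrow> (\<forall>m\<in>Poly_Mapping.keys p. mdeg m = d)"

text \<open>Where \<open>e\<close> does not occur in \<open>m\<close>, the subtraction below truncates but the coefficient is \<open>0\<close>.\<close>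

definition partial :: "'e \<Rightarrow> ('e, 'k::comm_ring_1) mpoly \<Rightarrow> ('e, 'k) mpoly" where
  "partial e f = (\<Sum>m\<in>Poly_Mapping.keys f.
     Poly_Mapping.single (m - Poly_Mapping.single e 1)
       (of_nat (Poly_Mapping.lookup m e) * Poly_Mapping.lookup f m))"

text \<open>
  A monomial acts by the composition of its iterated partial derivatives; the order of
  composition is irrelevant since partial derivatives commute (\<open>partial_commute\<close> below).
\<close>

definition monom_act :: "('e \<Rightarrow>\<^sub>0 nat) \<Rightarrow> ('e, 'k::comm_ring_1) mpoly \<Rightarrow> ('e, 'k) mpoly" where
  "monom_act m f =
     Finite_Set.fold (\<lambda>e. partial e ^^ Poly_Mapping.lookup m e) f (Poly_Mapping.keys m)"

definition act :: "('e, 'k::comm_ring_1) mpoly \<Rightarrow> ('e, 'k) mpoly \<Rightarrow> ('e, 'k) mpoly" where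
  "act \<phi> f = (\<Sum>m\<in>Poly_Mapping.keys \<phi>. mconst (Poly_Mapping.lookup \<phi> m) * monom_act m f)"

definition ann :: "'e set \<Rightarrow> ('e, 'k::comm_ring_1) mpoly \<Rightarrow> ('e, 'k) mpoly set" where
  "ann E f = {\<phi> \<in> carrier (poly_ring E). act \<phi> f = 0}"


section \<open>The polynomial, the relations and the algebra of a matroid\<close>

definition basis_poly :: "'e set set \<Rightarrow> ('e, 'k::comm_ring_1) mpoly" where
  "basis_poly \<F> = (\<Sum>B\<in>bases \<F>. mvars_prod B)"

definition Lambda :: "'e set \<Rightarrow> 'e set set \<Rightarrow> ('e, 'k::comm_ring_1) mpoly set" where
  "Lambda E \<F> = {mvar e ^ 2 | e. e \<in> E}
     \<union> {mvars_prod S | S. S \<subseteq> E \<and> S \<notin> \<F>}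
     \<union> {mvars_prod A - mvars_prod A' | A A'. A \<in> \<F> \<and> A' \<in> \<F> \<and> matroid_equiv E \<F> A A'}"

text \<open>
  The quotient \<open>Q/I\<close> of a polynomial ring, with the images of the constants as its coefficient
  field and the images of the homogeneous polynomials of degree \<open>d\<close> as its graded components.
\<close>

definition quot_const :: "('e, 'k::comm_ring_1) mpoly ring \<Rightarrow> ('e, 'k) mpoly set \<Rightarrow> ('e, 'k) mpoly set set" where
  "quot_const Q I = {I +>\<^bsub>Q\<^esub> mconst c | c. True}"

definition quot_graded :: "('e, 'k::comm_ring_1) mpoly ring \<Rightarrow> ('e, 'k) mpoly set \<Rightarrow> nat \<Rightarrow> ('e, 'k) mpoly set set" where
  "quot_graded Q I d = {I +>\<^bsub>Q\<^esub> p | p. p \<in> carrier Q \<and> homogeneous d p}"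

text \<open>A binomial is a polynomial with at most two terms; monomials and \<open>0\<close> are included.\<close>

definition binomial_ideal :: "('e, 'k::comm_ring_1) mpoly ring \<Rightarrow> ('e, 'k) mpoly set \<Rightarrow> bool" where
  "binomial_ideal Q I \<longleftrightarrow>
     (\<exists>G \<subseteq> carrier Q. (\<forall>g\<in>G. card (Poly_Mapping.keys g) \<le> 2) \<and> I = Idl\<^bsub>Q\<^esub> G)"


section \<open>Graded Artinian algebras\<close>

text \<open>
  \<open>A\<close> is the direct sum of its components \<open>Ad 0, \<dots>, Ad D\<close>, which are finite-dimensional over
  the coefficient field \<open>K\<close>. The relation \<open>ring.dimension A m K V\<close> includes that \<open>V\<close> is a
  \<open>K\<close>-subspace of \<open>A\<close>.
\<close>

definition graded_artinian :: "('a, 'b) ring_scheme \<Rightarrow> 'a set \<Rightarrow> (nat \<Rightarrow> 'a set) \<Rightarrow> nat \<Rightarrow> bool" where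
  "graded_artinian A K Ad D \<longleftrightarrow>
     cring A \<and> subfield K A \<and> K \<subseteq> Ad 0 \<and>
     (\<forall>d. \<exists>m. ring.dimension A m K (Ad d)) \<and>
     (\<forall>i j. \<forall>a\<in>Ad i. \<forall>b\<in>Ad j. a \<otimes>\<^bsub>A\<^esub> b \<in> Ad (i + j)) \<and>
     (\<forall>a\<in>carrier A. \<exists>!c. (\<forall>d. c d \<in> Ad d) \<and> a = (\<Oplus>\<^bsub>A\<^esub>d\<in>{..D}. c d)) \<and>
     (\<forall>d>D. Ad d = {\<zero>\<^bsub>A\<^esub>}) \<and> Ad D \<noteq> {\<zero>\<^bsub>A\<^esub>}"

text \<open>The strong Lefschetz property in the narrow sense.\<close>

definition strong_lefschetz :: "('a, 'b) ring_scheme \<Rightarrow> 'a set \<Rightarrow> (nat \<Rightarrow> 'a set) \<Rightarrow> bool" where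
  "strong_lefschetz A K Ad \<longleftrightarrow>
     (\<exists>D. graded_artinian A K Ad D \<and>
       (\<exists>L\<in>Ad 1. \<forall>i \<le> D div 2.
          bij_betw (\<lambda>a. L [^]\<^bsub>A\<^esub> (D - 2 * i) \<otimes>\<^bsub>A\<^esub> a) (Ad i) (Ad (D - i))))"

definition hilbert_series :: "('a, 'b) ring_scheme \<Rightarrow> 'a set \<Rightarrow> (nat \<Rightarrow> 'a set) \<Rightarrow> rat fps" where
  "hilbert_series A K Ad = Abs_fps (\<lambda>d. of_nat (THE m. ring.dimension A m K (Ad d)))"

definition q_binomial :: "nat \<Rightarrow> nat \<Rightarrow> nat \<Rightarrow> rat" where
  "q_binomial q n i = (\<Prod>j<i. (of_nat q ^ (n - j) - 1) / (of_nat q ^ (i - j) - 1))"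


section \<open>Ranked posets and the Sperner property\<close>

definition ranked_poset :: "'a::order set \<Rightarrow> ('a \<Rightarrow> nat) \<Rightarrow> bool" where
  "ranked_poset P rk \<longleftrightarrow> finite P \<and>
     (\<forall>x\<in>P. (\<forall>y\<in>P. \<not> y < x) \<longrightarrow> rk x = 0) \<and>
     (\<forall>x\<in>P. \<forall>y\<in>P. x < y \<and> \<not> (\<exists>z\<in>P. x < z \<and> z < y) \<longrightarrow> rk y = rk x + 1)"

definition antichain :: "'a::order set \<Rightarrow> bool" where
  "antichain S \<longleftrightarrow> (\<forall>x\<in>S. \<forall>y\<in>S. x \<le> y \<longrightarrow> x = y)"

definition sperner_property :: "'a::order set \<Rightarrow> ('a \<Rightarrow> nat) \<Rightarrow> bool" where
  "sperner_property P rk \<longleftrightarrow> ranked_poset P rk \<and>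
     Max {card S | S. S \<subseteq> P \<and> antichain S} = Max {card {x \<in> P. rk x = i} | i. True}"

definition subspace_lattice :: "('f::field ^ 'n::finite) set set" where
  "subspace_lattice = {U. vec.subspace U}"


section \<open>Well-definedness\<close>

lemma lookup_partial:
  "Poly_Mapping.lookup (partial e f) m =
     of_nat (Suc (Poly_Mapping.lookup m e)) * Poly_Mapping.lookup f (m + Poly_Mapping.single e 1)"
proof -
  let ?s = "Poly_Mapping.single e (1::nat)"
  have key: "(of_nat (Poly_Mapping.lookup m' e) * Poly_Mapping.lookup f m' when m' - ?s = m)
    = (if m' = m + ?s then of_nat (Suc (Poly_Mapping.lookup m e)) * Poly_Mapping.lookup f (m + ?s) else 0)" for m'
  proof (cases "Poly_Mapping.lookup m' e = 0")
    case True
    then have "m' \<noteq> m + ?s" by (auto simp: lookup_add)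
    with True show ?thesis by (simp add: when_def)
  next
    case False
    have "m' - ?s = m \<longleftrightarrow> m' = m + ?s"
    proof
      assume "m' - ?s = m"
      with False show "m' = m + ?s"
        by (intro poly_mapping_eqI) (auto simp: lookup_add lookup_minus lookup_single when_def)
    qed simp
    then show ?thesis by (auto simp: when_def lookup_add)
  qed
  have "Poly_Mapping.lookup (partial e f) m = (\<Sum>m'\<in>Poly_Mapping.keys f.
     (of_nat (Poly_Mapping.lookup m' e) * Poly_Mapping.lookup f m' when m' - ?s = m))"
    by (simp add: partial_def lookup_sum lookup_single)
  also have "\<dots> = of_nat (Suc (Poly_Mapping.lookup m e)) * Poly_Mapping.lookup f (m + ?s)"
    unfolding key by (simp add: sum.delta' in_keys_iff)
  finally show ?thesis .
qed

lemma partial_commute: "partial e (partial e' f) = partial e' (partial e f)"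
  by (intro poly_mapping_eqI)
    (auto simp: lookup_partial lookup_add lookup_single when_def algebra_simps)

lemma funpow_partial_commute:
  "(partial e ^^ i) ((partial e' ^^ j) f) = (partial e' ^^ j) ((partial e ^^ i) f)"
proof -
  have 1: "partial e ((partial e' ^^ j) g) = (partial e' ^^ j) (partial e g)" for g
    by (induction j) (simp_all add: partial_commute[of e e'])
  show ?thesis by (induction i) (auto simp: 1)
qed

interpretation partial: comp_fun_commute "\<lambda>e. partial e ^^ h e" for h
  by standard (auto simp: fun_eq_iff funpow_partial_commute)

lemma monom_act_rec:
  assumes "e \<in> Poly_Mapping.keys m"
  shows "monom_act m f = (partial e ^^ Poly_Mapping.lookup m e)
    (Finite_Set.fold (\<lambda>e. partial e ^^ Poly_Mapping.lookup m e) f (Poly_Mapping.keys m - {e}))"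
  unfolding monom_act_def using assms by (intro partial.fold_rec) auto

lemma proj_space_span:
  assumes "p \<in> proj_space" "x \<in> p" "x \<noteq> 0"
  shows "p = vec.span {x}"
proof -
  have "vec.independent {x}" using assms by simp
  moreover have "{x} \<subseteq> p" "card {x} = vec.dim p" using assms by (auto simp: proj_space_def)
  ultimately have "p \<subseteq> vec.span {x}" by (intro vec.card_ge_dim_independent) auto
  moreover have "vec.span {x} \<subseteq> p"
    using assms by (intro vec.span_minimal) (auto simp: proj_space_def)
  ultimately show ?thesis by auto
qed

lemma proj_space_rep:
  assumes "p \<in> proj_space"
  shows "\<exists>x\<in>p. x \<noteq> 0"
proof (rule ccontr)
  assume "\<not> ?thesis"
  then have "p \<subseteq> {0}" by auto
  then have "vec.dim p = 0" by (simp only: vec.dim_eq_0)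
  moreover have "vec.dim p = 1" using assms by (simp add: proj_space_def)
  ultimately show False by linarith
qed

lemma inj_on_rep:
  assumes "F \<subseteq> proj_space" "\<forall>p\<in>F. v p \<in> p \<and> v p \<noteq> 0"
  shows "inj_on v F"
  using assms by (intro inj_onI) (metis proj_space_span subsetD)

lemma independent_rep_change:
  fixes F :: "('f::field ^ 'n::finite) set set"
  assumes F: "F \<subseteq> proj_space"
    and v: "\<forall>p\<in>F. v p \<in> p \<and> v p \<noteq> 0" and w: "\<forall>p\<in>F. w p \<in> p \<and> w p \<noteq> 0"
    and ind: "vec.independent (v ` F)"
  shows "vec.independent (w ` F)"
proof -
  have inj: "inj_on v F" "inj_on w F" using inj_on_rep F v w by blast+
  have fin: "finite F" using ind inj vec.finiteI_independent finite_imageD by blast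
  have "v p \<in> vec.span (w ` F)" if "p \<in> F" for p
  proof -
    have "v p \<in> vec.span {w p}" using that F v w proj_space_span by blast
    then show ?thesis using vec.span_mono[of "{w p}" "w ` F"] that by blast
  qed
  moreover have "w p \<in> vec.span (v ` F)" if "p \<in> F" for p
  proof -
    have "w p \<in> vec.span {v p}" using that F v w proj_space_span by blast
    then show ?thesis using vec.span_mono[of "{v p}" "v ` F"] that by blast
  qed
  ultimately have "vec.span (v ` F) = vec.span (w ` F)"
    by (intro equalityI vec.span_minimal) auto
  moreover have "vec.dim (vec.span (v ` F)) = card (w ` F)"
    using ind inj by (simp add: vec.dim_span vec.dim_eq_card_independent card_image)
  ultimately show ?thesis
    using fin by (intro vec.card_le_dim_spanning[of _ "vec.span (w ` F)"]) (auto simp: vec.span_superset)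
qed

lemma proj_indep_iff_all:
  "F \<in> proj_indep \<longleftrightarrow> F \<subseteq> proj_space \<and>
     (\<forall>v. (\<forall>p\<in>F. v p \<in> p \<and> v p \<noteq> 0) \<longrightarrow> vec.independent (v ` F))"
proof
  assume "F \<in> proj_indep"
  then obtain v where F: "F \<subseteq> proj_space"
    and v: "\<forall>p\<in>F. v p \<in> p \<and> v p \<noteq> 0" "vec.independent (v ` F)"
    unfolding proj_indep_def mem_Collect_eq by blast
  have "vec.independent (w ` F)" if "\<forall>p\<in>F. w p \<in> p \<and> w p \<noteq> 0" for w
    using independent_rep_change[OF F v(1) that v(2)] .
  with F show "F \<subseteq> proj_space \<and> (\<forall>v. (\<forall>p\<in>F. v p \<in> p \<and> v p \<noteq> 0) \<longrightarrow> vec.independent (v ` F))"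
    by simp
next
  assume F: "F \<subseteq> proj_space \<and> (\<forall>v. (\<forall>p\<in>F. v p \<in> p \<and> v p \<noteq> 0) \<longrightarrow> vec.independent (v ` F))"
  define v where "v p = (SOME x. x \<in> p \<and> x \<noteq> 0)" for p :: "('a ^ 'b) set"
  have "v p \<in> p \<and> v p \<noteq> 0" if "p \<in> F" for p
  proof -
    have "p \<in> proj_space" using that F by blast
    then have "\<exists>x. x \<in> p \<and> x \<noteq> 0" using proj_space_rep[of p] by blast
    then show ?thesis unfolding v_def by (rule someI_ex)
  qed
  with F show "F \<in> proj_indep" unfolding proj_indep_def mem_Collect_eq
    by (intro conjI exI[of _ v]) blast+
qed

lemma matroid_proj: "matroid (proj_space :: ('f::{field,finite} ^ 'n::finite) set set) proj_indep"
proof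
  fix F G :: "('f ^ 'n) set set"
  show "finite (proj_space :: ('f ^ 'n) set set)" by simp
  show "{} \<in> (proj_indep :: ('f ^ 'n) set set set)" by (auto simp: proj_indep_def vec.independent_empty)
  show "F \<subseteq> proj_space" if "F \<in> proj_indep" using that by (simp add: proj_indep_def)
  show "G \<in> proj_indep" if FG: "F \<in> proj_indep" "G \<subseteq> F"
  proof -
    obtain v where v: "\<forall>p\<in>F. v p \<in> p \<and> v p \<noteq> 0" "vec.independent (v ` F)"
      using FG(1) unfolding proj_indep_def mem_Collect_eq by blast
    have "vec.independent (v ` G)" using vec.independent_mono[OF v(2) image_mono] FG(2) by simp
    with v(1) FG show ?thesis unfolding proj_indep_def mem_Collect_eq by blast
  qed
  show "\<exists>x\<in>G - F. insert x F \<in> proj_indep"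
    if FG: "F \<in> proj_indep" "G \<in> proj_indep" and card: "card F < card G"
  proof -
    have sub: "F \<subseteq> proj_space" "G \<subseteq> proj_space" using FG by (auto simp: proj_indep_def)
    obtain v where v: "\<And>p::('f ^ 'n) set. p \<in> proj_space \<Longrightarrow> v p \<in> p \<and> v p \<noteq> 0"
      using proj_space_rep by metis
    have inj: "inj_on v F" "inj_on v G" using inj_on_rep sub v by blast+
    have ind: "vec.independent (v ` F)" "vec.independent (v ` G)"
      using FG sub v unfolding proj_indep_iff_all by blast+
    have "\<not> v ` G \<subseteq> vec.span (v ` F)"
      using vec.independent_span_bound[of "v ` F" "v ` G"] ind(2) card inj by (auto simp: card_image)
    then obtain x where x: "x \<in> G" "v x \<notin> vec.span (v ` F)" by blast
    then have "x \<notin> F" using vec.span_base by blast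
    moreover have "vec.independent (v ` insert x F)"
      using ind(1) x by (simp add: vec.independent_insertI)
    then have "insert x F \<in> proj_indep"
      using sub x(1) v unfolding proj_indep_def mem_Collect_eq
      by (intro conjI exI[of _ v]) auto
    ultimately show ?thesis using x by blast
  qed
qed

end

theory Submission
  imports Defs
begin

text \<open>
  Modulo \<open>J\<close> a squarefree monomial depends only on the subspace spanned by its points, so \<open>Q/J\<close> is
  spanned by the subspaces of \<open>V = \<bbbF>\<^sub>q\<^sup>n\<close>, graded by dimension. Applied to \<open>\<Phi>\<close>, the class of a
  subspace \<open>U\<close> gives the sum over the complements \<open>W\<close> of \<open>U\<close> of the basis polynomials of \<open>W\<close>; hence
  \<open>J = Ann \<Phi>\<close> amounts to the injectivity of the matrix of complementary pairs. With \<open>L = \<Sum> X\<^sub>e\<close>, the map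
  \<open>L\<close> to the power \<open>n - 2i\<close> is a positive multiple of the inclusion matrix between the subspaces of
  dimension \<open>i\<close> and \<open>n - i\<close>. All these incidence matrices are injective by one argument: fix a
  subspace \<open>S\<close> and sum the coefficients of a kernel vector over the orbits \<open>{U. dim (U \<inter> S) = t}\<close> of the
  stabilizer of \<open>S\<close> in the general linear group; summing the equations over the types of \<open>W\<close> relative
  to \<open>S\<close> gives a triangular system for these orbit sums. Applied to consecutive dimensions, the same
  injectivity shows that shadows towards the middle level do not decrease cardinalities, which yields
  the Sperner property.
\<close>

section \<open>Linear algebra and incidences of subspaces\<close>

text \<open>A triangular system for orbit sums only needs nonzero diagonal entries. These are
  positive counts, so characteristic zero enters through their invertibility. For each incidence the
  task is to find a numerical label of \<open>W\<close> that bounds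
  \<open>vec.dim (U \<inter> S)\<close> from above for all related \<open>U\<close>, such that every
  \<open>U\<close> has a related \<open>W\<close> attaining the bound. Attaining it is where
  conditions such as \<open>i + j \<le> CARD('n)\<close> come from. The last orbit is
  \<open>{S}\<close>, so its orbit sum is the coefficient at \<open>S\<close>, and \<open>S\<close>
  is arbitrary.

  Injectivity of the Lefschetz map becomes bijectivity because opposite levels have equal size,
  which follows from the injectivity of the complement matrix in both directions. The annihilator
  and the ideal of relations are never compared directly: each is identified with the kernel of the
  coordinate map \<open>coords\<close>, the first by the complement matrix, the second by rewriting
  monomials to a normal form.\<close>

definition level :: "nat \<Rightarrow> ('f::field ^ 'n::finite) set set" where
  "level d = {U. vec.subspace U \<and> vec.dim U = d}"

text \<open>Bases of \<open>S\<close> and of \<open>T\<close> that extend one basis of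
  \<open>S \<inter> T\<close> have an independent union. Intersection dimensions then become
  cardinalities of subsets of \<open>B\<close>, and subspaces in prescribed position are found by
  choosing basis vectors.\<close>

lemma adapted_basis:
  fixes S T :: "('f::field ^ 'n::finite) set"
  assumes "vec.subspace S" "vec.subspace T"
  obtains B where "vec.independent B" "vec.span B = UNIV"
    "vec.span (B \<inter> S) = S" "vec.span (B \<inter> T) = T" "vec.span (B \<inter> (S \<inter> T)) = S \<inter> T"
proof -
  have ST: "vec.subspace (S \<inter> T)" using assms by (rule vec.subspace_inter)
  obtain B1 where B1: "B1 \<subseteq> S \<inter> T" "vec.independent B1" "S \<inter> T \<subseteq> vec.span B1" "card B1 = vec.dim (S \<inter> T)"
    using vec.basis_exists by metis
  obtain B2 where B2: "B1 \<subseteq> B2" "B2 \<subseteq> S" "vec.independent B2" "S \<subseteq> vec.span B2"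
    using vec.maximal_independent_subset_extend[of B1 S] B1 by auto
  obtain B3 where B3: "B1 \<subseteq> B3" "B3 \<subseteq> T" "vec.independent B3" "T \<subseteq> vec.span B3"
    using vec.maximal_independent_subset_extend[of B1 T] B1 by auto
  have fin: "finite B1" "finite B2" "finite B3"
    using B1 B2 B3 vec.finiteI_independent by blast+
  have d2: "card B2 = vec.dim S" using B2 by (metis vec.basis_card_eq_dim)
  have d3: "card B3 = vec.dim T" using B3 by (metis vec.basis_card_eq_dim)
  have "card (B2 \<union> B3) + card (B2 \<inter> B3) = card B2 + card B3"
    using card_Un_Int[OF fin(2,3)] by simp
  moreover have "card B1 \<le> card (B2 \<inter> B3)" using B1 B2 B3 fin by (intro card_mono) auto
  moreover have "vec.dim {x + y |x y. x \<in> S \<and> y \<in> T} + vec.dim (S \<inter> T) = vec.dim S + vec.dim T"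
    using assms by (rule vec.dim_sums_Int)
  \<comment> \<open>By the modular law the union has at most as many elements as the dimension of
    \<open>S + T\<close>, which it spans; a spanning set of that size is independent.\<close>
  ultimately have "card (B2 \<union> B3) \<le> vec.dim {x + y |x y. x \<in> S \<and> y \<in> T}"
    using d2 d3 B1 by linarith
  moreover have "{x + y |x y. x \<in> S \<and> y \<in> T} \<subseteq> vec.span (B2 \<union> B3)"
  proof safe
    fix x y assume "x \<in> S" "y \<in> T"
    then have "x \<in> vec.span (B2 \<union> B3)" "y \<in> vec.span (B2 \<union> B3)"
      using B2 B3 vec.span_mono[of B2 "B2 \<union> B3"] vec.span_mono[of B3 "B2 \<union> B3"] by auto
    then show "x + y \<in> vec.span (B2 \<union> B3)" by (rule vec.span_add)
  qed
  moreover have "B2 \<union> B3 \<subseteq> {x + y |x y. x \<in> S \<and> y \<in> T}"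
  proof
    fix x assume "x \<in> B2 \<union> B3"
    then have "x \<in> S \<or> x \<in> T" using B2 B3 by auto
    moreover have "0 \<in> S" "0 \<in> T" using assms vec.subspace_0 by auto
    ultimately show "x \<in> {x + y |x y. x \<in> S \<and> y \<in> T}"
      by (metis (mono_tags, lifting) add_0 add_0_right mem_Collect_eq)
  qed
  ultimately have "vec.independent (B2 \<union> B3)"
    using fin by (intro vec.card_le_dim_spanning) auto
  then obtain B where B: "B2 \<union> B3 \<subseteq> B" "vec.independent B" "UNIV \<subseteq> vec.span B"
    using vec.maximal_independent_subset_extend[of "B2 \<union> B3" UNIV] by auto
  have eq: "vec.span (B \<inter> X) = X" if "vec.subspace X" "C \<subseteq> B" "C \<subseteq> X" "X \<subseteq> vec.span C" for X C
  proof
    show "vec.span (B \<inter> X) \<subseteq> X" using that by (intro vec.span_minimal) auto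
    have "vec.span C \<subseteq> vec.span (B \<inter> X)" using that by (intro vec.span_mono) auto
    then show "X \<subseteq> vec.span (B \<inter> X)" using that by auto
  qed
  show thesis
  proof
    show "vec.independent B" "vec.span B = UNIV" using B by auto
    show "vec.span (B \<inter> S) = S" using eq[of S B2] assms B B2 by auto
    show "vec.span (B \<inter> T) = T" using eq[of T B3] assms B B3 by auto
    show "vec.span (B \<inter> (S \<inter> T)) = S \<inter> T" using eq[of "S \<inter> T" B1] ST B B1 B2 by auto
  qed
qed

text \<open>Monotonicity of the span gives one inclusion. The modular law for dimensions and
  inclusion-exclusion for cardinalities show that both sides have dimension
  \<open>card (C \<inter> D)\<close>.\<close>

lemma independent_span_Int:
  fixes B :: "('f::field ^ 'n::finite) set"
  assumes "vec.independent B" "C \<subseteq> B" "D \<subseteq> B"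
  shows "vec.span C \<inter> vec.span D = vec.span (C \<inter> D)"
proof -
  have fin: "finite B" using assms vec.finiteI_independent by blast
  have ind: "vec.independent X" if "X \<subseteq> B" for X using assms(1) that by (rule vec.independent_mono)
  have d: "vec.dim (vec.span X) = card X" if "X \<subseteq> B" for X
    using ind[OF that] by (rule vec.dim_span_eq_card_independent)
  let ?S = "{x + y |x y. x \<in> vec.span C \<and> y \<in> vec.span D}"
  have "?S = vec.span (C \<union> D)" by (simp add: vec.span_Un)
  then have "vec.dim ?S = card (C \<union> D)" using d[of "C \<union> D"] assms by simp
  moreover have "vec.dim ?S + vec.dim (vec.span C \<inter> vec.span D) = vec.dim (vec.span C) + vec.dim (vec.span D)"
    by (intro vec.dim_sums_Int) auto
  moreover have "card (C \<union> D) + card (C \<inter> D) = card C + card D"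
    using card_Un_Int[of C D] assms fin finite_subset by metis
  ultimately have "vec.dim (vec.span C \<inter> vec.span D) = card (C \<inter> D)"
    using d[of C] d[of D] assms by linarith
  moreover have "C \<inter> D \<subseteq> B" using assms by auto
  ultimately have "vec.dim (vec.span C \<inter> vec.span D) \<le> vec.dim (vec.span (C \<inter> D))"
    using d[of "C \<inter> D"] by simp
  moreover have "vec.span (C \<inter> D) \<subseteq> vec.span C \<inter> vec.span D" by (simp add: vec.span_mono)
  ultimately show ?thesis
    using vec.subspace_dim_equal[of "vec.span (C \<inter> D)" "vec.span C \<inter> vec.span D"]
    by (simp add: vec.subspace_inter)
qed

section \<open>Orbits of the stabilizer of a subspace\<close>

lemma bij_betw_preserving_label:
  assumes "finite A" "finite B" "\<And>c. card {x\<in>A. l x = c} = card {x\<in>B. m x = c}"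
  shows "\<exists>h. bij_betw h A B \<and> (\<forall>x\<in>A. m (h x) = l x)"
proof -
  have "\<forall>c. \<exists>h. bij_betw h {x\<in>A. l x = c} {x\<in>B. m x = c}"
    using assms by (intro allI finite_same_card_bij) auto
  then obtain H where H: "\<And>c. bij_betw (H c) {x\<in>A. l x = c} {x\<in>B. m x = c}" by metis
  define h where "h x = H (l x) x" for x
  have m: "h x \<in> B \<and> m (h x) = l x" if "x \<in> A" for x
    using H[of "l x"] that by (auto simp: h_def bij_betw_def)
  have "inj_on h A"
  proof (rule inj_onI)
    fix x y assume xy: "x \<in> A" "y \<in> A" "h x = h y"
    then have "l x = l y" using m by metis
    then show "x = y" using H[of "l x"] xy by (auto simp: h_def bij_betw_def inj_on_def)
  qed
  moreover have "y \<in> h ` A" if "y \<in> B" for y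
  proof -
    obtain x where "x \<in> A" "l x = m y" "H (m y) x = y"
      using H[of "m y"] \<open>y \<in> B\<close> unfolding bij_betw_def by force
    then show ?thesis by (force simp: h_def)
  qed
  ultimately have "bij_betw h A B" using m by (auto simp: bij_betw_def)
  then show ?thesis using m by blast
qed

abbreviation lin_auto :: "('f::field ^ 'n::finite \<Rightarrow> 'f ^ 'n) \<Rightarrow> bool" where
  "lin_auto g \<equiv> Vector_Spaces.linear (*s) (*s) g \<and> bij g"

lemma lin_auto_dim:
  assumes "lin_auto g"
  shows "vec.dim (g ` U) = vec.dim U"
  using assms by (auto intro!: vec.dim_image_eq inj_on_subset[of g UNIV] simp: bij_def)

lemma lin_auto_subspace:
  assumes "lin_auto g" "vec.subspace U"
  shows "vec.subspace (g ` U)"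
  using assms by (simp add: vec.linear_subspace_image)

lemma lin_auto_subspace_iff:
  assumes "lin_auto g"
  shows "vec.subspace (g ` U) \<longleftrightarrow> vec.subspace U"
proof
  assume *: "vec.subspace (g ` U)"
  have "U = g -` g ` U" using assms by (simp add: bij_def inj_vimage_image_eq)
  then show "vec.subspace U" using vec.linear_subspace_vimage[of g "g ` U"] assms * by simp
qed (use lin_auto_subspace[OF assms] in auto)

lemma lin_auto_level:
  assumes "lin_auto g"
  shows "g ` U \<in> level d \<longleftrightarrow> U \<in> level d"
  using lin_auto_dim[OF assms] lin_auto_subspace_iff[OF assms] by (auto simp: level_def)

text \<open>The dimensions determine how the vectors of an adapted basis are distributed over the
  four regions cut out by \<open>S\<close> and \<open>T\<close>. A bijection of two adapted bases
  that respects the regions extends linearly to the wanted automorphism.\<close>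

lemma lin_auto_transitive:
  fixes S T T' :: "('f::field ^ 'n::finite) set"
  assumes sub: "vec.subspace S" "vec.subspace T" "vec.subspace T'"
    and dT: "vec.dim T = vec.dim T'" and dST: "vec.dim (T \<inter> S) = vec.dim (T' \<inter> S)"
  obtains g where "lin_auto g" "g ` S = S" "g ` T = T'"
proof -
  obtain B where B: "vec.independent B" "vec.span B = UNIV"
    "vec.span (B \<inter> S) = S" "vec.span (B \<inter> T) = T" "vec.span (B \<inter> (S \<inter> T)) = S \<inter> T"
    using adapted_basis[OF sub(1,2)] .
  obtain B' where B': "vec.independent B'" "vec.span B' = UNIV"
    "vec.span (B' \<inter> S) = S" "vec.span (B' \<inter> T') = T'" "vec.span (B' \<inter> (S \<inter> T')) = S \<inter> T'"
    using adapted_basis[OF sub(1,3)] .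
  have fin: "finite B" "finite B'" using B B' vec.finiteI_independent by blast+
  have d: "card (C \<inter> X) = vec.dim X" if "vec.independent C" "vec.span (C \<inter> X) = X" for C X :: "('f ^ 'n) set"
    using that by (metis Int_lower1 vec.dim_span_eq_card_independent vec.independent_mono)
  have c1: "card (B \<inter> S) = card (B' \<inter> S)" using d B B' by metis
  have c2: "card (B \<inter> T) = card (B' \<inter> T')" using d B B' dT by metis
  have c3: "card (B \<inter> (S \<inter> T)) = card (B' \<inter> (S \<inter> T'))"
    using d[OF B(1,5)] d[OF B'(1,5)] dST by (simp add: Int_commute)
  have c4: "card B = card B'" using d[of B UNIV] d[of B' UNIV] B B' by simp
  \<comment> \<open>Inclusion-exclusion expresses all four region sizes by the four cardinalities
    that agree for \<open>B\<close> and \<open>B'\<close>.\<close>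
  have split: "card {x\<in>C. (x \<in> S, x \<in> X) = c} = (case c of
      (True, True) \<Rightarrow> card (C \<inter> (S \<inter> X))
    | (True, False) \<Rightarrow> card (C \<inter> S) - card (C \<inter> (S \<inter> X))
    | (False, True) \<Rightarrow> card (C \<inter> X) - card (C \<inter> (S \<inter> X))
    | (False, False) \<Rightarrow> card C - (card (C \<inter> S) + card (C \<inter> X) - card (C \<inter> (S \<inter> X))))"
    if "finite C" for C X and c :: "bool \<times> bool"
  proof -
    have 1: "{x\<in>C. x \<in> S \<and> x \<notin> X} = C \<inter> S - C \<inter> (S \<inter> X)" by auto
    have 2: "{x\<in>C. x \<notin> S \<and> x \<in> X} = C \<inter> X - C \<inter> (S \<inter> X)" by auto
    have 3: "{x\<in>C. x \<notin> S \<and> x \<notin> X} = C - (C \<inter> S \<union> C \<inter> X)" by auto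
    have 5: "{x\<in>C. x \<in> S \<and> x \<in> X} = C \<inter> (S \<inter> X)" by auto
    have 4: "C \<inter> S \<inter> (C \<inter> X) = C \<inter> (S \<inter> X)" by auto
    have "card (C \<inter> S \<union> C \<inter> X) = card (C \<inter> S) + card (C \<inter> X) - card (C \<inter> (S \<inter> X))"
      using card_Un_Int[of "C \<inter> S" "C \<inter> X"] that 4 by simp
    moreover have "card (C \<inter> S - C \<inter> (S \<inter> X)) = card (C \<inter> S) - card (C \<inter> (S \<inter> X))"
      using that by (intro card_Diff_subset) auto
    moreover have "card (C \<inter> X - C \<inter> (S \<inter> X)) = card (C \<inter> X) - card (C \<inter> (S \<inter> X))"
      using that by (intro card_Diff_subset) auto
    moreover have "card (C - (C \<inter> S \<union> C \<inter> X)) = card C - card (C \<inter> S \<union> C \<inter> X)"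
      using that by (intro card_Diff_subset) auto
    ultimately show ?thesis
      by (cases c) (auto simp: 1 2 3 5 simp del: Un_Int_distrib split: bool.split)
  qed
  have "card {x\<in>B. (x \<in> S, x \<in> T) = c} = card {x\<in>B'. (x \<in> S, x \<in> T') = c}" for c
    unfolding split[OF fin(1)] split[OF fin(2)] c1 c2 c3 c4 ..
  from bij_betw_preserving_label[OF fin this]
  obtain h where h: "bij_betw h B B'" "\<And>x. x \<in> B \<Longrightarrow> (h x \<in> S, h x \<in> T') = (x \<in> S, x \<in> T)"
    by blast
  define g where "g = vec.construct B h"
  have lin: "Vector_Spaces.linear (*s) (*s) g"
    unfolding g_def using B(1) by (rule vec.linear_construct)
  have gB: "g x = h x" if "x \<in> B" for x unfolding g_def using B(1) that by (rule vec.construct_basis)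
  have im: "g ` vec.span (B \<inter> X) = vec.span (B' \<inter> Y)"
    if "\<And>x. x \<in> B \<Longrightarrow> h x \<in> Y \<longleftrightarrow> x \<in> X" for X Y
  proof -
    have "g ` (B \<inter> X) = h ` (B \<inter> X)" using gB by auto
    also have "\<dots> = B' \<inter> Y" using h(1) that unfolding bij_betw_def by blast
    finally show ?thesis using vec.linear_span_image[OF lin] by metis
  qed
  have "surj g" using im[of UNIV UNIV] B B' by simp
  then have "bij g" using lin vec.linear_surj_imp_inj by (auto simp: bij_def)
  moreover have "g ` S = S" using im[of S S] h(2) B B' by auto
  moreover have "g ` T = T'" using im[of T' T] h(2) B B' by auto
  ultimately show thesis using that lin by blast
qed

text \<open>By transitivity, the number of related \<open>W\<close> with a given label is constant
  on each orbit, so the equations summed over a label involve only orbit sums of \<open>f\<close>.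
  Label \<open>t\<close> sees only orbits with \<open>vec.dim (U \<inter> S) \<le> t\<close>, and
  does see the orbit \<open>t\<close> itself, whence induction on \<open>t\<close>. The kernel
  equations range over all sets \<open>W\<close>, so a restriction of \<open>W\<close> to a level
  belongs into \<open>R\<close>.\<close>

lemma invariant_incidence_kernel:
  fixes f :: "('f::{field,finite} ^ 'n::finite) set \<Rightarrow> 'k::field_char_0"
    and type_of :: "('f ^ 'n) set \<Rightarrow> nat"
  assumes S: "S \<in> level i"
    and inv: "\<And>g U W. lin_auto g \<Longrightarrow> R U W \<Longrightarrow> R (g ` U) (g ` W)"
    and type_inv: "\<And>g W. lin_auto g \<Longrightarrow> g ` S = S \<Longrightarrow> type_of (g ` W) = type_of W"
    and triangular: "\<And>U W. U \<in> level i \<Longrightarrow> R U W \<Longrightarrow> vec.dim (U \<inter> S) \<le> type_of W"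
    and diagonal: "\<And>U. U \<in> level i \<Longrightarrow> \<exists>W. R U W \<and> type_of W = vec.dim (U \<inter> S)"
    and kernel: "\<And>W. (\<Sum>U | U \<in> level i \<and> R U W. f U) = 0"
  shows "f S = 0"
proof -
  define C where "C t = {U \<in> level i. vec.dim (U \<inter> S) = t}" for t
  define N where "N t U = card {W. R U W \<and> type_of W = t}" for t U
  \<comment> \<open>An inequality suffices, since \<open>U\<close> and \<open>U'\<close> can be
    exchanged.\<close>
  have N_eq: "N t U \<le> N t U'" if U: "U \<in> C s" "U' \<in> C s" for s t U U'
  proof -
    obtain g where g: "lin_auto g" "g ` S = S" "g ` U = U'"
      using lin_auto_transitive[of S U U'] S U by (auto simp: C_def level_def)
    have "card {W. R U W \<and> type_of W = t} \<le> card {W. R U' W \<and> type_of W = t}"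
    proof (rule card_inj_on_le)
      show "inj_on ((`) g) {W. R U W \<and> type_of W = t}"
        using g(1) by (auto simp: bij_def inj_on_def inj_image_eq_iff)
      show "(`) g ` {W. R U W \<and> type_of W = t} \<subseteq> {W. R U' W \<and> type_of W = t}"
        using inv[OF g(1), of U] type_inv[OF g(1,2)] g(3) by auto
    qed simp
    then show ?thesis by (simp add: N_def)
  qed
  have zero: "(\<Sum>U\<in>C t. f U) = 0" for t
  proof (induction t rule: less_induct)
    case (less t)
    show ?case
    proof (cases "C t = {}")
      case False
      then obtain V where V: "V \<in> C t" by auto
      \<comment> \<open>After exchanging the sums, each \<open>U\<close> is weighted by the number
        of related \<open>W\<close> of label \<open>t\<close>.\<close>
      have "0 = (\<Sum>W | type_of W = t. \<Sum>U | U \<in> level i \<and> R U W. f U)" by (simp add: kernel)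
      also have "\<dots> = (\<Sum>W | type_of W = t. \<Sum>U\<in>level i. if R U W then f U else 0)"
        by (intro sum.cong refl sum.inter_filter) simp
      also have "\<dots> = (\<Sum>U\<in>level i. \<Sum>W | type_of W = t. if R U W then f U else 0)"
        by (rule sum.swap)
      also have "\<dots> = (\<Sum>U\<in>level i. of_nat (N t U) * f U)"
        by (auto intro!: sum.cong simp: N_def sum.If_cases Int_def conj_commute)
      also have "\<dots> = (\<Sum>s\<le>t. \<Sum>U\<in>C s. of_nat (N t U) * f U)"
      proof (rule sym, subst sum.UNION_disjoint[symmetric])
        show "(\<Sum>U\<in>\<Union>(C ` {..t}). of_nat (N t U) * f U) = (\<Sum>U\<in>level i. of_nat (N t U) * f U)"
        proof (intro sum.mono_neutral_left ballI)
          fix U assume U: "U \<in> level i - \<Union>(C ` {..t})"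
          then have "t < vec.dim (U \<inter> S)" by (auto simp: C_def)
          then have "{W. R U W \<and> type_of W = t} = {}" using triangular[of U] U by fastforce
          then show "of_nat (N t U) * f U = 0" unfolding N_def by simp
        qed (auto simp: C_def)
      qed (auto simp: C_def)
      \<comment> \<open>For \<open>s < t\<close> the constant weight factors out and leaves an orbit
        sum that vanishes by induction.\<close>
      also have "\<dots> = (\<Sum>U\<in>C t. of_nat (N t U) * f U)"
      proof (rule trans[OF sum.mono_neutral_right[of "{..t}" "{t}"]])
        show "\<forall>s\<in>{..t} - {t}. (\<Sum>U\<in>C s. of_nat (N t U) * f U) = 0"
        proof
          fix s assume s: "s \<in> {..t} - {t}"
          have "\<exists>c. \<forall>U\<in>C s. N t U = c" using N_eq[of _ s _ t] by (meson le_antisym)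
          then obtain c where "\<forall>U\<in>C s. N t U = c" by auto
          then have "(\<Sum>U\<in>C s. of_nat (N t U) * f U) = of_nat c * (\<Sum>U\<in>C s. f U)"
            by (auto simp: sum_distrib_left)
          then show "(\<Sum>U\<in>C s. of_nat (N t U) * f U) = 0" using less s by simp
        qed
      qed auto
      also have "\<dots> = of_nat (N t V) * (\<Sum>U\<in>C t. f U)"
        using N_eq[of _ t V t] N_eq[of V t _ t] V by (auto simp: sum_distrib_left le_antisym intro!: sum.cong)
      finally have "of_nat (N t V) * (\<Sum>U\<in>C t. f U) = 0" by simp
      \<comment> \<open>The diagonal entry is a positive count, hence nonzero in characteristic
        zero.\<close>
      moreover have "N t V \<noteq> 0" using diagonal[of V] V by (auto simp: N_def C_def)
      ultimately show ?thesis by simp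
    qed simp
  qed
  have "C i = {S}"
  proof -
    have "U = S" if "U \<in> level i" "vec.dim (U \<inter> S) = i" for U
    proof -
      have "U \<inter> S = U"
        using that by (intro vec.subspace_dim_equal vec.subspace_inter) (use S in \<open>auto simp: level_def\<close>)
      moreover have "U \<inter> S = S"
        using that by (intro vec.subspace_dim_equal vec.subspace_inter) (use S in \<open>auto simp: level_def\<close>)
      ultimately show ?thesis by simp
    qed
    then show ?thesis using S by (auto simp: C_def level_def)
  qed
  then show ?thesis using zero[of i] by simp
qed

section \<open>Inclusion, containment and complementarity as triangular incidences\<close>

lemma lin_auto_dim_Int:
  assumes "lin_auto g" "g ` S = S"
  shows "vec.dim (g ` W \<inter> S) = vec.dim (W \<inter> S)"
  using assms image_Int[of g W S] lin_auto_dim[OF assms(1), of "W \<inter> S"] by (simp add: bij_def)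

lemma adapted_basis_level:
  fixes S T :: "('f::{field,finite} ^ 'n::finite) set"
  assumes "S \<in> level i" "T \<in> level j"
  obtains B where "vec.independent B" "vec.span (B \<inter> S) = S" "vec.span (B \<inter> T) = T"
    "card B = CARD('n)" "card (B \<inter> S) = i" "card (B \<inter> T) = j"
    "card (B \<inter> (S \<inter> T)) = vec.dim (S \<inter> T)"
    "\<And>C. C \<subseteq> B \<Longrightarrow> vec.span C \<in> level (card C)"
    "\<And>C D. C \<subseteq> B \<Longrightarrow> D \<subseteq> B \<Longrightarrow> vec.span C \<inter> vec.span D = vec.span (C \<inter> D)"
proof -
  obtain B where B: "vec.independent B" "vec.span B = UNIV"
    "vec.span (B \<inter> S) = S" "vec.span (B \<inter> T) = T" "vec.span (B \<inter> (S \<inter> T)) = S \<inter> T"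
    using adapted_basis[of S T] assms by (auto simp: level_def)
  have d: "vec.dim (vec.span C) = card C" if "C \<subseteq> B" for C
    using vec.independent_mono[OF B(1) that] by (rule vec.dim_span_eq_card_independent)
  show thesis
  proof
    show "card B = CARD('n)" using d[of B] B(2) vec_dim_card[where 'a = 'f and 'n = 'n] by (simp del: vec.dim_UNIV)
    show "card (B \<inter> S) = i" "card (B \<inter> T) = j" "card (B \<inter> (S \<inter> T)) = vec.dim (S \<inter> T)"
      using d[of "B \<inter> S"] d[of "B \<inter> T"] d[of "B \<inter> (S \<inter> T)"] B assms by (simp_all add: level_def)
  qed (use B d independent_span_Int[OF B(1)] in \<open>auto simp: level_def\<close>)
qed

lemma subspace_Int_eq_zero_iff:
  assumes "vec.subspace U" "vec.subspace W"
  shows "U \<inter> W = {0} \<longleftrightarrow> vec.dim (U \<inter> W) = 0"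
  using assms vec.subspace_0[of "U \<inter> W"] vec.subspace_inter[of U W] by auto

lemma dim_Int_ge:
  fixes S T V :: "('f::field ^ 'n::finite) set"
  assumes "vec.subspace S" "vec.subspace T" "vec.subspace V" "S \<subseteq> V" "T \<subseteq> V"
  shows "vec.dim S + vec.dim T \<le> vec.dim V + vec.dim (S \<inter> T)"
proof -
  have "{x + y |x y. x \<in> S \<and> y \<in> T} \<subseteq> V"
    using assms vec.subspace_add by blast
  then have "vec.dim {x + y |x y. x \<in> S \<and> y \<in> T} \<le> vec.dim V" by (rule vec.dim_subset)
  then show ?thesis using vec.dim_sums_Int[OF assms(1,2)] by linarith
qed

text \<open>Enlarging \<open>U\<close> to \<open>W\<close> can only enlarge the trace on
  \<open>S\<close>, which suggests its dimension as label. The trace stays the same when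
  \<open>U\<close> is extended by basis vectors outside both \<open>U\<close> and \<open>S\<close>;
  \<open>i + j \<le> CARD('n)\<close> guarantees enough of them.\<close>

lemma inclusion_kernel:
  fixes f :: "('f::{field,finite} ^ 'n::finite) set \<Rightarrow> 'k::field_char_0"
  assumes S: "S \<in> level i" and ij: "i \<le> j" "i + j \<le> CARD('n)"
    and kernel: "\<And>W. W \<in> level j \<Longrightarrow> (\<Sum>U | U \<in> level i \<and> U \<subseteq> W. f U) = 0"
  shows "f S = 0"
proof (rule invariant_incidence_kernel[OF S, where R = "\<lambda>U W. W \<in> level j \<and> U \<subseteq> W"
      and type_of = "\<lambda>W. vec.dim (W \<inter> S)"])
  fix g :: "'f ^ 'n \<Rightarrow> 'f ^ 'n" and U W :: "('f ^ 'n) set" assume "lin_auto g" "W \<in> level j \<and> U \<subseteq> W"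
  then show "g ` W \<in> level j \<and> g ` U \<subseteq> g ` W" by (simp add: lin_auto_level image_mono)
next
  fix U W :: "('f ^ 'n) set" assume "W \<in> level j \<and> U \<subseteq> W"
  then show "vec.dim (U \<inter> S) \<le> vec.dim (W \<inter> S)" by (intro vec.dim_subset) auto
next
  fix U :: "('f ^ 'n) set" assume U: "U \<in> level i"
  obtain B where B: "vec.independent B" "vec.span (B \<inter> S) = S" "vec.span (B \<inter> U) = U"
    "card B = CARD('n)" "card (B \<inter> S) = i" "card (B \<inter> U) = i"
    "card (B \<inter> (S \<inter> U)) = vec.dim (S \<inter> U)"
    "\<And>C. C \<subseteq> B \<Longrightarrow> vec.span C \<in> level (card C)"
    "\<And>C D. C \<subseteq> B \<Longrightarrow> D \<subseteq> B \<Longrightarrow> vec.span C \<inter> vec.span D = vec.span (C \<inter> D)"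
    by (rule adapted_basis_level[OF S \<open>U \<in> level i\<close>]) blast
  have "card (B \<inter> S \<union> B \<inter> U) \<le> i + i" using card_Un_le[of "B \<inter> S" "B \<inter> U"] B by simp
  moreover have "card (B - (B \<inter> S \<union> B \<inter> U)) = card B - card (B \<inter> S \<union> B \<inter> U)"
    by (intro card_Diff_subset) auto
  \<comment> \<open>At most \<open>2 * i\<close> basis vectors lie in \<open>S\<close> or
    \<open>U\<close>, so at least \<open>CARD('n) - 2 * i \<ge> j - i\<close> are left.\<close>
  ultimately have "j - i \<le> card (B - (B \<inter> S \<union> B \<inter> U))" using ij B by linarith
  then obtain C where C: "C \<subseteq> B - (B \<inter> S \<union> B \<inter> U)" "card C = j - i"
    by (meson obtain_subset_with_card_n)
  let ?W = "vec.span (B \<inter> U \<union> C)"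
  have "card (B \<inter> U \<union> C) = i + (j - i)"
    using C B by (subst card_Un_disjoint) auto
  then have "?W \<in> level j" using B(8)[of "B \<inter> U \<union> C"] C ij by auto
  moreover have "U \<subseteq> ?W" using vec.span_mono[of "B \<inter> U" "B \<inter> U \<union> C"] B(3) by auto
  moreover have "vec.dim (?W \<inter> S) = vec.dim (U \<inter> S)"
  proof -
    have "(B \<inter> U \<union> C) \<inter> (B \<inter> S) = (B \<inter> U) \<inter> (B \<inter> S)" using C by auto
    then have "?W \<inter> vec.span (B \<inter> S) = vec.span (B \<inter> U) \<inter> vec.span (B \<inter> S)"
      using B(9)[of "B \<inter> U \<union> C" "B \<inter> S"] B(9)[of "B \<inter> U" "B \<inter> S"] C by auto
    then show ?thesis using B by simp
  qed
  ultimately show "\<exists>W. (W \<in> level j \<and> U \<subseteq> W) \<and> vec.dim (W \<inter> S) = vec.dim (U \<inter> S)" by blast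
next
  fix W show "(\<Sum>U | U \<in> level i \<and> W \<in> level j \<and> U \<subseteq> W. f U) = 0"
    using kernel[of W] by (cases "W \<in> level j") auto
qed (rule lin_auto_dim_Int)

text \<open>Passing from \<open>U\<close> to a subspace of codimension \<open>i - j\<close> lowers
  the dimension of the trace on \<open>S\<close> by at most \<open>i - j\<close>, hence the shift in
  the label. The loss is largest when all removed basis vectors lie in \<open>S \<inter> U\<close>,
  and \<open>CARD('n) \<le> i + j\<close> makes this intersection large enough.\<close>

lemma containment_kernel:
  fixes f :: "('f::{field,finite} ^ 'n::finite) set \<Rightarrow> 'k::field_char_0"
  assumes S: "S \<in> level i" and ij: "j \<le> i" "CARD('n) \<le> i + j"
    and kernel: "\<And>W. W \<in> level j \<Longrightarrow> (\<Sum>U | U \<in> level i \<and> W \<subseteq> U. f U) = 0"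
  shows "f S = 0"
proof (rule invariant_incidence_kernel[OF S, where R = "\<lambda>U W. W \<in> level j \<and> W \<subseteq> U"
      and type_of = "\<lambda>W. vec.dim (W \<inter> S) + (i - j)"])
  fix g :: "'f ^ 'n \<Rightarrow> 'f ^ 'n" and U W :: "('f ^ 'n) set" assume "lin_auto g" "W \<in> level j \<and> W \<subseteq> U"
  then show "g ` W \<in> level j \<and> g ` W \<subseteq> g ` U" by (simp add: lin_auto_level image_mono)
next
  fix U W :: "('f ^ 'n) set" assume *: "U \<in> level i" "W \<in> level j \<and> W \<subseteq> U"
  then have "vec.dim W + vec.dim (U \<inter> S) \<le> vec.dim U + vec.dim (W \<inter> (U \<inter> S))"
    using S by (intro dim_Int_ge vec.subspace_inter) (auto simp: level_def)
  moreover have "W \<inter> (U \<inter> S) = W \<inter> S" using * by auto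
  ultimately show "vec.dim (U \<inter> S) \<le> vec.dim (W \<inter> S) + (i - j)"
    using * by (simp add: level_def)
next
  fix U :: "('f ^ 'n) set" assume U: "U \<in> level i"
  obtain B where B: "vec.independent B" "vec.span (B \<inter> S) = S" "vec.span (B \<inter> U) = U"
    "card B = CARD('n)" "card (B \<inter> S) = i" "card (B \<inter> U) = i"
    "card (B \<inter> (S \<inter> U)) = vec.dim (S \<inter> U)"
    "\<And>C. C \<subseteq> B \<Longrightarrow> vec.span C \<in> level (card C)"
    "\<And>C D. C \<subseteq> B \<Longrightarrow> D \<subseteq> B \<Longrightarrow> vec.span C \<inter> vec.span D = vec.span (C \<inter> D)"
    by (rule adapted_basis_level[OF S \<open>U \<in> level i\<close>]) blast
  \<comment> \<open>Two subspaces of dimension \<open>i\<close> meet in dimension at least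
    \<open>2 * i - CARD('n)\<close>, and this is at least \<open>i - j\<close>.\<close>
  have "vec.dim S + vec.dim U \<le> vec.dim (UNIV :: ('f ^ 'n) set) + vec.dim (S \<inter> U)"
    using S U by (intro dim_Int_ge) (auto simp: level_def)
  then have "i + i \<le> CARD('n) + vec.dim (S \<inter> U)"
    using S U by (simp add: level_def vec_dim_card del: vec.dim_UNIV)
  then have le: "i - j \<le> card (B \<inter> (S \<inter> U))" using ij B by linarith
  then obtain C where C: "C \<subseteq> B \<inter> (S \<inter> U)" "card C = i - j"
    by (meson obtain_subset_with_card_n)
  let ?W = "vec.span (B \<inter> U - C)"
  have "card (B \<inter> U - C) = i - (i - j)"
    using C B by (subst card_Diff_subset) auto
  then have "?W \<in> level j" using B(8)[of "B \<inter> U - C"] ij by auto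
  moreover have "?W \<subseteq> U" using vec.span_mono[of "B \<inter> U - C" "B \<inter> U"] B(3) by auto
  moreover have "vec.dim (?W \<inter> S) + (i - j) = vec.dim (U \<inter> S)"
  proof -
    have eq: "(B \<inter> U - C) \<inter> (B \<inter> S) = B \<inter> (S \<inter> U) - C" by auto
    have "?W \<inter> vec.span (B \<inter> S) = vec.span (B \<inter> (S \<inter> U) - C)"
      using B(9)[of "B \<inter> U - C" "B \<inter> S"] unfolding eq by auto
    then have "?W \<inter> S \<in> level (card (B \<inter> (S \<inter> U) - C))"
      using B(8)[of "B \<inter> (S \<inter> U) - C"] B(2) by auto
    moreover have "card (B \<inter> (S \<inter> U) - C) = card (B \<inter> (S \<inter> U)) - (i - j)"
      using C by (subst card_Diff_subset) auto
    ultimately show ?thesis using le B(7) by (simp add: level_def Int_commute)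
  qed
  ultimately show "\<exists>W. (W \<in> level j \<and> W \<subseteq> U) \<and> vec.dim (W \<inter> S) + (i - j) = vec.dim (U \<inter> S)"
    by blast
next
  fix W show "(\<Sum>U | U \<in> level i \<and> W \<in> level j \<and> W \<subseteq> U. f U) = 0"
    using kernel[of W] by (cases "W \<in> level j") auto
qed (simp add: lin_auto_dim_Int)

text \<open>If \<open>U\<close> and \<open>W\<close> meet trivially, so do their traces on
  \<open>S\<close>, whose dimensions therefore add up to at most \<open>i\<close>; this dictates the
  label. Equality holds for the complement of \<open>U\<close> spanned by the remaining vectors of a
  basis adapted to \<open>S\<close> and \<open>U\<close>.\<close>

lemma complement_kernel:
  fixes f :: "('f::{field,finite} ^ 'n::finite) set \<Rightarrow> 'k::field_char_0"
  assumes S: "S \<in> level i"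
    and kernel: "\<And>W. W \<in> level (CARD('n) - i) \<Longrightarrow> (\<Sum>U | U \<in> level i \<and> U \<inter> W = {0}. f U) = 0"
  shows "f S = 0"
proof (rule invariant_incidence_kernel[OF S, where R = "\<lambda>U W. W \<in> level (CARD('n) - i) \<and> U \<inter> W = {0}"
      and type_of = "\<lambda>W. i - vec.dim (W \<inter> S)"])
  fix g :: "'f ^ 'n \<Rightarrow> 'f ^ 'n" and U W :: "('f ^ 'n) set" assume *: "lin_auto g" "W \<in> level (CARD('n) - i) \<and> U \<inter> W = {0}"
  then have "g ` U \<inter> g ` W = {0}"
    using image_Int[of g U W] vec.linear_0[of g] by (auto simp: bij_def)
  with * show "g ` W \<in> level (CARD('n) - i) \<and> g ` U \<inter> g ` W = {0}" by (simp add: lin_auto_level)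
next
  fix U W :: "('f ^ 'n) set" assume *: "U \<in> level i" "W \<in> level (CARD('n) - i) \<and> U \<inter> W = {0}"
  then have "vec.dim (U \<inter> S) + vec.dim (W \<inter> S) \<le> vec.dim S + vec.dim ((U \<inter> S) \<inter> (W \<inter> S))"
    using S by (intro dim_Int_ge vec.subspace_inter) (auto simp: level_def)
  moreover have "(U \<inter> S) \<inter> (W \<inter> S) \<subseteq> {0}" using * by auto
  then have "vec.dim ((U \<inter> S) \<inter> (W \<inter> S)) = 0" by (simp only: vec.dim_eq_0)
  ultimately show "vec.dim (U \<inter> S) \<le> i - vec.dim (W \<inter> S)"
    using S by (simp add: level_def)
next
  fix U :: "('f ^ 'n) set" assume U: "U \<in> level i"
  obtain B where B: "vec.independent B" "vec.span (B \<inter> S) = S" "vec.span (B \<inter> U) = U"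
    "card B = CARD('n)" "card (B \<inter> S) = i" "card (B \<inter> U) = i"
    "card (B \<inter> (S \<inter> U)) = vec.dim (S \<inter> U)"
    "\<And>C. C \<subseteq> B \<Longrightarrow> vec.span C \<in> level (card C)"
    "\<And>C D. C \<subseteq> B \<Longrightarrow> D \<subseteq> B \<Longrightarrow> vec.span C \<inter> vec.span D = vec.span (C \<inter> D)"
    by (rule adapted_basis_level[OF S \<open>U \<in> level i\<close>]) blast
  let ?W = "vec.span (B - B \<inter> U)"
  have "card (B - B \<inter> U) = CARD('n) - i"
    using B by (subst card_Diff_subset) auto
  then have "?W \<in> level (CARD('n) - i)" using B(8)[of "B - B \<inter> U"] by auto
  moreover have "U \<inter> ?W = {0}"
  proof -
    have eq: "B \<inter> U \<inter> (B - B \<inter> U) = {}" by auto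
    show ?thesis using B(9)[of "B \<inter> U" "B - B \<inter> U"] B(3) unfolding eq by (simp add: vec.span_empty)
  qed
  moreover have "i - vec.dim (?W \<inter> S) = vec.dim (U \<inter> S)"
  proof -
    have eq: "(B - B \<inter> U) \<inter> (B \<inter> S) = B \<inter> S - B \<inter> (S \<inter> U)" by auto
    have "?W \<inter> vec.span (B \<inter> S) = vec.span (B \<inter> S - B \<inter> (S \<inter> U))"
      using B(9)[of "B - B \<inter> U" "B \<inter> S"] unfolding eq by auto
    then have "?W \<inter> S \<in> level (card (B \<inter> S - B \<inter> (S \<inter> U)))"
      using B(8)[of "B \<inter> S - B \<inter> (S \<inter> U)"] B(2) by auto
    moreover have "card (B \<inter> S - B \<inter> (S \<inter> U)) = i - card (B \<inter> (S \<inter> U))"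
      using B(5) by (subst card_Diff_subset) auto
    moreover have "card (B \<inter> (S \<inter> U)) \<le> i" unfolding B(5)[symmetric] by (intro card_mono) auto
    ultimately show ?thesis using B(7) by (simp add: level_def Int_commute)
  qed
  ultimately show "\<exists>W. (W \<in> level (CARD('n) - i) \<and> U \<inter> W = {0}) \<and> i - vec.dim (W \<inter> S) = vec.dim (U \<inter> S)"
    by blast
next
  fix W show "(\<Sum>U | U \<in> level i \<and> W \<in> level (CARD('n) - i) \<and> U \<inter> W = {0}. f U) = 0"
    using kernel[of W] by (cases "W \<in> level (CARD('n) - i)") auto
qed (simp add: lin_auto_dim_Int)

section \<open>Counting subspaces\<close>

lemma card_span_independent:
  fixes B :: "('f::{field,finite} ^ 'n::finite) set"
  assumes "vec.independent B"
  shows "card (vec.span B) = CARD('f) ^ card B"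
proof -
  have "finite B" by simp
  then show ?thesis using assms
  proof (induction B rule: finite_induct)
    case (insert b B)
    have b: "b \<notin> vec.span B" and ind: "vec.independent B"
      using insert.prems insert.hyps by (auto simp: vec.independent_insert)
    have "bij_betw (\<lambda>(k, y). k *s b + y) (UNIV \<times> vec.span B) (vec.span (insert b B))"
    proof (rule bij_betw_imageI)
      show "inj_on (\<lambda>(k, y). k *s b + y) (UNIV \<times> vec.span B)"
      proof (rule inj_onI, safe)
        fix k l :: 'f and y z assume yz: "y \<in> vec.span B" "z \<in> vec.span B" and eq: "k *s b + y = l *s b + z"
        have "(k - l) *s b = z - y" using eq by (simp add: vec.scale_left_diff_distrib algebra_simps)
        then have "(k - l) *s b \<in> vec.span B" using yz by (simp add: vec.span_diff)
        then have "inverse (k - l) *s ((k - l) *s b) \<in> vec.span B" by (rule vec.span_scale)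
        then have "k - l = 0" using b by (cases "k - l = 0") (simp_all del: right_minus_eq)
        then show "k = l" "y = z" using eq by auto
      qed
      show "(\<lambda>(k, y). k *s b + y) ` (UNIV \<times> vec.span B) = vec.span (insert b B)"
        unfolding vec.span_insert
        by (auto simp: image_iff intro: exI[of _ "x - k *s b" for x k]) (metis add_diff_cancel_left' diff_add_cancel add.commute)+
    qed
    then have "card (vec.span (insert b B)) = card ((UNIV :: 'f set) \<times> vec.span B)"
      by (rule bij_betw_same_card[symmetric])
    then show ?case using insert ind by (simp add: card_cartesian_product)
  qed (simp add: vec.span_empty)
qed

lemma card_subspace:
  fixes U :: "('f::{field,finite} ^ 'n::finite) set"
  assumes "vec.subspace U"
  shows "card U = CARD('f) ^ vec.dim U"
proof -
  obtain B where B: "B \<subseteq> U" "vec.independent B" "U \<subseteq> vec.span B" "card B = vec.dim U"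
    using vec.basis_exists by metis
  then have "vec.span B = U" using assms vec.span_minimal by blast
  then show ?thesis using card_span_independent[OF B(2)] B(4) by simp
qed

lemma CARD_field_ge_2: "2 \<le> CARD('f::{field,finite})"
proof -
  have "card {0, 1 :: 'f} \<le> CARD('f)" by (intro card_mono) auto
  then show ?thesis by simp
qed

definition points :: "('f::field ^ 'n::finite) set \<Rightarrow> ('f ^ 'n) set set" where
  "points U = {e \<in> proj_space. e \<subseteq> U}"

text \<open>Distinct points share only \<open>0\<close>, so the nonzero vectors of \<open>U\<close>
  are partitioned by its points into blocks of size \<open>CARD('f) - 1\<close>.\<close>

lemma card_points:
  fixes U :: "('f::{field,finite} ^ 'n::finite) set"
  assumes U: "vec.subspace U"
  shows "card (points U) * (CARD('f) - 1) = CARD('f) ^ vec.dim U - 1"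
proof -
  have e: "0 \<in> e" "card e = CARD('f)" if "e \<in> points U" for e
    using that card_subspace[of e] vec.subspace_0[of e] by (auto simp: points_def proj_space_def)
  have "card (\<Union>e\<in>points U. e - {0}) = (\<Sum>e\<in>points U. card (e - {0}))"
  proof (intro card_UN_disjoint ballI impI)
    fix e e' assume ee: "e \<in> points U" "e' \<in> points U" "e \<noteq> e'"
    have False if "x \<in> e" "x \<in> e'" "x \<noteq> 0" for x
      using proj_space_span[of e x] proj_space_span[of e' x] that ee by (auto simp: points_def)
    then show "(e - {0}) \<inter> (e' - {0}) = {}" by blast
  qed simp_all
  also have "\<dots> = card (points U) * (CARD('f) - 1)" using e by simp
  also have "(\<Union>e\<in>points U. e - {0}) = U - {0}"
  proof
    show "U - {0} \<subseteq> (\<Union>e\<in>points U. e - {0})"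
    proof
      fix x assume x: "x \<in> U - {0}"
      then have "vec.span {x} \<in> points U"
        using U by (auto simp: points_def proj_space_def vec.span_minimal)
      then show "x \<in> (\<Union>e\<in>points U. e - {0})" using x vec.span_base[of x "{x}"] by auto
    qed
  qed (auto simp: points_def)
  also have "card (U - {0}) = CARD('f) ^ vec.dim U - 1"
    using U vec.subspace_0[OF U] by (simp add: card_subspace)
  finally show ?thesis by simp
qed

lemma card_points_eq:
  fixes U W :: "('f::{field,finite} ^ 'n::finite) set"
  assumes "vec.subspace U" "vec.subspace W" "vec.dim U = vec.dim W"
  shows "card (points U) = card (points W)"
proof -
  have "card (points U) * (CARD('f) - 1) = card (points W) * (CARD('f) - 1)"
    using assms by (simp only: card_points)
  then show ?thesis using CARD_field_ge_2[where 'f = 'f] by simp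
qed

section \<open>Ordered bases and Gaussian binomial coefficients\<close>

definition frames :: "nat \<Rightarrow> ('f::field ^ 'n::finite) set \<Rightarrow> ('f ^ 'n) list set" where
  "frames d U = {xs. length xs = d \<and> distinct xs \<and> set xs \<subseteq> U \<and> vec.independent (set xs)}"

lemma finite_frames: "finite (frames d (U :: ('f::{field,finite} ^ 'n::finite) set))"
  by (rule finite_subset[OF _ finite_lists_length_eq[of UNIV d]]) (auto simp: frames_def)

text \<open>The vector put in front may be any vector of \<open>U\<close> outside the span of the
  others. For \<open>d > vec.dim U\<close> both sides vanish, the product because of its factor at
  \<open>j = vec.dim U\<close>.\<close>

lemma card_frames:
  fixes U :: "('f::{field,finite} ^ 'n::finite) set"
  assumes U: "vec.subspace U"
  shows "card (frames d U) = (\<Prod>j<d. CARD('f) ^ vec.dim U - CARD('f) ^ j)"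
proof (induction d)
  case 0
  have "frames 0 U = {[]}" by (auto simp: frames_def vec.independent_empty)
  then show ?case by simp
next
  case (Suc d)
  have eq: "frames (Suc d) U = (\<lambda>(xs, x). x # xs) ` (SIGMA xs:frames d U. U - vec.span (set xs))"
  proof (intro equalityI subsetI)
    fix ys assume "ys \<in> frames (Suc d) U"
    then obtain x xs where "ys = x # xs" "length xs = d" "x \<notin> set xs" "distinct xs" "x \<in> U" "set xs \<subseteq> U"
        "vec.independent (insert x (set xs))"
      by (cases ys) (auto simp: frames_def)
    then show "ys \<in> (\<lambda>(xs, x). x # xs) ` (SIGMA xs:frames d U. U - vec.span (set xs))"
      by (intro image_eqI[of _ _ "(xs, x)"]) (auto simp: frames_def vec.independent_insert)
  next
    fix ys assume "ys \<in> (\<lambda>(xs, x). x # xs) ` (SIGMA xs:frames d U. U - vec.span (set xs))"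
    then obtain x xs where "ys = x # xs" "xs \<in> frames d U" "x \<in> U" "x \<notin> vec.span (set xs)" by auto
    then show "ys \<in> frames (Suc d) U"
      using vec.span_base[of x "set xs"] by (auto simp: frames_def vec.independent_insertI)
  qed
  have "card (U - vec.span (set xs)) = CARD('f) ^ vec.dim U - CARD('f) ^ d" if "xs \<in> frames d U" for xs
  proof -
    have xs: "vec.independent (set xs)" "card (set xs) = d" "vec.span (set xs) \<subseteq> U"
      using that U vec.span_minimal by (auto simp: frames_def distinct_card)
    then show ?thesis
      using card_span_independent[OF xs(1)] card_subspace[OF U] by (simp add: card_Diff_subset)
  qed
  moreover have "inj_on (\<lambda>(xs, x). x # xs) (SIGMA xs:frames d U. U - vec.span (set xs))"
    by (auto simp: inj_on_def)
  ultimately have "card (frames (Suc d) U) = (\<Sum>xs\<in>frames d U. CARD('f) ^ vec.dim U - CARD('f) ^ d)"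
    unfolding eq by (subst card_image) (simp_all add: finite_frames)
  then show ?case using Suc by simp
qed

text \<open>Double counting: every frame of length \<open>d\<close> of the whole space is a frame of
  exactly one subspace of dimension \<open>d\<close>, namely its span.\<close>

lemma card_level_mult:
  "card (level d :: ('f::{field,finite} ^ 'n::finite) set set) * (\<Prod>j<d. CARD('f) ^ d - CARD('f) ^ j)
    = (\<Prod>j<d. CARD('f) ^ CARD('n) - CARD('f) ^ j)"
proof -
  let ?L = "level d :: ('f ^ 'n) set set"
  have span: "vec.span (set xs) = U" if "U \<in> ?L" "xs \<in> frames d U" for U xs
    using that vec.span_minimal[of "set xs" U]
    by (intro vec.subspace_dim_equal) (auto simp: frames_def level_def vec.dim_eq_card_independent distinct_card)
  have "frames d (UNIV :: ('f ^ 'n) set) = (\<Union>U\<in>?L. frames d U)"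
  proof (intro equalityI subsetI)
    fix xs assume xs: "xs \<in> frames d (UNIV :: ('f ^ 'n) set)"
    then have "vec.span (set xs) \<in> ?L"
      by (auto simp: frames_def level_def vec.dim_eq_card_independent distinct_card)
    moreover have "xs \<in> frames d (vec.span (set xs))"
      using xs by (auto simp: frames_def vec.span_base)
    ultimately show "xs \<in> (\<Union>U\<in>?L. frames d U)" by blast
  qed (auto simp: frames_def)
  then have "card (frames d (UNIV :: ('f ^ 'n) set)) = card (\<Union>U\<in>?L. frames d U)" by simp
  also have "\<dots> = (\<Sum>U\<in>?L. card (frames d U))"
  proof (intro card_UN_disjoint ballI impI)
    fix U U' assume UU: "U \<in> ?L" "U' \<in> ?L" "U \<noteq> U'"
    show "frames d U \<inter> frames d U' = {}" using span[OF UU(1)] span[OF UU(2)] UU(3) by blast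
  qed (simp_all add: finite_frames)
  also have "\<dots> = card ?L * (\<Prod>j<d. CARD('f) ^ d - CARD('f) ^ j)"
    by (simp add: level_def card_frames)
  finally show ?thesis
    using card_frames[of "UNIV :: ('f ^ 'n) set" d] vec_dim_card[where 'a = 'f and 'n = 'n]
    by (simp del: vec.dim_UNIV)
qed

lemma card_level:
  assumes "d \<le> CARD('n)"
  shows "of_nat (card (level d :: ('f::{field,finite} ^ 'n::finite) set set)) = q_binomial CARD('f) CARD('n) d"
proof -
  let ?q = "of_nat CARD('f) :: rat"
  have q: "?q > 1" using CARD_field_ge_2[where 'f = 'f] by simp
  \<comment> \<open>Splitting \<open>?q ^ j\<close> off each factor leaves the numerator or
    denominator of the Gaussian binomial. The powers split off are the same for
    \<open>m = CARD('n)\<close> and \<open>m = d\<close> and cancel.\<close>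
  have prod: "of_nat (\<Prod>j<d. CARD('f) ^ m - CARD('f) ^ j) = (\<Prod>j<d. ?q ^ j) * (\<Prod>j<d. ?q ^ (m - j) - 1)"
    if "d \<le> m" for m
  proof -
    have "of_nat (CARD('f) ^ m - CARD('f) ^ j) = ?q ^ j * (?q ^ (m - j) - 1)" if "j < d" for j
    proof -
      have "CARD('f) ^ j \<le> CARD('f) ^ m" using that \<open>d \<le> m\<close> CARD_field_ge_2[where 'f = 'f]
        by (intro power_increasing) auto
      then show ?thesis using that \<open>d \<le> m\<close> by (simp add: of_nat_diff algebra_simps flip: power_add)
    qed
    then show ?thesis unfolding of_nat_prod by (simp add: prod.distrib)
  qed
  have "of_nat (card (level d :: ('f ^ 'n) set set)) * ((\<Prod>j<d. ?q ^ j) * (\<Prod>j<d. ?q ^ (d - j) - 1))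
      = (\<Prod>j<d. ?q ^ j) * (\<Prod>j<d. ?q ^ (CARD('n) - j) - 1)"
    using card_level_mult[where 'f = 'f and 'n = 'n and d = d]
    unfolding prod[OF assms, symmetric] prod[OF order_refl, symmetric] by (metis of_nat_mult)
  moreover have "(\<Prod>j<d. ?q ^ j) \<noteq> 0" using q by simp
  moreover have "(\<Prod>j<d. ?q ^ (d - j) - 1) \<noteq> 0"
  proof -
    have "?q ^ (d - j) \<noteq> 1" if "j < d" for j
      using one_less_power[OF q, of "d - j"] that by (metis less_irrefl zero_less_diff)
    then show ?thesis by auto
  qed
  ultimately show ?thesis by (simp add: q_binomial_def prod_dividef field_simps)
qed

lemma level_empty: "CARD('n) < d \<Longrightarrow> (level d :: ('f::field ^ 'n::finite) set set) = {}"
  using vec.dim_subset_UNIV[where ?'a = 'f and ?'b = 'n] vec_dim_card[where 'a = 'f and 'n = 'n]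
  by (auto simp: level_def vec.dimension_def[symmetric]) (metis leD vec.dim_subset subset_UNIV)

section \<open>The Sperner property\<close>

text \<open>A function space on a subset is encoded as a coordinate subspace of one ambient space,
  so that linear maps between different levels live over a single finite index type.\<close>

definition supported :: "'a set \<Rightarrow> ('k::field ^ 'a::finite) set" where
  "supported T = {v. \<forall>x. x \<notin> T \<longrightarrow> v $ x = 0}"

lemma dim_supported: "vec.dim (supported T) = card T"
  unfolding supported_def by (rule dim_substandard_cart)

lemma subspace_supported: "vec.subspace (supported T)"
  by (auto simp: supported_def vec.subspace_def)

lemma injective_supported:
  fixes F :: "'k::field ^ 'a::finite \<Rightarrow> 'k ^ 'b::finite"
  assumes lin: "Vector_Spaces.linear (*s) (*s) F"
    and kernel: "\<And>v. v \<in> supported T \<Longrightarrow> F v = 0 \<Longrightarrow> v = 0"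
  shows "inj_on F (supported T)" "vec.dim (F ` supported T) = card T"
proof -
  interpret F: Vector_Spaces.linear "(*s)" "(*s)" F by (rule lin)
  show inj: "inj_on F (supported T)"
  proof (rule inj_onI)
    fix v w assume "v \<in> supported T" "w \<in> supported T" "F v = F w"
    then have "v - w = 0" by (intro kernel) (auto simp: F.diff supported_def)
    then show "v = w" by simp
  qed
  then show "vec.dim (F ` supported T) = card T"
    using vec.dim_image_eq[OF lin, of "supported T"] vec.span_eq_iff[THEN iffD2, OF subspace_supported[of T]]
    by (metis dim_supported)
qed

lemma card_le_if_injective:
  fixes F :: "'k::field ^ 'a::finite \<Rightarrow> 'k ^ 'b::finite"
  assumes "Vector_Spaces.linear (*s) (*s) F"
    and "\<And>v. v \<in> supported T \<Longrightarrow> F v = 0 \<Longrightarrow> v = 0"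
    and "\<And>v. v \<in> supported T \<Longrightarrow> F v \<in> supported S"
  shows "card T \<le> card S"
proof -
  have "vec.dim (F ` supported T) \<le> vec.dim (supported S :: ('k ^ 'b) set)"
    using assms(3) by (intro vec.dim_subset) auto
  then show ?thesis using injective_supported(2)[OF assms(1,2)] by (simp add: dim_supported)
qed

lemma bij_betw_supported:
  fixes F :: "'k::field ^ 'a::finite \<Rightarrow> 'k ^ 'b::finite"
  assumes lin: "Vector_Spaces.linear (*s) (*s) F"
    and kernel: "\<And>v. v \<in> supported T \<Longrightarrow> F v = 0 \<Longrightarrow> v = 0"
    and range: "\<And>v. v \<in> supported T \<Longrightarrow> F v \<in> supported S"
    and card: "card T = card S"
  shows "bij_betw F (supported T) (supported S)"
proof (rule bij_betw_imageI)
  show "inj_on F (supported T)" using injective_supported(1)[OF lin kernel] .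
  show "F ` supported T = supported S"
    using injective_supported(2)[OF lin kernel] range card vec.linear_subspace_image[OF lin subspace_supported]
    by (intro vec.subspace_dim_equal) (auto simp: subspace_supported dim_supported)
qed

text \<open>Only the rows are restricted, to \<open>S\<close>; the restriction of the columns is
  left to the support of \<open>v\<close>.\<close>

definition incidence :: "'b set \<Rightarrow> ('a \<Rightarrow> 'b \<Rightarrow> bool) \<Rightarrow> 'k ^ 'a \<Rightarrow> 'k::field ^ 'b" where
  "incidence S R v = (\<chi> W. if W \<in> S then (\<Sum>U | R U W. v $ U) else 0)"

lemma linear_incidence: "Vector_Spaces.linear (*s) (*s) (incidence S R)"
  by unfold_locales (auto simp: incidence_def vec_eq_iff sum.distrib sum_distrib_left)

text \<open>A matrix with independent columns has at least as many rows as columns. The field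
  \<open>'k\<close> occurs only in the hypothesis; it is \<open>rat\<close> in the applications to
  levels and shadows.\<close>

lemma card_le_if_incidence_injective:
  fixes R :: "'a::finite \<Rightarrow> 'b::finite \<Rightarrow> bool"
  assumes "\<And>f :: 'a \<Rightarrow> 'k::field. (\<And>U. U \<notin> T \<Longrightarrow> f U = 0) \<Longrightarrow>
      (\<And>W. W \<in> S \<Longrightarrow> (\<Sum>U | R U W. f U) = 0) \<Longrightarrow> (\<And>U. U \<in> T \<Longrightarrow> f U = 0)"
  shows "card T \<le> card S"
proof (rule card_le_if_injective)
  fix v :: "'k ^ 'a" assume v: "v \<in> supported T" "incidence S R v = 0"
  have "(\<Sum>U | R U W. v $ U) = 0" if "W \<in> S" for W
    using v(2) that by (simp add: incidence_def vec_eq_iff) metis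
  then have "v $ U = 0" for U
    using assms[of "\<lambda>U. v $ U"] v(1) by (cases "U \<in> T") (auto simp: supported_def)
  then show "v = 0" by (simp add: vec_eq_iff)
qed (rule linear_incidence, simp add: supported_def incidence_def)

text \<open>Extend a function on \<open>T\<close> by zero to its level. A \<open>W\<close> outside
  the shadow contains no member of \<open>T\<close>, so its equation holds trivially, and the
  equations over the shadow alone force the function to vanish.\<close>

lemma card_upper_shadow:
  fixes T :: "('f::{field,finite} ^ 'n::finite) set set"
  assumes "T \<subseteq> level i" "2 * i + 1 \<le> CARD('n)"
  shows "card T \<le> card {W \<in> level (i + 1). \<exists>U\<in>T. U \<subseteq> W}"
proof (rule card_le_if_incidence_injective[where R = "(\<subseteq>)"])
  fix f :: "('f ^ 'n) set \<Rightarrow> rat" and S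
  assume f: "\<And>U. U \<notin> T \<Longrightarrow> f U = 0" and S: "S \<in> T"
    and zero: "\<And>W. W \<in> {W \<in> level (i + 1). \<exists>U\<in>T. U \<subseteq> W} \<Longrightarrow> (\<Sum>U | U \<subseteq> W. f U) = 0"
  show "f S = 0"
  proof (rule inclusion_kernel[where i = i and j = "i + 1"])
    fix W :: "('f ^ 'n) set" assume W: "W \<in> level (i + 1)"
    have "(\<Sum>U | U \<in> level i \<and> U \<subseteq> W. f U) = (\<Sum>U | U \<subseteq> W. f U)"
      using f assms(1) by (intro sum.mono_neutral_left) auto
    also have "\<dots> = 0"
    proof (cases "\<exists>U\<in>T. U \<subseteq> W")
      case False
      then show ?thesis using f by (intro sum.neutral) auto
    qed (use zero W in auto)
    finally show "(\<Sum>U | U \<in> level i \<and> U \<subseteq> W. f U) = 0" .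
  qed (use S assms in auto)
qed

text \<open>The same argument for reverse inclusion; the hypothesis reads
  \<open>CARD('n) \<le> (i + 1) + i\<close>, which is the condition of
  \<open>containment_kernel\<close>.\<close>

lemma card_lower_shadow:
  fixes T :: "('f::{field,finite} ^ 'n::finite) set set"
  assumes "T \<subseteq> level (i + 1)" "CARD('n) \<le> 2 * i + 1"
  shows "card T \<le> card {W \<in> level i. \<exists>U\<in>T. W \<subseteq> U}"
proof (rule card_le_if_incidence_injective[where R = "\<lambda>U W. W \<subseteq> U"])
  fix f :: "('f ^ 'n) set \<Rightarrow> rat" and S
  assume f: "\<And>U. U \<notin> T \<Longrightarrow> f U = 0" and S: "S \<in> T"
    and zero: "\<And>W. W \<in> {W \<in> level i. \<exists>U\<in>T. W \<subseteq> U} \<Longrightarrow> (\<Sum>U | W \<subseteq> U. f U) = 0"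
  show "f S = 0"
  proof (rule containment_kernel[where i = "i + 1" and j = i])
    fix W :: "('f ^ 'n) set" assume W: "W \<in> level i"
    have "(\<Sum>U | U \<in> level (i + 1) \<and> W \<subseteq> U. f U) = (\<Sum>U | W \<subseteq> U. f U)"
      using f assms(1) by (intro sum.mono_neutral_left) auto
    also have "\<dots> = 0"
    proof (cases "\<exists>U\<in>T. W \<subseteq> U")
      case False
      then show ?thesis using f by (intro sum.neutral) auto
    qed (use zero W in auto)
    finally show "(\<Sum>U | U \<in> level (i + 1) \<and> W \<subseteq> U. f U) = 0" .
  qed (use S assms in auto)
qed

text \<open>The complement matrix between the two levels is injective from either side, so each
  level is at most as large as the other.\<close>

lemma card_level_symmetric:
  assumes "i \<le> CARD('n)"
  shows "card (level i :: ('f::{field,finite} ^ 'n::finite) set set)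
    = card (level (CARD('n) - i) :: ('f ^ 'n) set set)"
proof -
  have le: "card (level i :: ('f ^ 'n) set set) \<le> card (level (CARD('n) - i) :: ('f ^ 'n) set set)" for i
  proof (rule card_le_if_incidence_injective[where R = "\<lambda>U W. U \<inter> W = {0}"])
    fix f :: "('f ^ 'n) set \<Rightarrow> rat" and S :: "('f ^ 'n) set"
    assume f: "\<And>U. U \<notin> level i \<Longrightarrow> f U = 0" and S: "S \<in> level i"
      and zero: "\<And>W. W \<in> level (CARD('n) - i) \<Longrightarrow> (\<Sum>U | U \<inter> W = {0}. f U) = 0"
    show "f S = 0"
    proof (rule complement_kernel[OF S])
      fix W :: "('f ^ 'n) set" assume "W \<in> level (CARD('n) - i)"
      then show "(\<Sum>U | U \<in> level i \<and> U \<inter> W = {0}. f U) = 0"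
        using zero[of W] f by (subst sum.mono_neutral_left[of "{U. U \<inter> W = {0}}"]) auto
    qed
  qed
  show ?thesis using le[of i] le[of "CARD('n) - i"] assms by simp
qed

lemma subspace_dim_less:
  "vec.subspace U \<Longrightarrow> vec.subspace W \<Longrightarrow> U \<subset> W \<Longrightarrow> vec.dim U < vec.dim W"
  by (metis psubset_eq vec.subspace_dim_equal not_le_imp_less)

lemma antichain_card_le_middle:
  fixes S :: "('f::{field,finite} ^ 'n::finite) set set"
  assumes "antichain S" "S \<subseteq> (\<Union>d\<in>{l..h}. level d)"
    and "l \<le> CARD('n) div 2" "CARD('n) div 2 \<le> h"
  shows "card S \<le> card (level (CARD('n) div 2) :: ('f ^ 'n) set set)"
  using assms
proof (induction "h - l" arbitrary: S l h rule: less_induct)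
  case less
  let ?m = "CARD('n) div 2"
  have dims: "vec.subspace U \<and> l \<le> vec.dim U \<and> vec.dim U \<le> h" if "U \<in> S" for U
    using less.prems(2) that by (auto simp: level_def)
  consider "l < ?m" | "?m < h" | "l = ?m" "h = ?m" using less.prems(3,4) by linarith
  then show ?case
  proof cases
    case 1
    define T where "T = S \<inter> level l"
    define T' where "T' = {W \<in> level (l + 1). \<exists>U\<in>T. U \<subseteq> W}"
    have T': "\<exists>U\<in>S. U \<subset> W" if "W \<in> T'" for W
    proof -
      obtain U where "U \<in> S" "U \<in> level l" "W \<in> level (l + 1)" "U \<subseteq> W"
        using \<open>W \<in> T'\<close> unfolding T'_def T_def by blast
      then show ?thesis by (intro bexI[of _ U]) (auto simp: level_def)
    qed
    \<comment> \<open>A member of \<open>T'\<close> lies strictly above a member of \<open>S\<close>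
      and hence outside the antichain \<open>S\<close>; so the cardinalities of the two parts add
      up.\<close>
    have disj: "(S - T) \<inter> T' = {}"
    proof -
      have False if W: "W \<in> S" "W \<in> T'" for W
      proof -
        obtain U where "U \<in> S" "U \<subset> W" using T'[OF W(2)] by auto
        then show False using less.prems(1) W(1) unfolding antichain_def by blast
      qed
      then show ?thesis by blast
    qed
    have sub: "S - T \<union> T' \<subseteq> (\<Union>d\<in>{l + 1..h}. level d)"
    proof
      fix X assume "X \<in> S - T \<union> T'"
      then have "vec.subspace X \<and> l + 1 \<le> vec.dim X \<and> vec.dim X \<le> h"
        using dims[of X] 1 less.prems(4) by (auto simp: T_def T'_def level_def)
      then show "X \<in> (\<Union>d\<in>{l + 1..h}. level d)" by (auto simp: level_def)
    qed
    have "antichain (S - T \<union> T')"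
      unfolding antichain_def
    proof (intro ballI impI)
      fix X Y assume XY: "X \<in> S - T \<union> T'" "Y \<in> S - T \<union> T'" "X \<le> Y"
      have d: "vec.subspace X" "vec.subspace Y" "l + 1 \<le> vec.dim X" "l + 1 \<le> vec.dim Y"
        using sub XY by (auto simp: level_def)
      show "X = Y"
      proof (rule ccontr)
        assume neq: "X \<noteq> Y"
        then have "vec.dim X < vec.dim Y" using subspace_dim_less[of X Y] d XY(3) by auto
        \<comment> \<open>\<open>T'\<close> lies in the lowest level that remains, so the larger of
          two comparable members is not in it.\<close>
        then have "Y \<notin> T'" using d by (auto simp: T'_def level_def)
        then have Y: "Y \<in> S" using XY by auto
        show False
        proof (cases "X \<in> T'")
          case True
          then obtain U where "U \<in> S" "U \<subset> X" using T' by auto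
          then show False using less.prems(1) Y XY(3) unfolding antichain_def by blast
        next
          case False
          then show False using less.prems(1) Y XY neq unfolding antichain_def by blast
        qed
      qed
    qed
    then have "card (S - T \<union> T') \<le> card (level ?m :: ('f ^ 'n) set set)"
      using less.hyps[of h "l + 1"] sub 1 less.prems by simp
    moreover have "card T \<le> card T'"
      unfolding T'_def using 1 by (intro card_upper_shadow) (auto simp: T_def)
    moreover have "card S = card (S - T) + card T"
      by (subst card_Un_disjoint[symmetric]) (auto simp: T_def intro: arg_cong[of _ _ card])
    ultimately show ?thesis using disj by (simp add: card_Un_disjoint)
  next
    case 2
    define T where "T = S \<inter> level h"
    define T' where "T' = {W \<in> level (h - 1). \<exists>U\<in>T. W \<subseteq> U}"
    have T': "\<exists>U\<in>S. W \<subset> U" if "W \<in> T'" for W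
    proof -
      obtain U where "U \<in> S" "U \<in> level h" "W \<in> level (h - 1)" "W \<subseteq> U"
        using \<open>W \<in> T'\<close> unfolding T'_def T_def by blast
      then show ?thesis using 2 by (intro bexI[of _ U]) (auto simp: level_def)
    qed
    have disj: "(S - T) \<inter> T' = {}"
    proof -
      have False if W: "W \<in> S" "W \<in> T'" for W
      proof -
        obtain U where "U \<in> S" "W \<subset> U" using T'[OF W(2)] by auto
        then show False using less.prems(1) W(1) unfolding antichain_def by blast
      qed
      then show ?thesis by blast
    qed
    have sub: "S - T \<union> T' \<subseteq> (\<Union>d\<in>{l..h - 1}. level d)"
    proof
      fix X assume "X \<in> S - T \<union> T'"
      then have "vec.subspace X \<and> l \<le> vec.dim X \<and> vec.dim X \<le> h - 1"
        using dims[of X] 2 less.prems(3) by (auto simp: T_def T'_def level_def)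
      then show "X \<in> (\<Union>d\<in>{l..h - 1}. level d)" by (auto simp: level_def)
    qed
    have "antichain (S - T \<union> T')"
      unfolding antichain_def
    proof (intro ballI impI)
      fix X Y assume XY: "X \<in> S - T \<union> T'" "Y \<in> S - T \<union> T'" "X \<le> Y"
      have d: "vec.subspace X" "vec.subspace Y" "vec.dim X \<le> h - 1" "vec.dim Y \<le> h - 1"
        using sub XY by (auto simp: level_def)
      show "X = Y"
      proof (rule ccontr)
        assume neq: "X \<noteq> Y"
        then have "vec.dim X < vec.dim Y" using subspace_dim_less[of X Y] d XY(3) by auto
        then have "X \<notin> T'" using d by (auto simp: T'_def level_def)
        then have X: "X \<in> S" using XY by auto
        show False
        proof (cases "Y \<in> T'")
          case True
          then obtain U where "U \<in> S" "Y \<subset> U" using T' by auto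
          then show False using less.prems(1) X XY(3) unfolding antichain_def by blast
        next
          case False
          then show False using less.prems(1) X XY neq unfolding antichain_def by blast
        qed
      qed
    qed
    then have "card (S - T \<union> T') \<le> card (level ?m :: ('f ^ 'n) set set)"
      using less.hyps[of "h - 1" l] sub 2 less.prems by simp
    \<comment> \<open>\<open>h\<close> exceeds \<open>CARD('n) div 2\<close>, so
      \<open>CARD('n) \<le> 2 * (h - 1) + 1\<close>; for odd \<open>CARD('n)\<close> equality occurs
      in the step down to the middle level.\<close>
    moreover have "card T \<le> card T'"
      unfolding T'_def using 2 by (intro card_lower_shadow) (auto simp: T_def)
    moreover have "card S = card (S - T) + card T"
      by (subst card_Un_disjoint[symmetric]) (auto simp: T_def intro: arg_cong[of _ _ card])
    ultimately show ?thesis using disj by (simp add: card_Un_disjoint)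
  next
    case 3
    then show ?thesis using less.prems(2) by (intro card_mono) auto
  qed
qed

section \<open>Rank function and largest antichains of the subspace lattice\<close>

lemma dim_span_insert:
  fixes U :: "('f::field ^ 'n::finite) set"
  assumes "vec.subspace U" "x \<notin> U"
  shows "vec.dim (vec.span (insert x U)) = vec.dim U + 1"
  using assms by (simp add: vec.dim_insert vec.span_eq_iff[THEN iffD2])

lemma ranked_poset_subspace_lattice:
  "ranked_poset (subspace_lattice :: ('f::{field,finite} ^ 'n::finite) set set) vec.dim"
  unfolding ranked_poset_def
proof (intro conjI ballI impI)
  fix U :: "('f ^ 'n) set"
  assume U: "U \<in> subspace_lattice" and minimal: "\<forall>W\<in>subspace_lattice. \<not> W < U"
  have "{0} \<subseteq> U" using U vec.subspace_0 by (auto simp: subspace_lattice_def)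
  moreover have "{0} \<in> (subspace_lattice :: ('f ^ 'n) set set)" by (simp add: subspace_lattice_def)
  ultimately have "U = {0}" using minimal by auto
  then show "vec.dim U = 0" by simp
next
  fix U W :: "('f ^ 'n) set"
  assume UW: "U \<in> subspace_lattice" "W \<in> subspace_lattice"
    and cover: "U < W \<and> \<not> (\<exists>Z\<in>subspace_lattice. U < Z \<and> Z < W)"
  then have sub: "vec.subspace U" "vec.subspace W" by (auto simp: subspace_lattice_def)
  obtain x where x: "x \<in> W" "x \<notin> U" using cover by auto
  \<comment> \<open>Nothing lies strictly between the members of a cover, so adjoining a single
    vector to \<open>U\<close> already fills \<open>W\<close>.\<close>
  let ?Z = "vec.span (insert x U)"
  have "U \<subset> ?Z" using x vec.span_superset[of "insert x U"] by auto
  moreover have "?Z \<subseteq> W" using x sub cover by (intro vec.span_minimal) auto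
  moreover have "?Z \<in> subspace_lattice" by (simp add: subspace_lattice_def)
  ultimately have "?Z = W" using cover by auto
  then show "vec.dim W = vec.dim U + 1" using dim_span_insert[OF sub(1) x(2)] by simp
qed simp

text \<open>The middle level is an antichain that is at least as large as every antichain, in
  particular as every other level; hence both maxima equal its size.\<close>

lemma sperner_subspace_lattice:
  "sperner_property (subspace_lattice :: ('f::{field,finite} ^ 'n::finite) set set) vec.dim"
  unfolding sperner_property_def
proof
  let ?P = "subspace_lattice :: ('f ^ 'n) set set"
  let ?m = "CARD('n) div 2"
  have level: "{U \<in> ?P. vec.dim U = i} = level i" for i
    by (auto simp: subspace_lattice_def level_def)
  have anti: "antichain (level i :: ('f ^ 'n) set set)" for i
    using subspace_dim_less by (fastforce simp: antichain_def level_def)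
  have le: "card S \<le> card (level ?m :: ('f ^ 'n) set set)" if "S \<subseteq> ?P" "antichain S" for S
  proof (rule antichain_card_le_middle[OF that(2), of 0 "CARD('n)"])
    have "vec.dim U \<le> CARD('n)" for U :: "('f ^ 'n) set"
      using vec.dim_subset_UNIV[of U] vec_dim_card[where 'a = 'f and 'n = 'n]
      by (simp add: vec.dimension_def)
    then show "S \<subseteq> (\<Union>d\<in>{0..CARD('n)}. level d)"
      using that(1) by (auto simp: subspace_lattice_def level_def)
  qed simp_all
  have "Max {card S | S. S \<subseteq> ?P \<and> antichain S} = card (level ?m :: ('f ^ 'n) set set)"
  proof (rule Max_eqI)
    show "card (level ?m :: ('f ^ 'n) set set) \<in> {card S | S. S \<subseteq> ?P \<and> antichain S}"
      using anti[of ?m] by (auto simp: subspace_lattice_def level_def)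
  qed (use le in \<open>auto simp: setcompr_eq_image\<close>)
  moreover have "Max {card {U \<in> ?P. vec.dim U = i} | i. True} = card (level ?m :: ('f ^ 'n) set set)"
  proof (rule Max_eqI)
    show "finite {card {U \<in> ?P. vec.dim U = i} | i. True}"
      by (rule finite_subset[of _ "{..card ?P}"]) (auto intro: card_mono)
    fix y assume "y \<in> {card {U \<in> ?P. vec.dim U = i} | i. True}"
    then obtain i where "y = card (level i :: ('f ^ 'n) set set)" unfolding level by auto
    then show "y \<le> card (level ?m :: ('f ^ 'n) set set)"
      using le[OF _ anti[of i]] by (auto simp: subspace_lattice_def level_def)
  qed (auto simp: level)
  ultimately show "Max {card S | S. S \<subseteq> ?P \<and> antichain S}
    = Max {card {U \<in> ?P. vec.dim U = i} | i. True}" by simp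
qed (rule ranked_poset_subspace_lattice)

section \<open>The matroid of a projective space\<close>

abbreviation psp :: "('f::field ^ 'n::finite) set set \<Rightarrow> ('f ^ 'n) set" where
  "psp F \<equiv> vec.span (\<Union>F)"

lemma dim_le_CARD: "vec.dim (U :: ('f::field ^ 'n::finite) set) \<le> CARD('n)"
  using vec.dim_subset_UNIV[of U] vec_dim_card[where 'a = 'f and 'n = 'n]
  by (simp add: vec.dimension_def)

lemma psp_image_rep:
  fixes F :: "('f::field ^ 'n::finite) set set"
  assumes F: "F \<subseteq> proj_space" and v: "\<And>e. e \<in> F \<Longrightarrow> v e \<in> e \<and> v e \<noteq> 0"
  shows "psp F = vec.span (v ` F)"
proof
  have "e \<subseteq> vec.span (v ` F)" if "e \<in> F" for e
  proof -
    have "e = vec.span {v e}" using that F v by (intro proj_space_span) auto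
    then show ?thesis using vec.span_mono[of "{v e}" "v ` F"] that by auto
  qed
  then show "psp F \<subseteq> vec.span (v ` F)" by (intro vec.span_minimal) auto
  show "vec.span (v ` F) \<subseteq> psp F" using v by (intro vec.span_mono) auto
qed

lemma exists_rep: "\<exists>v. \<forall>e\<in>proj_space :: ('f::field ^ 'n::finite) set set. v e \<in> e \<and> v e \<noteq> 0"
  using proj_space_rep by metis

lemma dim_psp_le_card:
  fixes F :: "('f::{field,finite} ^ 'n::finite) set set"
  assumes "F \<subseteq> proj_space"
  shows "vec.dim (psp F) \<le> card F"
proof -
  obtain v where v: "\<forall>e\<in>proj_space :: ('f ^ 'n) set set. v e \<in> e \<and> v e \<noteq> 0"
    using exists_rep by blast
  have "psp F = vec.span (v ` F)" using assms v by (intro psp_image_rep) auto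
  then have "vec.dim (psp F) \<le> card (v ` F)" by (simp only:) (simp add: vec.dim_le_card')
  also have "\<dots> \<le> card F" by (simp add: card_image_le)
  finally show ?thesis .
qed

text \<open>Representatives of the points span \<open>psp F\<close> and are as many as the points,
  and a finite spanning set is independent exactly when its size is the dimension. This frees
  independence from the choice of representatives.\<close>

lemma proj_indep_iff_dim:
  fixes F :: "('f::{field,finite} ^ 'n::finite) set set"
  shows "F \<in> proj_indep \<longleftrightarrow> F \<subseteq> proj_space \<and> vec.dim (psp F) = card F"
proof (cases "F \<subseteq> proj_space")
  case True
  obtain v where v: "\<forall>e\<in>proj_space :: ('f ^ 'n) set set. v e \<in> e \<and> v e \<noteq> 0"
    using exists_rep by blast
  have v': "\<forall>e\<in>F. v e \<in> e \<and> v e \<noteq> 0" using v True by auto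
  have eq: "psp F = vec.span (v ` F)" using True v by (intro psp_image_rep) auto
  have card: "card (v ` F) = card F" using inj_on_rep[OF True v'] by (rule card_image)
  have "F \<in> proj_indep \<longleftrightarrow> vec.independent (v ` F)"
    using True v' independent_rep_change[OF True _ v'] unfolding proj_indep_def by blast
  also have "\<dots> \<longleftrightarrow> vec.dim (psp F) = card F"
    unfolding eq card[symmetric]
    by (metis finite_class.finite vec.card_le_dim_spanning vec.dim_span_eq_card_independent vec.span_superset order_refl)
  finally show ?thesis using True by simp
qed (auto simp: proj_indep_def)

lemma psp_level: "F \<in> proj_indep \<Longrightarrow> psp F \<in> level (card F)" for F :: "('f::{field,finite} ^ 'n::finite) set set"
  by (simp add: proj_indep_iff_dim level_def del: vec.dim_span)

text \<open>The lines through the vectors of a basis span \<open>U\<close> and number at most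
  \<open>vec.dim U\<close>, so they are independent by the dimension criterion.\<close>

lemma exists_psp_eq:
  fixes U :: "('f::{field,finite} ^ 'n::finite) set"
  assumes "vec.subspace U"
  shows "\<exists>F\<in>proj_indep. psp F = U"
proof -
  obtain B where B: "B \<subseteq> U" "vec.independent B" "U \<subseteq> vec.span B" "card B = vec.dim U"
    using vec.basis_exists by metis
  let ?F = "(\<lambda>x. vec.span {x}) ` B"
  have "0 \<notin> B" using B(2) vec.dependent_zero by blast
  then have F: "?F \<subseteq> proj_space" by (auto simp: proj_space_def)
  have "vec.span B \<subseteq> psp ?F" by (intro vec.span_mono) (auto intro: vec.span_base)
  moreover have "psp ?F \<subseteq> U"
    using B(1) assms by (intro vec.span_minimal) (auto dest: vec.span_minimal[THEN subsetD, rotated -1])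
  ultimately have eq: "psp ?F = U" using B(3) by auto
  have "vec.dim U \<le> card ?F" using dim_psp_le_card[OF F] eq by simp
  moreover have "card ?F \<le> vec.dim U" using card_image_le[of B] B(4) by simp
  ultimately show ?thesis using F eq proj_indep_iff_dim[of ?F] by (intro bexI[of _ ?F]) auto
qed

abbreviation join :: "('f::field ^ 'n::finite) set \<Rightarrow> ('f ^ 'n) set \<Rightarrow> ('f ^ 'n) set" where
  "join e U \<equiv> vec.span (e \<union> U)"

lemma psp_insert: "psp (insert e F) = join e (psp F)"
proof
  show "psp (insert e F) \<subseteq> join e (psp F)"
    using vec.span_superset[of "\<Union>F"] by (intro vec.span_mono) auto
  show "join e (psp F) \<subseteq> psp (insert e F)"
    using vec.span_superset[of "\<Union>(insert e F)"] vec.span_mono[of "\<Union>F" "\<Union>(insert e F)"]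
    by (intro vec.span_minimal) auto
qed

lemma join_level:
  fixes U :: "('f::field ^ 'n::finite) set"
  assumes "e \<in> proj_space" "U \<in> level d" "\<not> e \<subseteq> U"
  shows "join e U \<in> level (d + 1)"
proof -
  obtain x where x: "x \<in> e" "x \<notin> U" using assms(3) by auto
  have U: "vec.subspace U" "vec.dim U = d" using assms by (auto simp: level_def)
  have "x \<noteq> 0" using x U vec.subspace_0 by auto
  then have e: "e = vec.span {x}" using proj_space_span assms x by auto
  have "join e U = vec.span (insert x U)"
  proof
    show "join e U \<subseteq> vec.span (insert x U)"
      unfolding e using vec.span_mono[of "{x}" "insert x U"] by (intro vec.span_minimal) (auto intro: vec.span_base)
    show "vec.span (insert x U) \<subseteq> join e U" using x by (intro vec.span_mono) auto
  qed
  then show ?thesis using dim_span_insert[OF U(1) x(2)] U by (simp add: level_def)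
qed

lemma insert_proj_indep_iff:
  fixes F :: "('f::{field,finite} ^ 'n::finite) set set"
  assumes "F \<in> proj_indep" "e \<in> proj_space" "e \<notin> F"
  shows "insert e F \<in> proj_indep \<longleftrightarrow> \<not> e \<subseteq> psp F"
proof
  assume "\<not> e \<subseteq> psp F"
  then have "join e (psp F) \<in> level (card F + 1)"
    using assms psp_level by (intro join_level) auto
  then show "insert e F \<in> proj_indep"
    using assms unfolding proj_indep_iff_dim psp_insert level_def by simp
next
  assume ind: "insert e F \<in> proj_indep"
  show "\<not> e \<subseteq> psp F"
  proof
    assume "e \<subseteq> psp F"
    then have "join e (psp F) = psp F" by (simp add: Un_absorb1)
    then have "psp (insert e F) = psp F" by (simp only: psp_insert)
    then have "card (insert e F) = card F"
      using ind assms(1) unfolding proj_indep_iff_dim by metis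
    then show False using assms(3) by simp
  qed
qed

lemma mem_subset_psp: "e \<in> F \<Longrightarrow> e \<subseteq> psp F"
  using vec.span_superset[of "\<Union>F"] by auto

lemma proj_indep_card_le: "F \<in> proj_indep \<Longrightarrow> card F \<le> CARD('n)" for F :: "('f::{field,finite} ^ 'n::finite) set set"
  using dim_le_CARD[of "psp F"] unfolding proj_indep_iff_dim by (simp del: vec.dim_span)

lemma points_psp: "vec.subspace U \<Longrightarrow> psp (points U) = U" for U :: "('f::{field,finite} ^ 'n::finite) set"
proof
  assume U: "vec.subspace U"
  show "psp (points U) \<subseteq> U" using U by (intro vec.span_minimal) (auto simp: points_def)
  obtain F where F: "F \<in> proj_indep" "psp F = U" using exists_psp_eq[OF U] by auto
  then have "F \<subseteq> points U" using mem_subset_psp[of _ F] by (auto simp: points_def proj_indep_def)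
  then have "psp F \<subseteq> psp (points U)" by (intro vec.span_mono) auto
  then show "U \<subseteq> psp (points U)" using F by simp
qed

lemma bases_proj_indep:
  "bases (proj_indep :: ('f::{field,finite} ^ 'n::finite) set set set) = {B \<in> proj_indep. card B = CARD('n)}"
proof (intro equalityI subsetI)
  fix B :: "('f ^ 'n) set set" assume B: "B \<in> bases proj_indep"
  then have ind: "B \<in> proj_indep" by (simp add: bases_def)
  \<comment> \<open>A point outside the span could be added, against maximality.\<close>
  have "e \<subseteq> psp B" if "e \<in> proj_space" for e
  proof (rule ccontr)
    assume e: "\<not> e \<subseteq> psp B"
    then have "e \<notin> B" using mem_subset_psp by auto
    then have "insert e B \<in> proj_indep" using insert_proj_indep_iff[OF ind that] e by simp
    then have "insert e B = B" using B unfolding bases_def by blast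
    then show False using \<open>e \<notin> B\<close> by auto
  qed
  then have "psp (points (UNIV :: ('f ^ 'n) set)) \<subseteq> psp B"
    by (intro vec.span_minimal) (auto simp: points_def)
  then have "psp B = UNIV" using points_psp[of "UNIV :: ('f ^ 'n) set"] by auto
  then have "card B = CARD('n)"
    using ind vec_dim_card[where 'a = 'f and 'n = 'n] unfolding proj_indep_iff_dim by metis
  then show "B \<in> {B \<in> proj_indep. card B = CARD('n)}" using ind by simp
next
  fix B :: "('f ^ 'n) set set" assume B: "B \<in> {B \<in> proj_indep. card B = CARD('n)}"
  have "F = B" if "F \<in> proj_indep" "B \<subseteq> F" for F
    using that B proj_indep_card_le[OF that(1)] card_seteq[of F B] by auto
  then show "B \<in> bases proj_indep" using B by (auto simp: bases_def)
qed

text \<open>The modular law for the spans and inclusion-exclusion for the sets both have total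
  \<open>card F + card G\<close>, and the dimension of \<open>psp (F \<union> G)\<close> is at most
  \<open>card (F \<union> G)\<close>. The claim is then arithmetic; it translates splittings of a
  basis into complementary subspaces.\<close>

lemma disjoint_union_basis_iff:
  fixes F G :: "('f::{field,finite} ^ 'n::finite) set set"
  assumes "F \<in> proj_indep" "G \<in> proj_indep"
  shows "F \<inter> G = {} \<and> F \<union> G \<in> bases proj_indep \<longleftrightarrow>
    psp F \<inter> psp G = {0} \<and> card F + card G = CARD('n)"
proof -
  have "psp (F \<union> G) = {x + y |x y. x \<in> psp F \<and> y \<in> psp G}"
    by (simp add: vec.span_Un)
  then have sum: "vec.dim (psp (F \<union> G)) + vec.dim (psp F \<inter> psp G) = card F + card G"
    using assms vec.dim_sums_Int[of "psp F" "psp G"] unfolding proj_indep_iff_dim by (simp del: vec.dim_span)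
  have zero: "psp F \<inter> psp G = {0} \<longleftrightarrow> vec.dim (psp F \<inter> psp G) = 0"
    by (intro subspace_Int_eq_zero_iff) auto
  have Un: "card (F \<union> G) + card (F \<inter> G) = card F + card G" using card_Un_Int[of F G] by simp
  have le: "vec.dim (psp (F \<union> G)) \<le> card (F \<union> G)"
    using assms by (intro dim_psp_le_card) (auto simp: proj_indep_def)
  have sub: "F \<union> G \<subseteq> proj_space" using assms by (auto simp: proj_indep_def)
  have disj: "F \<inter> G = {} \<longleftrightarrow> card (F \<inter> G) = 0" by simp
  show ?thesis
    unfolding zero disj bases_proj_indep mem_Collect_eq proj_indep_iff_dim[of "F \<union> G"]
    using sum Un le sub by linarith
qed

section \<open>Rank, closure and equivalence of sets of points\<close>

lemma matroid_rank_proj_indep: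
  fixes S :: "('f::{field,finite} ^ 'n::finite) set set"
  assumes S: "S \<subseteq> proj_space"
  shows "matroid_rank proj_indep S = vec.dim (psp S)"
  unfolding matroid_rank_def
proof (rule Max_eqI)
  fix c assume "c \<in> card ` {F \<in> proj_indep. F \<subseteq> S}"
  then obtain F where F: "F \<in> proj_indep" "F \<subseteq> S" "c = card F" by auto
  then have "psp F \<subseteq> psp S" by (intro vec.span_mono) auto
  then have "vec.dim (psp F) \<le> vec.dim (psp S)" by (rule vec.dim_subset)
  then show "c \<le> vec.dim (psp S)" using F by (simp add: proj_indep_iff_dim del: vec.dim_span)
next
  obtain v where v: "\<forall>e\<in>proj_space :: ('f ^ 'n) set set. v e \<in> e \<and> v e \<noteq> 0"
    using exists_rep by blast
  obtain B where B: "B \<subseteq> v ` S" "vec.independent B" "v ` S \<subseteq> vec.span B"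
    using vec.maximal_independent_subset[of "v ` S"] by auto
  obtain F where F: "F \<subseteq> S" "B = v ` F" using B(1) subset_imageE by metis
  have FE: "F \<subseteq> proj_space" using F S by auto
  have ind: "F \<in> proj_indep"
    using B(2) F FE v unfolding proj_indep_def by auto
  have "psp S = vec.span (v ` S)" using S v by (intro psp_image_rep) auto
  also have "\<dots> = vec.span B" using B vec.span_mono[of B "v ` S"] vec.span_minimal[of "v ` S" "vec.span B"] by auto
  also have "\<dots> = psp F" unfolding F(2) using FE v by (intro psp_image_rep[symmetric]) auto
  finally have "card F = vec.dim (psp S)" using ind by (simp only: proj_indep_iff_dim)
  then show "vec.dim (psp S) \<in> card ` {F \<in> proj_indep. F \<subseteq> S}" using ind F by force
qed simp

lemma matroid_closure_proj_indep:
  fixes S :: "('f::{field,finite} ^ 'n::finite) set set"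
  assumes S: "S \<subseteq> proj_space"
  shows "matroid_closure proj_space proj_indep S = points (psp S)"
proof -
  have "matroid_rank proj_indep (S \<union> {y}) = matroid_rank proj_indep S \<longleftrightarrow> y \<subseteq> psp S"
    if y: "y \<in> proj_space" for y
  proof -
    have rank: "matroid_rank proj_indep (S \<union> {y}) = vec.dim (join y (psp S))"
        "matroid_rank proj_indep S = vec.dim (psp S)"
      using S y matroid_rank_proj_indep[of "insert y S"] matroid_rank_proj_indep[OF S]
      by (simp_all only: psp_insert Un_insert_right Un_empty_right) simp_all
    show ?thesis
    proof (cases "y \<subseteq> psp S")
      case True
      then have "join y (psp S) = psp S" by (simp add: Un_absorb1)
      then show ?thesis using True rank by simp
    next
      case False
      then have "join y (psp S) \<in> level (vec.dim (psp S) + 1)"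
        using y by (intro join_level) (auto simp: level_def)
      then show ?thesis using False rank by (simp add: level_def del: vec.dim_span)
    qed
  qed
  then show ?thesis by (auto simp: matroid_closure_def points_def)
qed

text \<open>The closure consists of the points of the span, and a subspace is recovered from its
  points, so closure and span determine each other.\<close>

lemma matroid_equiv_proj_indep:
  fixes S T :: "('f::{field,finite} ^ 'n::finite) set set"
  assumes "S \<subseteq> proj_space" "T \<subseteq> proj_space"
  shows "matroid_equiv proj_space proj_indep S T \<longleftrightarrow> psp S = psp T"
  unfolding matroid_equiv_def matroid_closure_proj_indep[OF assms(1)] matroid_closure_proj_indep[OF assms(2)]
  by (metis points_psp vec.subspace_span)

section \<open>The differential action\<close>

lemma lookup_single_times:
  fixes p :: "('e, 'k::comm_ring_1) mpoly"
  shows "Poly_Mapping.lookup (Poly_Mapping.single a c * p) (a + m) = c * Poly_Mapping.lookup p m"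
    and "(\<And>m'. m \<noteq> a + m') \<Longrightarrow> Poly_Mapping.lookup (Poly_Mapping.single a c * p) m = 0"
proof -
  have *: "Poly_Mapping.lookup (Poly_Mapping.single a c * p) m = c * (\<Sum>q. Poly_Mapping.lookup p q when m = a + q)" for m
    unfolding lookup_mult lookup_single by (simp add: when_mult)
  show "Poly_Mapping.lookup (Poly_Mapping.single a c * p) (a + m) = c * Poly_Mapping.lookup p m"
    unfolding * by simp
  show "Poly_Mapping.lookup (Poly_Mapping.single a c * p) m = 0" if "\<And>m'. m \<noteq> a + m'"
    unfolding * using that by simp
qed

lemma lookup_mconst_times: "Poly_Mapping.lookup (mconst c * p) m = c * Poly_Mapping.lookup p m"
  using lookup_single_times(1)[of 0 c p m] by (simp add: mconst_def)

section \<open>Squarefree monomials\<close>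

definition indicator_monom :: "'e set \<Rightarrow> 'e \<Rightarrow>\<^sub>0 nat" where
  "indicator_monom S = (\<Sum>e\<in>S. Poly_Mapping.single e 1)"

lemma lookup_indicator_monom:
  "finite S \<Longrightarrow> Poly_Mapping.lookup (indicator_monom S) e = (if e \<in> S then 1 else 0)"
  by (auto simp: indicator_monom_def lookup_sum lookup_single when_def)

lemma keys_indicator_monom: "finite S \<Longrightarrow> Poly_Mapping.keys (indicator_monom S) = S"
  by (auto simp: in_keys_iff lookup_indicator_monom split: if_splits)

lemma indicator_monom_inject:
  "finite S \<Longrightarrow> finite T \<Longrightarrow> indicator_monom S = indicator_monom T \<longleftrightarrow> S = T"
  by (metis keys_indicator_monom)

lemma mdeg_indicator_monom: "finite S \<Longrightarrow> mdeg (indicator_monom S) = card S"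
  by (simp add: mdeg_def keys_indicator_monom lookup_indicator_monom)

lemma indicator_monom_insert:
  "finite S \<Longrightarrow> e \<notin> S \<Longrightarrow> indicator_monom (insert e S) = Poly_Mapping.single e 1 + indicator_monom S"
  by (simp add: indicator_monom_def)

lemma mvars_prod_eq_single: "mvars_prod S = Poly_Mapping.single (indicator_monom S) 1"
  unfolding mvars_prod_def indicator_monom_def
  by (induction S rule: infinite_finite_induct) (simp_all add: mvar_def mult_single)

text \<open>No exponent of a squarefree monomial exceeds \<open>1\<close>, so its factorizations
  correspond to splittings of its support.\<close>

lemma indicator_monom_eq_add_iff:
  assumes "finite B"
  shows "indicator_monom B = m' + m \<longleftrightarrow> (\<exists>G\<subseteq>B. m' = indicator_monom G \<and> m = indicator_monom (B - G))"
proof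
  assume eq: "indicator_monom B = m' + m"
  have l: "Poly_Mapping.lookup m' e + Poly_Mapping.lookup m e = (if e \<in> B then 1 else 0)" for e
    using lookup_indicator_monom[OF assms, of e] by (simp add: eq lookup_add)
  have G: "Poly_Mapping.keys m' \<subseteq> B"
  proof
    fix e assume "e \<in> Poly_Mapping.keys m'"
    then show "e \<in> B" using l[of e] by (cases "e \<in> B") (auto simp: in_keys_iff)
  qed
  have "m' = indicator_monom (Poly_Mapping.keys m')"
  proof (rule poly_mapping_eqI)
    fix e show "Poly_Mapping.lookup m' e = Poly_Mapping.lookup (indicator_monom (Poly_Mapping.keys m')) e"
      using l[of e] by (auto simp: lookup_indicator_monom in_keys_iff split: if_splits)
  qed
  moreover have "m = indicator_monom (B - Poly_Mapping.keys m')"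
  proof (rule poly_mapping_eqI)
    fix e show "Poly_Mapping.lookup m e = Poly_Mapping.lookup (indicator_monom (B - Poly_Mapping.keys m')) e"
      using l[of e] assms by (auto simp: lookup_indicator_monom in_keys_iff split: if_splits)
  qed
  ultimately show "\<exists>G\<subseteq>B. m' = indicator_monom G \<and> m = indicator_monom (B - G)" using G by blast
next
  assume "\<exists>G\<subseteq>B. m' = indicator_monom G \<and> m = indicator_monom (B - G)"
  then obtain G where "G \<subseteq> B" "m' = indicator_monom G" "m = indicator_monom (B - G)" by auto
  then show "indicator_monom B = m' + m"
    using assms finite_subset[of G B]
    by (intro poly_mapping_eqI) (auto simp: lookup_add lookup_indicator_monom)
qed

text \<open>The rising factorial collects the exponents brought down by \<open>h\<close>
  differentiations, from the remaining exponent of \<open>e\<close> plus \<open>h\<close> down to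
  the remaining exponent plus \<open>1\<close>.\<close>

lemma lookup_funpow_partial:
  "Poly_Mapping.lookup ((partial e ^^ h) f) m =
    pochhammer (of_nat (Suc (Poly_Mapping.lookup m e))) h * Poly_Mapping.lookup f (m + Poly_Mapping.single e h)"
proof (induction h arbitrary: m)
  case (Suc h)
  have "m + Poly_Mapping.single e 1 + Poly_Mapping.single e h = m + Poly_Mapping.single e (Suc h)"
    by (simp add: add.assoc flip: single_add)
  then show ?case
    by (simp add: lookup_partial Suc pochhammer_rec lookup_add ac_simps)
qed simp

lemma lookup_fold_partial:
  assumes "finite K"
  shows "Poly_Mapping.lookup (Finite_Set.fold (\<lambda>e. partial e ^^ h e) f K) m =
    (\<Prod>e\<in>K. pochhammer (of_nat (Suc (Poly_Mapping.lookup m e))) (h e)) *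
    Poly_Mapping.lookup f (m + (\<Sum>e\<in>K. Poly_Mapping.single e (h e)))"
  using assms
proof (induction K arbitrary: m rule: finite_induct)
  case (insert x K)
  have "(\<Prod>e\<in>K. pochhammer (of_nat (Suc (Poly_Mapping.lookup (m + Poly_Mapping.single x (h x)) e))) (h e))
      = (\<Prod>e\<in>K. pochhammer (of_nat (Suc (Poly_Mapping.lookup m e)) :: 'b) (h e))"
    using insert.hyps by (intro prod.cong) (auto simp: lookup_add lookup_single when_def)
  then show ?case
    using insert by (simp add: partial.fold_insert lookup_funpow_partial add.assoc mult.assoc)
qed simp

lemma lookup_monom_act:
  "Poly_Mapping.lookup (monom_act m f) m' =
    (\<Prod>e\<in>Poly_Mapping.keys m. pochhammer (of_nat (Suc (Poly_Mapping.lookup m' e))) (Poly_Mapping.lookup m e)) *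
    Poly_Mapping.lookup f (m' + m)"
proof -
  have "(\<Sum>e\<in>Poly_Mapping.keys m. Poly_Mapping.single e (Poly_Mapping.lookup m e)) = m"
    by (intro poly_mapping_eqI) (auto simp: lookup_sum lookup_single when_def in_keys_iff)
  then show ?thesis unfolding monom_act_def by (simp add: lookup_fold_partial)
qed

text \<open>On squarefree polynomials a variable can be differentiated at most once without giving
  zero, so every factor produced by differentiation is \<open>1\<close> and the action is
  contraction of monomials.\<close>

lemma lookup_act_basis_poly:
  fixes \<phi> :: "('e, 'k::comm_ring_1) mpoly"
  assumes fin: "finite \<B>" "\<And>B. B \<in> \<B> \<Longrightarrow> finite B"
  shows "Poly_Mapping.lookup (act \<phi> (\<Sum>B\<in>\<B>. mvars_prod B)) m' =
    (\<Sum>B\<in>\<B>. \<Sum>m\<in>Poly_Mapping.keys \<phi>. if indicator_monom B = m' + m then Poly_Mapping.lookup \<phi> m else 0)"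
proof -
  have one: "(\<Prod>e\<in>Poly_Mapping.keys m. pochhammer (of_nat (Suc (Poly_Mapping.lookup m' e)) :: 'k) (Poly_Mapping.lookup m e)) = 1"
    if B: "B \<in> \<B>" "indicator_monom B = m' + m" for B m
  proof (intro prod.neutral ballI)
    fix e assume "e \<in> Poly_Mapping.keys m"
    moreover have "Poly_Mapping.lookup m' e + Poly_Mapping.lookup m e = (if e \<in> B then 1 else 0)"
      using lookup_indicator_monom[OF fin(2)[OF B(1)], of e] by (simp add: B(2) lookup_add)
    ultimately have "Poly_Mapping.lookup m' e = 0" "Poly_Mapping.lookup m e = 1"
      by (auto simp: in_keys_iff split: if_splits)
    then show "pochhammer (of_nat (Suc (Poly_Mapping.lookup m' e)) :: 'k) (Poly_Mapping.lookup m e) = 1"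
      by simp
  qed
  show ?thesis
    unfolding act_def lookup_sum lookup_mconst_times lookup_monom_act
      lookup_sum[of mvars_prod] mvars_prod_eq_single lookup_single when_def sum_distrib_left
    by (subst sum.swap) (auto intro!: sum.cong simp: one simp del: of_nat_Suc)
qed

text \<open>The condition at \<open>G\<close> is the vanishing of one squarefree coefficient of the
  result. All other coefficients are zero, because divisors of squarefree monomials are
  squarefree.\<close>

lemma act_basis_poly_eq_0_iff:
  fixes \<phi> :: "('e, 'k::comm_ring_1) mpoly"
  assumes fin: "finite \<B>" "\<And>B. B \<in> \<B> \<Longrightarrow> finite B"
  shows "act \<phi> (\<Sum>B\<in>\<B>. mvars_prod B) = 0 \<longleftrightarrow>
    (\<forall>G. finite G \<longrightarrow> (\<Sum>B | B \<in> \<B> \<and> G \<subseteq> B. Poly_Mapping.lookup \<phi> (indicator_monom (B - G))) = 0)"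
proof -
  let ?a = "act \<phi> (\<Sum>B\<in>\<B>. mvars_prod B)"
  have coeff: "Poly_Mapping.lookup ?a (indicator_monom G)
      = (\<Sum>B | B \<in> \<B> \<and> G \<subseteq> B. Poly_Mapping.lookup \<phi> (indicator_monom (B - G)))" if G: "finite G" for G
  proof -
    have "(\<Sum>m\<in>Poly_Mapping.keys \<phi>. if indicator_monom B = indicator_monom G + m then Poly_Mapping.lookup \<phi> m else 0)
        = (if G \<subseteq> B then Poly_Mapping.lookup \<phi> (indicator_monom (B - G)) else 0)" if B: "B \<in> \<B>" for B
    proof -
      have "indicator_monom B = indicator_monom G + m \<longleftrightarrow> G \<subseteq> B \<and> m = indicator_monom (B - G)" for m
        using indicator_monom_eq_add_iff[OF fin(2)[OF B], of "indicator_monom G" m]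
          indicator_monom_inject[OF G] fin(2)[OF B] finite_subset[of _ B] by metis
      then show ?thesis by (simp add: in_keys_iff)
    qed
    then have "Poly_Mapping.lookup ?a (indicator_monom G)
        = (\<Sum>B\<in>\<B>. if G \<subseteq> B then Poly_Mapping.lookup \<phi> (indicator_monom (B - G)) else 0)"
      by (subst lookup_act_basis_poly[OF fin]) (auto intro!: sum.cong)
    then show ?thesis using fin(1) by (simp add: sum.inter_filter)
  qed
  have "?a = 0" if zero: "\<forall>G. finite G \<longrightarrow> (\<Sum>B | B \<in> \<B> \<and> G \<subseteq> B. Poly_Mapping.lookup \<phi> (indicator_monom (B - G))) = 0"
  proof (rule poly_mapping_eqI)
    fix m' show "Poly_Mapping.lookup ?a m' = Poly_Mapping.lookup 0 m'"
    proof (cases "\<exists>G. finite G \<and> m' = indicator_monom G")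
      case True
      then show ?thesis using coeff zero by auto
    next
      case False
      then have "indicator_monom B \<noteq> m' + m" if "B \<in> \<B>" for B m
        using indicator_monom_eq_add_iff[OF fin(2)[OF that]] finite_subset fin(2)[OF that] by metis
      then show ?thesis by (subst lookup_act_basis_poly[OF fin]) auto
    qed
  qed
  moreover have "\<forall>G. finite G \<longrightarrow> (\<Sum>B | B \<in> \<B> \<and> G \<subseteq> B. Poly_Mapping.lookup \<phi> (indicator_monom (B - G))) = 0"
    if "?a = 0"
    by (intro allI impI, subst coeff[symmetric], assumption) (simp only: that lookup_zero)
  ultimately show ?thesis by (rule iffI[rotated])
qed

text \<open>
  \<open>coords p\<close> lists the coefficients of \<open>p\<close> modulo \<open>J\<close> with respect to the classes of the
  subspaces; it is \<open>0\<close> at the sets that are not subspaces.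
\<close>

definition coords :: "(('f::{field,finite} ^ 'n::finite) set, 'k::field_char_0) mpoly \<Rightarrow> 'k ^ (('f ^ 'n) set)" where
  "coords p = (\<chi> U. \<Sum>F | F \<in> proj_indep \<and> psp F = U. Poly_Mapping.lookup p (indicator_monom F))"

text \<open>Grouping the sets \<open>B - G\<close> by their spans turns the coefficient at an
  independent \<open>G\<close> into the sum of \<open>coords \<phi>\<close> over the complements of
  \<open>psp G\<close>. Every subspace is some \<open>psp G\<close>, so the vanishing of these sums
  is the system solved by \<open>complement_kernel\<close>.\<close>

lemma ann_iff_coords_eq_0:
  fixes \<phi> :: "(('f::{field,finite} ^ 'n::finite) set, 'k::field_char_0) mpoly"
  shows "act \<phi> (basis_poly proj_indep) = 0 \<longleftrightarrow> coords \<phi> = 0"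
proof -
  have eq: "(\<Sum>B | B \<in> bases proj_indep \<and> G \<subseteq> B. Poly_Mapping.lookup \<phi> (indicator_monom (B - G)))
      = (\<Sum>U | U \<in> level (CARD('n) - card G) \<and> U \<inter> psp G = {0}. coords \<phi> $ U)"
    if G: "G \<in> proj_indep" for G
  proof -
    have Gn: "card G \<le> CARD('n)" using G by (rule proj_indep_card_le)
    have "(\<Sum>B | B \<in> bases proj_indep \<and> G \<subseteq> B. Poly_Mapping.lookup \<phi> (indicator_monom (B - G)))
      = (\<Sum>F | F \<in> proj_indep \<and> F \<inter> G = {} \<and> F \<union> G \<in> bases proj_indep. Poly_Mapping.lookup \<phi> (indicator_monom F))"
    proof (rule sum.reindex_bij_witness[where i = "\<lambda>F. F \<union> G" and j = "\<lambda>B. B - G"])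
      fix B assume B: "B \<in> {B. B \<in> bases proj_indep \<and> G \<subseteq> B}"
      then have "B - G \<in> proj_indep"
        using matroid.indep_subset[OF matroid_proj, of B "B - G"] by (auto simp: bases_def)
      moreover have "B - G \<union> G = B" using B by auto
      ultimately show "B - G \<in> {F. F \<in> proj_indep \<and> F \<inter> G = {} \<and> F \<union> G \<in> bases proj_indep}"
        using B by auto
    qed auto
    also have "\<dots> = (\<Sum>F | F \<in> proj_indep \<and> psp F \<in> level (CARD('n) - card G) \<and> psp F \<inter> psp G = {0}.
        Poly_Mapping.lookup \<phi> (indicator_monom F))"
    proof -
      have "F \<inter> G = {} \<and> F \<union> G \<in> bases proj_indep \<longleftrightarrow>
          psp F \<in> level (CARD('n) - card G) \<and> psp F \<inter> psp G = {0}" if F: "F \<in> proj_indep" for F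
      proof -
        have "psp F \<in> level (CARD('n) - card G) \<longleftrightarrow> card F + card G = CARD('n)"
          using psp_level[OF F] Gn unfolding level_def by auto
        then show ?thesis using disjoint_union_basis_iff[OF F G] by blast
      qed
      then show ?thesis by (intro sum.cong) auto
    qed
    also have "\<dots> = (\<Sum>U | U \<in> level (CARD('n) - card G) \<and> U \<inter> psp G = {0}.
        \<Sum>F | F \<in> {F. F \<in> proj_indep \<and> psp F \<in> level (CARD('n) - card G) \<and> psp F \<inter> psp G = {0}} \<and> psp F = U.
        Poly_Mapping.lookup \<phi> (indicator_monom F))"
      by (rule sum.group[symmetric]) auto
    also have "\<dots> = (\<Sum>U | U \<in> level (CARD('n) - card G) \<and> U \<inter> psp G = {0}. coords \<phi> $ U)"
      by (auto intro!: sum.cong simp: coords_def)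
    finally show ?thesis .
  qed
  \<comment> \<open>A dependent \<open>G\<close> lies in no basis, so its condition is an empty
    sum.\<close>
  have nonindep: "(\<Sum>B | B \<in> bases proj_indep \<and> G \<subseteq> B. Poly_Mapping.lookup \<phi> (indicator_monom (B - G))) = 0"
    if G: "G \<notin> proj_indep" for G :: "('f ^ 'n) set set"
  proof -
    have "{B. B \<in> bases proj_indep \<and> G \<subseteq> B} = {}"
      using matroid.indep_subset[OF matroid_proj, of _ G] G by (auto simp: bases_def)
    then show ?thesis by (simp only: sum.empty)
  qed
  have "act \<phi> (basis_poly proj_indep) = 0 \<longleftrightarrow> (\<forall>G. finite G \<longrightarrow>
      (\<Sum>B | B \<in> bases proj_indep \<and> G \<subseteq> B. Poly_Mapping.lookup \<phi> (indicator_monom (B - G))) = 0)"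
    unfolding basis_poly_def by (rule act_basis_poly_eq_0_iff) auto
  also have "\<dots> \<longleftrightarrow> (\<forall>G\<in>proj_indep.
      (\<Sum>B | B \<in> bases proj_indep \<and> G \<subseteq> B. Poly_Mapping.lookup \<phi> (indicator_monom (B - G))) = 0)"
  proof (intro iffI ballI allI impI)
    fix G :: "('f ^ 'n) set set"
    assume *: "\<forall>G\<in>proj_indep. (\<Sum>B | B \<in> bases proj_indep \<and> G \<subseteq> B. Poly_Mapping.lookup \<phi> (indicator_monom (B - G))) = 0"
    show "(\<Sum>B | B \<in> bases proj_indep \<and> G \<subseteq> B. Poly_Mapping.lookup \<phi> (indicator_monom (B - G))) = 0"
      by (rule case_split[of "G \<in> proj_indep", OF bspec[OF *] nonindep])
  qed (drule spec, drule mp, rule finite_class.finite, assumption)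
  also have "\<dots> \<longleftrightarrow> (\<forall>G\<in>proj_indep.
      (\<Sum>U | U \<in> level (CARD('n) - card G) \<and> U \<inter> psp G = {0}. coords \<phi> $ U) = 0)"
    by (intro ball_cong refl) (simp only: eq)
  also have "\<dots> \<longleftrightarrow> coords \<phi> = 0"
  proof
    assume zero: "\<forall>G\<in>proj_indep. (\<Sum>U | U \<in> level (CARD('n) - card G) \<and> U \<inter> psp G = {0}. coords \<phi> $ U) = 0"
    have "coords \<phi> $ S = 0" for S
    proof (cases "vec.subspace S")
      case True
      show ?thesis
      proof (rule complement_kernel)
        show "S \<in> level (vec.dim S)" using True by (simp add: level_def)
        fix W :: "('f ^ 'n) set" assume W: "W \<in> level (CARD('n) - vec.dim S)"
        then obtain G where G: "G \<in> proj_indep" "psp G = W" using exists_psp_eq[of W] by (auto simp: level_def)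
        \<comment> \<open>Now \<open>CARD('n) - card G\<close> is \<open>vec.dim S\<close> again; as
          subtraction truncates, this rests on \<open>vec.dim S \<le> CARD('n)\<close>.\<close>
        then have "card G = CARD('n) - vec.dim S" using psp_level[OF G(1)] W by (simp add: level_def)
        then show "(\<Sum>U | U \<in> level (vec.dim S) \<and> U \<inter> W = {0}. coords \<phi> $ U) = 0"
          using zero G dim_le_CARD[of S] by auto
      qed
    next
      case False
      then have "{F. F \<in> proj_indep \<and> psp F = S} = {}" by auto
      then show ?thesis by (simp only: coords_def vec_lambda_beta sum.empty)
    qed
    then show "coords \<phi> = 0" by (simp add: vec_eq_iff)
  qed simp
  finally show ?thesis .
qed

section \<open>Coordinates modulo the annihilator\<close>

abbreviation proj_ring :: "(('f::{field,finite} ^ 'n::finite) set, 'k::field_char_0) mpoly ring" where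
  "proj_ring \<equiv> poly_ring proj_space"

section \<open>Closure properties and degrees in the polynomial ring\<close>

lemma poly_ring_simps:
  "p \<otimes>\<^bsub>poly_ring E\<^esub> q = p * q" "\<one>\<^bsub>poly_ring E\<^esub> = 1"
  "\<zero>\<^bsub>poly_ring E\<^esub> = 0" "p \<oplus>\<^bsub>poly_ring E\<^esub> q = p + q"
  by (simp_all add: poly_ring_def)

lemma mem_poly_ring: "p \<in> carrier (poly_ring E) \<longleftrightarrow> (\<forall>m\<in>Poly_Mapping.keys p. Poly_Mapping.keys m \<subseteq> E)"
  by (simp add: poly_ring_def)

lemma single_mem_poly_ring: "Poly_Mapping.keys m \<subseteq> E \<Longrightarrow> Poly_Mapping.single m c \<in> carrier (poly_ring E)"
  by (simp add: mem_poly_ring)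

lemma mconst_mem_poly_ring: "mconst c \<in> carrier (poly_ring E)"
  by (simp add: mconst_def single_mem_poly_ring)

lemma mvar_mem_poly_ring: "e \<in> E \<Longrightarrow> mvar e \<in> carrier (poly_ring E)"
  by (simp add: mvar_def single_mem_poly_ring)

lemma add_mem_poly_ring:
  "p \<in> carrier (poly_ring E) \<Longrightarrow> q \<in> carrier (poly_ring E) \<Longrightarrow> p + q \<in> carrier (poly_ring E)"
  using keys_add[of p q] by (auto simp: mem_poly_ring)

lemma uminus_mem_poly_ring: "p \<in> carrier (poly_ring E) \<Longrightarrow> - p \<in> carrier (poly_ring E)"
  by (simp add: mem_poly_ring in_keys_iff)

lemma mult_mem_poly_ring:
  fixes p q :: "('e, 'k::comm_ring_1) mpoly"
  assumes "p \<in> carrier (poly_ring E)" "q \<in> carrier (poly_ring E)"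
  shows "p * q \<in> carrier (poly_ring E)"
  unfolding mem_poly_ring
proof
  fix m assume "m \<in> Poly_Mapping.keys (p * q)"
  then obtain a b where "m = a + b" "a \<in> Poly_Mapping.keys p" "b \<in> Poly_Mapping.keys q"
    using keys_mult[of p q] by blast
  then show "Poly_Mapping.keys m \<subseteq> E" using keys_add[of a b] assms by (auto simp: mem_poly_ring)
qed

lemma diff_mem_poly_ring:
  "p \<in> carrier (poly_ring E) \<Longrightarrow> q \<in> carrier (poly_ring E) \<Longrightarrow> p - q \<in> carrier (poly_ring E)"
  using add_mem_poly_ring[of p E "- q"] uminus_mem_poly_ring[of q E] by simp

lemma sum_mem_poly_ring:
  "(\<And>x. x \<in> X \<Longrightarrow> f x \<in> carrier (poly_ring E)) \<Longrightarrow> sum f X \<in> carrier (poly_ring E)"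
proof (induction X rule: infinite_finite_induct)
  case (insert x X)
  then show ?case by (simp add: add_mem_poly_ring)
qed (simp_all add: mem_poly_ring)

lemma mvars_prod_mem_poly_ring: "finite S \<Longrightarrow> S \<subseteq> E \<Longrightarrow> mvars_prod S \<in> carrier (poly_ring E)"
  by (simp add: mvars_prod_eq_single single_mem_poly_ring keys_indicator_monom)

lemma cring_poly_ring: "cring (poly_ring E :: ('e, 'k::comm_ring_1) mpoly ring)"
proof (rule cringI)
  show "abelian_group (poly_ring E :: ('e, 'k) mpoly ring)"
  proof (rule abelian_groupI)
    fix p :: "('e, 'k) mpoly" assume "p \<in> carrier (poly_ring E)"
    then show "\<exists>q\<in>carrier (poly_ring E). q \<oplus>\<^bsub>poly_ring E\<^esub> p = \<zero>\<^bsub>poly_ring E\<^esub>"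
      by (intro bexI[of _ "- p"]) (auto simp: poly_ring_simps uminus_mem_poly_ring)
  qed (auto simp: poly_ring_simps add_mem_poly_ring ac_simps, simp add: mem_poly_ring)
  show "Group.comm_monoid (poly_ring E :: ('e, 'k) mpoly ring)"
    by (rule comm_monoidI)
      (auto simp: poly_ring_simps mult_mem_poly_ring ac_simps, metis mconst_mem_poly_ring mconst_def single_one)
qed (simp add: poly_ring_simps distrib_right)

lemma poly_ring_a_minus:
  fixes p q :: "('e, 'k::comm_ring_1) mpoly"
  assumes "p \<in> carrier (poly_ring E)" "q \<in> carrier (poly_ring E)"
  shows "p \<ominus>\<^bsub>poly_ring E\<^esub> q = p - q"
proof -
  interpret cring "poly_ring E :: ('e, 'k) mpoly ring" by (rule cring_poly_ring)
  have "\<ominus>\<^bsub>poly_ring E\<^esub> q = - q"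
    using assms(2) by (intro minus_equality) (auto simp: poly_ring_simps uminus_mem_poly_ring)
  then show ?thesis by (simp add: a_minus_def poly_ring_simps)
qed

lemma mdeg_eq_sum:
  assumes "finite K" "Poly_Mapping.keys m \<subseteq> K"
  shows "mdeg m = (\<Sum>e\<in>K. Poly_Mapping.lookup m e)"
  unfolding mdeg_def using assms by (intro sum.mono_neutral_left) (auto simp: in_keys_iff)

lemma mdeg_add: "mdeg (a + b) = mdeg a + mdeg b"
proof -
  let ?K = "Poly_Mapping.keys a \<union> Poly_Mapping.keys b"
  have "mdeg (a + b) = (\<Sum>e\<in>?K. Poly_Mapping.lookup (a + b) e)" by (intro mdeg_eq_sum keys_add) auto
  also have "\<dots> = mdeg a + mdeg b"
    using mdeg_eq_sum[of ?K a] mdeg_eq_sum[of ?K b] by (simp add: lookup_add sum.distrib)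
  finally show ?thesis .
qed

lemma homogeneous_mult:
  fixes p q :: "('e, 'k::comm_ring_1) mpoly"
  assumes "homogeneous i p" "homogeneous j q"
  shows "homogeneous (i + j) (p * q)"
  unfolding homogeneous_def
proof
  fix m assume "m \<in> Poly_Mapping.keys (p * q)"
  then obtain a b where "m = a + b" "a \<in> Poly_Mapping.keys p" "b \<in> Poly_Mapping.keys q"
    using keys_mult[of p q] by blast
  then show "mdeg m = i + j" using assms by (simp add: homogeneous_def mdeg_add)
qed

lemma homogeneous_sum:
  assumes "\<And>x. x \<in> X \<Longrightarrow> homogeneous d (f x)"
  shows "homogeneous d (sum f X)"
  using assms
proof (induction X rule: infinite_finite_induct)
  case (insert x X)
  then show ?case using keys_add[of "f x" "sum f X"] by (auto simp: homogeneous_def)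
qed (auto simp: homogeneous_def)

lemma sum_single_keys: "p = (\<Sum>m\<in>Poly_Mapping.keys p. Poly_Mapping.single m (Poly_Mapping.lookup p m))"
  by (intro poly_mapping_eqI) (auto simp: lookup_sum lookup_single when_def in_keys_iff)

lemma single_monom_decompose:
  assumes "e \<in> Poly_Mapping.keys m"
  obtains m' where "m = Poly_Mapping.single e 1 + m'"
    "\<And>c. Poly_Mapping.single m c = mvar e * Poly_Mapping.single m' c" "mdeg m = Suc (mdeg m')"
    "Poly_Mapping.keys m' \<subseteq> Poly_Mapping.keys m"
proof -
  define m' where "m' = m - Poly_Mapping.single e 1"
  have m: "m = Poly_Mapping.single e 1 + m'"
    using assms by (intro poly_mapping_eqI) (auto simp: m'_def lookup_add lookup_minus lookup_single when_def in_keys_iff)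
  have "mdeg (Poly_Mapping.single e (1::nat)) = 1" by (simp add: mdeg_def)
  then have "mdeg m = Suc (mdeg m')" using m mdeg_add[of "Poly_Mapping.single e 1" m'] by simp
  moreover have "Poly_Mapping.keys m' \<subseteq> Poly_Mapping.keys m"
    by (auto simp: m'_def in_keys_iff lookup_minus)
  ultimately show thesis using m by (intro that[of m']) (simp_all add: mvar_def mult_single)
qed

section \<open>Coordinates of sums, monomials and products\<close>

lemma coords_add: "coords (p + q) = coords p + coords q"
  by (simp add: coords_def vec_eq_iff lookup_add sum.distrib)

lemma coords_zero: "coords 0 = 0"
  by (simp add: coords_def vec_eq_iff)

lemma coords_diff: "coords (p - q) = coords p - coords q"
  by (simp add: coords_def vec_eq_iff lookup_minus sum_subtractf)

lemma coords_sum: "coords (sum f X) = (\<Sum>x\<in>X. coords (f x))"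
  by (induction X rule: infinite_finite_induct) (simp_all add: coords_zero coords_add)

lemma coords_mconst_times: "coords (mconst c * p) = c *s coords p"
  by (simp add: coords_def vec_eq_iff lookup_mconst_times sum_distrib_left)

lemma coords_single_indicator:
  fixes F :: "('f::{field,finite} ^ 'n::finite) set set"
  assumes "F \<in> proj_indep"
  shows "coords (Poly_Mapping.single (indicator_monom F) c) = c *s axis (psp F) 1"
  unfolding vec_eq_iff
proof
  fix U
  have "coords (Poly_Mapping.single (indicator_monom F) c) $ U
      = (\<Sum>F' | F' \<in> proj_indep \<and> psp F' = U. if F' = F then c else 0)"
    by (auto simp: coords_def lookup_single when_def indicator_monom_inject intro!: sum.cong)
  then show "coords (Poly_Mapping.single (indicator_monom F) c) $ U = (c *s axis (psp F) 1) $ U"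
    using assms by (auto simp: axis_def)
qed

lemma coords_single_other:
  assumes "\<And>F. F \<in> proj_indep \<Longrightarrow> m \<noteq> indicator_monom F"
  shows "coords (Poly_Mapping.single m c) = 0"
  using assms by (auto simp: coords_def vec_eq_iff lookup_single when_def intro!: sum.neutral)

lemma coords_supported: "coords p \<in> supported {U. vec.subspace U}"
proof -
  have "coords p $ U = 0" if "\<not> vec.subspace U" for U
  proof -
    have "{F. F \<in> proj_indep \<and> psp F = U} = {}" using that by auto
    then show ?thesis by (simp only: coords_def vec_lambda_beta sum.empty)
  qed
  then show ?thesis by (auto simp: supported_def)
qed

lemma coords_homogeneous:
  assumes "homogeneous d p"
  shows "coords p \<in> supported (level d)"
proof -
  have "coords p $ U = 0" if U: "U \<notin> level d" for U
    unfolding coords_def vec_lambda_beta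
  proof (intro sum.neutral ballI)
    fix F assume F: "F \<in> {F. F \<in> proj_indep \<and> psp F = U}"
    then have "card F \<noteq> d" using psp_level[of F] U by auto
    then show "Poly_Mapping.lookup p (indicator_monom F) = 0"
      using assms mdeg_indicator_monom[of F] unfolding homogeneous_def
      by (cases "indicator_monom F \<in> Poly_Mapping.keys p") (auto simp: in_keys_iff)
  qed
  then show ?thesis by (auto simp: supported_def)
qed

text \<open>A squarefree monomial of \<open>mvar e * p\<close> arises by adding \<open>e\<close> to
  a support, and \<open>insert e F\<close> is independent exactly when \<open>F\<close> is and
  \<open>e\<close> lies outside \<open>psp F\<close>. So the class of \<open>U\<close> goes to that
  of \<open>join e U\<close>, or to zero if \<open>e \<subseteq> U\<close>; the result depends on
  \<open>p\<close> only through \<open>coords p\<close>.\<close>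

lemma coords_mvar_times:
  fixes p :: "(('f::{field,finite} ^ 'n::finite) set, 'k::field_char_0) mpoly"
  assumes e: "e \<in> proj_space"
  shows "coords (mvar e * p) $ W = (\<Sum>U | \<not> e \<subseteq> U \<and> join e U = W. coords p $ U)"
proof -
  let ?l = "\<lambda>F. Poly_Mapping.lookup p (indicator_monom F)"
  have mult: "Poly_Mapping.lookup (mvar e * p) (indicator_monom F) = (if e \<in> F then ?l (F - {e}) else 0)" for F
  proof (cases "e \<in> F")
    case True
    then have "indicator_monom F = Poly_Mapping.single e 1 + indicator_monom (F - {e})"
      using indicator_monom_insert[of "F - {e}" e] by (simp add: insert_absorb)
    then show ?thesis using True lookup_single_times(1)[of "Poly_Mapping.single e 1" 1 p] by (simp add: mvar_def)
  next
    case False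
    have "indicator_monom F \<noteq> Poly_Mapping.single e 1 + m'" for m'
    proof
      assume eq: "indicator_monom F = Poly_Mapping.single e 1 + m'"
      have "Poly_Mapping.lookup (indicator_monom F) e = 0" using False by (simp add: lookup_indicator_monom)
      then show False by (simp add: eq lookup_add)
    qed
    then show ?thesis
      using False lookup_single_times(2)[of "indicator_monom F" "Poly_Mapping.single e 1" 1 p] by (simp add: mvar_def)
  qed
  have "coords (mvar e * p) $ W = (\<Sum>F | F \<in> proj_indep \<and> psp F = W. if e \<in> F then ?l (F - {e}) else 0)"
    by (simp add: coords_def mult)
  also have "\<dots> = (\<Sum>F\<in>{F \<in> {F. F \<in> proj_indep \<and> psp F = W}. e \<in> F}. ?l (F - {e}))"
    by (rule sum.inter_filter[symmetric]) simp
  also have "\<dots> = (\<Sum>F | F \<in> proj_indep \<and> \<not> e \<subseteq> psp F \<and> join e (psp F) = W. ?l F)"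
  proof (rule sum.reindex_bij_witness[where i = "insert e" and j = "\<lambda>F. F - {e}"])
    fix F assume F: "F \<in> {F \<in> {F. F \<in> proj_indep \<and> psp F = W}. e \<in> F}"
    then have ind: "F - {e} \<in> proj_indep" using matroid.indep_subset[OF matroid_proj, of F "F - {e}"] by auto
    moreover have "insert e (F - {e}) = F" using F by auto
    ultimately show "F - {e} \<in> {F. F \<in> proj_indep \<and> \<not> e \<subseteq> psp F \<and> join e (psp F) = W}"
      using insert_proj_indep_iff[OF ind e] psp_insert[of e "F - {e}"] F by auto
  next
    fix F assume F: "F \<in> {F. F \<in> proj_indep \<and> \<not> e \<subseteq> psp F \<and> join e (psp F) = W}"
    then have "e \<notin> F" using mem_subset_psp[of e F] by auto
    then show "insert e F - {e} = F" "insert e F \<in> {F \<in> {F. F \<in> proj_indep \<and> psp F = W}. e \<in> F}"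
      using F insert_proj_indep_iff[of F e] e psp_insert[of e F] by auto
  qed auto
  also have "\<dots> = (\<Sum>U | \<not> e \<subseteq> U \<and> join e U = W.
      \<Sum>F | F \<in> {F. F \<in> proj_indep \<and> \<not> e \<subseteq> psp F \<and> join e (psp F) = W} \<and> psp F = U. ?l F)"
    by (rule sum.group[symmetric]) auto
  also have "\<dots> = (\<Sum>U | \<not> e \<subseteq> U \<and> join e U = W. coords p $ U)"
    by (auto intro!: sum.cong simp: coords_def)
  finally show ?thesis .
qed

text \<open>Variables act on coordinates, so vanishing coordinates persist when the variables of a
  monomial are multiplied on one at a time. This makes the kernel of \<open>coords\<close> an
  ideal.\<close>

lemma coords_mult_eq_0:
  fixes p q :: "(('f::{field,finite} ^ 'n::finite) set, 'k::field_char_0) mpoly"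
  assumes q: "q \<in> carrier proj_ring" and p: "coords p = 0"
  shows "coords (q * p) = 0"
proof -
  have monom: "coords (Poly_Mapping.single m c * p) = 0" if "Poly_Mapping.keys m \<subseteq> proj_space" for m c
    using that
  proof (induction "mdeg m" arbitrary: m)
    case 0
    then have "m = 0" by (intro poly_mapping_eqI) (auto simp: mdeg_def in_keys_iff)
    then show ?case using coords_mconst_times[of c p] p by (simp add: mconst_def)
  next
    case (Suc d)
    then have "Poly_Mapping.keys m \<noteq> {}" by (auto simp: mdeg_def)
    then obtain e where e: "e \<in> Poly_Mapping.keys m" by blast
    obtain m' where m': "\<And>c. Poly_Mapping.single m c = mvar e * Poly_Mapping.single m' (c :: 'k)"
      "mdeg m = Suc (mdeg m')" "Poly_Mapping.keys m' \<subseteq> Poly_Mapping.keys m"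
      using single_monom_decompose[OF e] by metis
    have "coords (Poly_Mapping.single m' c * p) = 0" using Suc m' by auto
    then have "coords (mvar e * (Poly_Mapping.single m' c * p)) = 0"
      using e Suc.prems by (subst vec_eq_iff) (auto simp: coords_mvar_times)
    then show ?case by (simp add: m'(1) mult.assoc)
  qed
  have "q * p = (\<Sum>m\<in>Poly_Mapping.keys q. Poly_Mapping.single m (Poly_Mapping.lookup q m) * p)"
    by (subst (1) sum_single_keys) (simp add: sum_distrib_right)
  then show ?thesis using q monom by (simp add: coords_sum mem_poly_ring)
qed

section \<open>A section of the coordinate map\<close>

definition flat_basis :: "('f::{field,finite} ^ 'n::finite) set \<Rightarrow> ('f ^ 'n) set set" where
  "flat_basis U = (SOME F. F \<in> proj_indep \<and> psp F = U)"

lemma flat_basis: "vec.subspace U \<Longrightarrow> flat_basis U \<in> proj_indep \<and> psp (flat_basis U) = U"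
  unfolding flat_basis_def by (rule someI_ex) (use exists_psp_eq[of U] in blast)

definition of_coords :: "'k ^ ('f ^ 'n) set \<Rightarrow> (('f::{field,finite} ^ 'n::finite) set, 'k::field_char_0) mpoly" where
  "of_coords v = (\<Sum>U | vec.subspace U. mconst (v $ U) * mvars_prod (flat_basis U))"

lemma mconst_times_mvars_prod: "mconst c * mvars_prod F = Poly_Mapping.single (indicator_monom F) c"
  by (simp add: mconst_def mvars_prod_eq_single mult_single)

lemma of_coords_mem: "of_coords v \<in> carrier proj_ring"
proof -
  have "flat_basis U \<subseteq> proj_space" if "vec.subspace U" for U :: "('a ^ 'b) set"
    using flat_basis[OF that] by (simp add: proj_indep_def)
  then show ?thesis unfolding of_coords_def
    by (intro sum_mem_poly_ring mult_mem_poly_ring mconst_mem_poly_ring mvars_prod_mem_poly_ring) auto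
qed

lemma coords_of_coords:
  assumes "v \<in> supported {U. vec.subspace U}"
  shows "coords (of_coords v) = v"
  unfolding vec_eq_iff
proof
  fix W
  have "coords (mconst (v $ U) * mvars_prod (flat_basis U)) $ W = (if U = W then v $ U else 0)"
    if "vec.subspace U" for U
    using flat_basis[OF that] by (simp add: mconst_times_mvars_prod coords_single_indicator axis_def)
  then have "coords (of_coords v) $ W = (\<Sum>U | vec.subspace U. if U = W then v $ U else 0)"
    by (simp add: of_coords_def coords_sum)
  also have "\<dots> = v $ W" using assms by (simp add: supported_def)
  finally show "coords (of_coords v) $ W = v $ W" .
qed

lemma homogeneous_of_coords:
  fixes v :: "'k::field_char_0 ^ ('f::{field,finite} ^ 'n::finite) set"
  assumes "v \<in> supported (level d)"
  shows "homogeneous d (of_coords v)"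
  unfolding of_coords_def
proof (rule homogeneous_sum)
  fix U :: "('f ^ 'n) set" assume U: "U \<in> {U. vec.subspace U}"
  show "homogeneous d (mconst (v $ U) * mvars_prod (flat_basis U))"
  proof (cases "U \<in> level d")
    case True
    then have "card (flat_basis U) = d" using psp_level[of "flat_basis U"] flat_basis[of U] by (auto simp: level_def)
    then show ?thesis by (auto simp: mconst_times_mvars_prod homogeneous_def mdeg_indicator_monom)
  next
    case False
    then show ?thesis using assms by (simp add: supported_def mconst_times_mvars_prod homogeneous_def)
  qed
qed

section \<open>The Lefschetz map\<close>

text \<open>The operator that multiplication by the sum of all variables induces on
  coordinates.\<close>

definition raise :: "'k::field_char_0 ^ ('f::{field,finite} ^ 'n::finite) set \<Rightarrow> 'k ^ ('f ^ 'n) set" where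
  "raise v = (\<chi> W. \<Sum>e\<in>proj_space. \<Sum>U | \<not> e \<subseteq> U \<and> join e U = W. v $ U)"

lemma linear_raise: "Vector_Spaces.linear (*s) (*s) raise"
  by unfold_locales (auto simp: raise_def vec_eq_iff sum.distrib sum_distrib_left)

lemma coords_sum_mvars_times:
  "coords ((\<Sum>e\<in>proj_space. mvar e) * p) = raise (coords p)"
  by (simp add: vec_eq_iff raise_def sum_distrib_right coords_sum coords_mvar_times)

lemma raise_supported:
  assumes "v \<in> supported (level i)"
  shows "raise v \<in> supported (level (i + 1))"
proof -
  have "raise v $ W = 0" if W: "W \<notin> level (i + 1)" for W
    unfolding raise_def vec_lambda_beta
  proof (intro sum.neutral ballI)
    fix e U assume "e \<in> proj_space" "U \<in> {U. \<not> e \<subseteq> U \<and> join e U = W}"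
    then have "U \<notin> level i" using join_level[of e U i] W by auto
    then show "v $ U = 0" using assms by (simp add: supported_def)
  qed
  then show ?thesis by (simp add: supported_def)
qed

lemma funpow_raise_supported: "v \<in> supported (level i) \<Longrightarrow> (raise ^^ h) v \<in> supported (level (i + h))"
  by (induction h) (auto dest: raise_supported)

lemma linear_funpow_raise:
  "Vector_Spaces.linear (*s) (*s)
    (raise ^^ h :: 'k::field_char_0 ^ ('f::{field,finite} ^ 'n::finite) set \<Rightarrow> 'k ^ ('f ^ 'n) set)"
proof (induction h)
  case 0
  show ?case by unfold_locales auto
next
  case (Suc h)
  interpret R: Vector_Spaces.linear "(*s)" "(*s)" "raise :: 'k ^ ('f ^ 'n) set \<Rightarrow> _" by (rule linear_raise)
  interpret H: Vector_Spaces.linear "(*s)" "(*s)" "raise ^^ h :: 'k ^ ('f ^ 'n) set \<Rightarrow> _" by (rule Suc)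
  show ?case by unfold_locales (simp_all add: R.add R.scale H.add H.scale)
qed

text \<open>The sizes of \<open>points U\<close> and \<open>points W\<close> depend only on the
  dimensions, so the weight in \<open>incidence_raise\<close> is one constant for all nested pairs
  of given dimensions.\<close>

lemma card_points_diff:
  fixes U W U' W' :: "('f::{field,finite} ^ 'n::finite) set"
  assumes "U \<in> level i" "W \<in> level j" "U' \<in> level i" "W' \<in> level j" "U \<subseteq> W" "U' \<subseteq> W'"
  shows "card (points W - points U) = card (points W' - points U')"
proof -
  have "card (points W - points U) = card (points W) - card (points U)" if "U \<subseteq> W" for U W :: "('f ^ 'n) set"
    using that by (intro card_Diff_subset) (auto simp: points_def)
  then show ?thesis
    using assms card_points_eq[of U U'] card_points_eq[of W W'] by (simp add: level_def)
qed

lemma exists_level_above: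
  fixes U :: "('f::{field,finite} ^ 'n::finite) set"
  assumes "U \<in> level i" "i \<le> j" "j \<le> CARD('n)"
  shows "\<exists>W\<in>level j. U \<subseteq> W"
  using assms(2,3)
proof (induction j rule: dec_induct)
  case base
  then show ?case using assms(1) by auto
next
  case (step j)
  then obtain W where W: "W \<in> level j" "U \<subseteq> W" by auto
  have "W \<noteq> UNIV"
    using W(1) step.prems vec_dim_card[where 'a = 'f and 'n = 'n] by (auto simp: level_def simp del: vec.dim_UNIV)
  then obtain x where "x \<notin> W" by auto
  then have "vec.span (insert x W) \<in> level (Suc j)"
    using dim_span_insert[of W x] W by (simp add: level_def)
  moreover have "U \<subseteq> vec.span (insert x W)" using W vec.span_superset[of "insert x W"] by auto
  ultimately show ?case by auto
qed

text \<open>\<open>join e U \<subseteq> W\<close> holds exactly when \<open>e\<close> and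
  \<open>U\<close> both lie in \<open>W\<close>. Each \<open>U \<subseteq> W\<close> is therefore
  reached once for every point of \<open>W\<close> outside \<open>U\<close>.\<close>

lemma incidence_raise:
  fixes v :: "'k::field_char_0 ^ ('f::{field,finite} ^ 'n::finite) set"
  assumes v: "v \<in> supported (level i)" and W: "W \<in> level j"
  shows "(\<Sum>U | U \<subseteq> W. raise v $ U) = (\<Sum>U | U \<subseteq> W. of_nat (card (points W - points U)) * v $ U)"
proof -
  have "(\<Sum>U' | U' \<subseteq> W. raise v $ U')
      = (\<Sum>e\<in>proj_space. \<Sum>U' | U' \<subseteq> W. \<Sum>U | \<not> e \<subseteq> U \<and> join e U = U'. v $ U)"
    by (simp add: raise_def) (rule sum.swap)
  also have "\<dots> = (\<Sum>e\<in>proj_space. \<Sum>U | U \<subseteq> W. if e \<in> points W - points U then v $ U else 0)"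
  proof (rule sum.cong[OF refl])
    fix e :: "('f ^ 'n) set" assume e: "e \<in> proj_space"
    have "(\<Sum>U' | U' \<subseteq> W. \<Sum>U | \<not> e \<subseteq> U \<and> join e U = U'. v $ U)
        = (\<Sum>U' | U' \<subseteq> W. \<Sum>U | U \<in> {U. \<not> e \<subseteq> U \<and> join e U \<subseteq> W} \<and> join e U = U'. v $ U)"
      by (intro sum.cong) auto
    also have "\<dots> = (\<Sum>U | \<not> e \<subseteq> U \<and> join e U \<subseteq> W. v $ U)" by (rule sum.group) auto
    also have "\<dots> = (\<Sum>U\<in>{U \<in> {U. U \<subseteq> W}. e \<in> points W - points U}. v $ U)"
    proof (rule sum.cong)
      have "join e U \<subseteq> W \<longleftrightarrow> e \<subseteq> W \<and> U \<subseteq> W" for U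
        using W vec.span_minimal[of "e \<union> U" W] vec.span_superset[of "e \<union> U"] by (auto simp: level_def)
      then show "{U. \<not> e \<subseteq> U \<and> join e U \<subseteq> W} = {U \<in> {U. U \<subseteq> W}. e \<in> points W - points U}"
        using e by (auto simp: points_def)
    qed simp
    also have "\<dots> = (\<Sum>U | U \<subseteq> W. if e \<in> points W - points U then v $ U else 0)"
      by (rule sum.inter_filter) simp
    finally show "(\<Sum>U' | U' \<subseteq> W. \<Sum>U | \<not> e \<subseteq> U \<and> join e U = U'. v $ U)
        = (\<Sum>U | U \<subseteq> W. if e \<in> points W - points U then v $ U else 0)" .
  qed
  also have "\<dots> = (\<Sum>U | U \<subseteq> W. \<Sum>e\<in>proj_space. if e \<in> points W - points U then v $ U else 0)"
    by (rule sum.swap)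
  also have "\<dots> = (\<Sum>U | U \<subseteq> W. of_nat (card (points W - points U)) * v $ U)"
  proof (rule sum.cong[OF refl])
    fix U
    have "(\<Sum>e\<in>proj_space. if e \<in> points W - points U then v $ U else 0)
        = (\<Sum>e\<in>{e \<in> proj_space. e \<in> points W - points U}. v $ U)"
      by (rule sum.inter_filter[symmetric]) simp
    also have "{e \<in> proj_space. e \<in> points W - points U} = points W - points U" by (auto simp: points_def)
    finally show "(\<Sum>e\<in>proj_space. if e \<in> points W - points U then v $ U else 0)
        = of_nat (card (points W - points U)) * v $ U" by simp
  qed
  finally show ?thesis .
qed

text \<open>The constant is the number of ways to climb from \<open>U\<close> to \<open>W\<close> by
  joining \<open>h\<close> points, each outside the subspace reached before; every step contributes
  the number of points of \<open>W\<close> not yet reached.\<close>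

lemma funpow_raise_eq_incidence:
  assumes "i + h \<le> CARD('n)"
  shows "\<exists>c\<noteq>0. \<forall>v :: 'k::field_char_0 ^ ('f::{field,finite} ^ 'n::finite) set. v \<in> supported (level i) \<longrightarrow>
    (raise ^^ h) v = c *s incidence (level (i + h)) (\<subseteq>) v"
  using assms
proof (induction h arbitrary: i)
  case 0
  \<comment> \<open>Within one level inclusion is equality, so the constant for \<open>h = 0\<close>
    is \<open>1\<close>.\<close>
  have "v = incidence (level i) (\<subseteq>) v" if v: "v \<in> supported (level i)" for v :: "'k ^ ('f ^ 'n) set"
    unfolding vec_eq_iff
  proof
    fix W :: "('f ^ 'n) set"
    show "v $ W = incidence (level i) (\<subseteq>) v $ W"
    proof (cases "W \<in> level i")
      case True
      have "v $ U = 0" if "U \<in> {U. U \<subseteq> W} - {W}" for U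
      proof -
        have "U \<subset> W" using that by auto
        then have "U \<notin> level i" using subspace_dim_less[of U W] True by (auto simp: level_def)
        then show ?thesis using v by (simp add: supported_def)
      qed
      then have "(\<Sum>U | U \<subseteq> W. v $ U) = (\<Sum>U\<in>{W}. v $ U)" by (intro sum.mono_neutral_right) auto
      then show ?thesis using True by (simp add: incidence_def)
    next
      case False
      then show ?thesis using v by (simp add: incidence_def supported_def)
    qed
  qed
  then show ?case by (intro exI[of _ 1]) (simp add: vec_eq_iff)
next
  case (Suc h)
  let ?j = "i + Suc h"
  obtain c :: 'k where c: "c \<noteq> 0" "\<And>v :: 'k ^ ('f ^ 'n) set. v \<in> supported (level (i + 1)) \<Longrightarrow>
      (raise ^^ h) v = c *s incidence (level (i + 1 + h)) (\<subseteq>) v"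
    using Suc.IH[of "i + 1"] Suc.prems by auto
  \<comment> \<open>Any nested pair of the two dimensions yields the same count \<open>P\<close>.
    Such a pair exists because the upper dimension is at most \<open>CARD('n)\<close>, and
    strictness of the inclusion makes \<open>P\<close> nonzero.\<close>
  have "\<exists>U \<in> level i :: ('f ^ 'n) set set. True"
    using exists_level_above[of "{0} :: ('f ^ 'n) set" 0 i] Suc.prems by (auto simp: level_def)
  then obtain U0 :: "('f ^ 'n) set" where U0: "U0 \<in> level i" by auto
  then obtain W0 where W0: "W0 \<in> level ?j" "U0 \<subseteq> W0" using exists_level_above[OF U0, of ?j] Suc.prems by auto
  define P where "P = card (points W0 - points U0)"
  have "P \<noteq> 0"
  proof
    assume "P = 0"
    then have "points W0 \<subseteq> points U0" by (simp add: P_def)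
    then have "psp (points W0) \<subseteq> psp (points U0)" by (intro vec.span_mono) auto
    then have "W0 \<subseteq> U0" using points_psp[of W0] points_psp[of U0] U0 W0 by (simp add: level_def)
    then show False using U0 W0 by (simp add: level_def)
  qed
  moreover have "(raise ^^ Suc h) v = (c * of_nat P) *s incidence (level ?j) (\<subseteq>) v"
    if v: "v \<in> supported (level i)" for v :: "'k ^ ('f ^ 'n) set"
  proof -
    \<comment> \<open>The first raise is split off: the induction hypothesis leads from level
      \<open>i + 1\<close> to the same top level.\<close>
    have "(raise ^^ Suc h) v = c *s incidence (level ?j) (\<subseteq>) (raise v)"
      using c(2)[of "raise v"] raise_supported[OF v] by (simp add: funpow_Suc_right del: funpow.simps)
    also have "incidence (level ?j) (\<subseteq>) (raise v) = of_nat P *s incidence (level ?j) (\<subseteq>) v"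
      unfolding vec_eq_iff
    proof
      fix W :: "('f ^ 'n) set"
      show "incidence (level ?j) (\<subseteq>) (raise v) $ W = (of_nat P *s incidence (level ?j) (\<subseteq>) v) $ W"
      proof (cases "W \<in> level ?j")
        case True
        have "of_nat (card (points W - points U)) * v $ U = of_nat P * v $ U" if "U \<subseteq> W" for U
        proof (cases "U \<in> level i")
          case U: True
          then show ?thesis using card_points_diff[OF U True U0 W0(1) that W0(2)] by (simp add: P_def)
        qed (use v in \<open>simp add: supported_def\<close>)
        then have "(\<Sum>U | U \<subseteq> W. of_nat (card (points W - points U)) * v $ U)
            = of_nat P * (\<Sum>U | U \<subseteq> W. v $ U)"
          unfolding sum_distrib_left by (intro sum.cong) auto
        then show ?thesis
          using True incidence_raise[OF v True] by (simp add: incidence_def)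
      qed (simp add: incidence_def)
    qed
    finally show ?thesis by (simp add: vector_smult_assoc)
  qed
  ultimately show ?case using c(1) by (intro exI[of _ "c * of_nat P"]) auto
qed

text \<open>Injectivity is \<open>inclusion_kernel\<close> at \<open>j = CARD('n) - i\<close>, where
  the bound on \<open>i + j\<close> is sharp. Surjectivity follows from the equal sizes of the two
  levels.\<close>

lemma bij_betw_funpow_raise:
  assumes "2 * i \<le> CARD('n)"
  shows "bij_betw (raise ^^ (CARD('n) - 2 * i))
    (supported (level i) :: ('k::field_char_0 ^ ('f::{field,finite} ^ 'n::finite) set) set) (supported (level (CARD('n) - i)))"
proof (rule bij_betw_supported[OF linear_funpow_raise])
  have eq: "i + (CARD('n) - 2 * i) = CARD('n) - i" using assms by simp
  then show "(raise ^^ (CARD('n) - 2 * i)) v \<in> supported (level (CARD('n) - i))"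
    if "v \<in> supported (level i)" for v :: "'k ^ ('f ^ 'n) set"
    using funpow_raise_supported[OF that, of "CARD('n) - 2 * i"] by simp
  show "card (level i :: ('f ^ 'n) set set) = card (level (CARD('n) - i) :: ('f ^ 'n) set set)"
    using assms by (intro card_level_symmetric) simp
  fix v :: "'k ^ ('f ^ 'n) set"
  assume v: "v \<in> supported (level i)" and zero: "(raise ^^ (CARD('n) - 2 * i)) v = 0"
  obtain c :: 'k where "c \<noteq> 0" "(raise ^^ (CARD('n) - 2 * i)) v = c *s incidence (level (CARD('n) - i)) (\<subseteq>) v"
    using funpow_raise_eq_incidence[of i "CARD('n) - 2 * i", where 'k = 'k and 'f = 'f and 'n = 'n] eq assms v by auto
  then have inc: "incidence (level (CARD('n) - i)) (\<subseteq>) v = 0" using zero by (simp add: vector_mul_eq_0)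
  have "v $ S = 0" for S
  proof (cases "S \<in> level i")
    case True
    then show ?thesis
    proof (rule inclusion_kernel[where j = "CARD('n) - i"])
      fix W :: "('f ^ 'n) set" assume W: "W \<in> level (CARD('n) - i)"
      have "(\<Sum>U | U \<in> level i \<and> U \<subseteq> W. v $ U) = (\<Sum>U | U \<subseteq> W. v $ U)"
        using v by (intro sum.mono_neutral_left) (auto simp: supported_def)
      also have "\<dots> = incidence (level (CARD('n) - i)) (\<subseteq>) v $ W" using W by (simp add: incidence_def)
      finally show "(\<Sum>U | U \<in> level i \<and> U \<subseteq> W. v $ U) = 0" by (simp add: inc)
    qed (use assms in auto)
  qed (use v in \<open>simp add: supported_def\<close>)
  then show "v = 0" by (simp add: vec_eq_iff)
qed

section \<open>The annihilator ideal\<close>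

lemma mvar_power2: "mvar e ^ 2 = Poly_Mapping.single (Poly_Mapping.single e 2) 1"
  by (simp add: mvar_def power2_eq_square mult_single numeral_2_eq_2 flip: single_add)

lemma Lambda_carrier:
  "Lambda (proj_space :: ('f::{field,finite} ^ 'n::finite) set set) proj_indep \<subseteq> carrier (proj_ring :: (('f ^ 'n) set, 'k::field_char_0) mpoly ring)"
  by (auto simp: Lambda_def proj_indep_def power2_eq_square
      intro!: mult_mem_poly_ring mvar_mem_poly_ring mvars_prod_mem_poly_ring diff_mem_poly_ring)

lemma coords_Lambda:
  fixes g :: "(('f::{field,finite} ^ 'n::finite) set, 'k::field_char_0) mpoly"
  assumes "g \<in> Lambda proj_space proj_indep"
  shows "coords g = 0"
proof -
  consider e where "e \<in> proj_space" "g = mvar e ^ 2"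
    | S where "S \<notin> proj_indep" "g = mvars_prod S"
    | F F' where "F \<in> proj_indep" "F' \<in> proj_indep" "matroid_equiv proj_space proj_indep F F'"
        "g = mvars_prod F - mvars_prod F'"
    using assms unfolding Lambda_def by blast
  then show ?thesis
  proof cases
    case 1
    have "Poly_Mapping.single e 2 \<noteq> indicator_monom F" for F
    proof
      assume "Poly_Mapping.single e 2 = indicator_monom F"
      then have "Poly_Mapping.lookup (indicator_monom F) e = 2" by (metis lookup_single_eq)
      then show False by (simp add: lookup_indicator_monom split: if_splits)
    qed
    then show ?thesis
      using 1 by (simp add: mvar_power2 coords_single_other)
  next
    case 2
    then show ?thesis
      unfolding 2 mvars_prod_eq_single by (intro coords_single_other) (metis finite_class.finite indicator_monom_inject)
  next
    case 3
    then have "psp F = psp F'" using matroid_equiv_proj_indep[of F F'] by (auto simp: proj_indep_def)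
    then show ?thesis using 3 by (simp add: coords_diff mvars_prod_eq_single coords_single_indicator)
  qed
qed

lemma of_coords_add: "of_coords (v + w) = of_coords v + of_coords w"
  by (simp add: of_coords_def mconst_times_mvars_prod single_add sum.distrib)

lemma of_coords_zero: "of_coords 0 = 0"
  by (simp add: of_coords_def mconst_times_mvars_prod)

lemma of_coords_sum: "of_coords (sum f X) = (\<Sum>x\<in>X. of_coords (f x))"
  by (induction X rule: infinite_finite_induct) (simp_all add: of_coords_zero of_coords_add)

lemma of_coords_axis:
  fixes U :: "('f::{field,finite} ^ 'n::finite) set" and c :: "'k::field_char_0"
  assumes "vec.subspace U"
  shows "of_coords (c *s axis U 1) = mconst c * mvars_prod (flat_basis U)"
proof -
  have "of_coords (c *s axis U 1) = (\<Sum>W | vec.subspace W. if W = U then mconst c * mvars_prod (flat_basis W) else 0)"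
    unfolding of_coords_def by (intro sum.cong) (auto simp: axis_def mconst_times_mvars_prod)
  then show ?thesis using assms by simp
qed

lemma ideal_coords_kernel:
  "ideal {p \<in> carrier proj_ring. coords p = 0} (proj_ring :: (('f::{field,finite} ^ 'n::finite) set, 'k::field_char_0) mpoly ring)"
proof -
  let ?Q = "proj_ring :: (('f ^ 'n) set, 'k) mpoly ring"
  interpret cring ?Q by (rule cring_poly_ring)
  have minus: "\<ominus>\<^bsub>?Q\<^esub> p = - p" if "p \<in> carrier ?Q" for p
    using that by (intro minus_equality) (auto simp: poly_ring_simps uminus_mem_poly_ring)
  show ?thesis
  proof (rule idealI)
    show "ring ?Q" by (rule ring_axioms)
    show "subgroup {p \<in> carrier ?Q. coords p = 0} (add_monoid ?Q)"
    proof (rule add.subgroupI)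
      fix p assume "p \<in> {p \<in> carrier ?Q. coords p = 0}"
      then show "\<ominus>\<^bsub>?Q\<^esub> p \<in> {p \<in> carrier ?Q. coords p = 0}"
        using coords_diff[of 0 p] by (simp add: minus uminus_mem_poly_ring coords_zero)
    next
      show "{p \<in> carrier ?Q. coords p = 0} \<noteq> {}"
        using zero_closed by (auto simp: poly_ring_simps coords_zero intro: exI[of _ 0])
    qed (auto simp: poly_ring_simps coords_add add_mem_poly_ring)
  qed (auto simp: poly_ring_simps coords_mult_eq_0 mult_mem_poly_ring, metis coords_mult_eq_0 mult.commute)
qed

text \<open>One inclusion is checked on generators. For the other,
  \<open>of_coords (coords p)\<close> is a normal form of \<open>p\<close>: each monomial is
  congruent to its normal form by one of the three kinds of relations, and polynomials with zero
  coordinates have normal form \<open>0\<close>.\<close>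

lemma coords_kernel_eq_Idl_Lambda:
  "{p \<in> carrier proj_ring. coords p = 0}
    = Idl\<^bsub>proj_ring\<^esub> (Lambda proj_space proj_indep :: (('f::{field,finite} ^ 'n::finite) set, 'k::field_char_0) mpoly set)"
    (is "?I = ?J")
proof
  let ?Q = "proj_ring :: (('f ^ 'n) set, 'k) mpoly ring"
  let ?L = "Lambda proj_space proj_indep :: (('f ^ 'n) set, 'k) mpoly set"
  interpret cring ?Q by (rule cring_poly_ring)
  show "?J \<subseteq> ?I"
    by (rule genideal_minimal[OF ideal_coords_kernel]) (use Lambda_carrier coords_Lambda in auto)
  interpret J: ideal ?J ?Q by (rule genideal_ideal[OF Lambda_carrier])
  have gen: "g \<in> ?J" if "g \<in> ?L" for g using genideal_self[OF Lambda_carrier] that by auto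
  have J_add: "p + q \<in> ?J" if "p \<in> ?J" "q \<in> ?J" for p q
    using J.a_closed[OF that] by (simp add: poly_ring_simps)
  have J_mult: "p * q \<in> ?J" if "p \<in> carrier ?Q" "q \<in> ?J" for p q
    using J.I_l_closed[OF that(2,1)] by (simp add: poly_ring_simps)
  have J_zero: "0 \<in> ?J" using J.zero_closed by (simp add: poly_ring_simps)
  have J_sum: "sum f X \<in> ?J" if "\<And>x. x \<in> X \<Longrightarrow> f x \<in> ?J" for f :: "_ \<Rightarrow> (('f ^ 'n) set, 'k) mpoly" and X :: "(('f ^ 'n) set \<Rightarrow>\<^sub>0 nat) set"
    using that by (induction X rule: infinite_finite_induct) (auto simp: J_zero J_add)
  have monom: "Poly_Mapping.single m c - of_coords (coords (Poly_Mapping.single m c)) \<in> ?J"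
    if m: "Poly_Mapping.keys m \<subseteq> proj_space" for m and c :: 'k
  proof -
    consider F where "F \<in> proj_indep" "m = indicator_monom F"
      | S where "S \<subseteq> proj_space" "S \<notin> proj_indep" "m = indicator_monom S"
      | "\<And>S. m \<noteq> indicator_monom S"
      using m keys_indicator_monom by (metis finite_class.finite)
    then show ?thesis
    proof cases
      case 1
      let ?F = "flat_basis (psp F)"
      have fb: "?F \<in> proj_indep \<and> psp ?F = psp F" by (rule flat_basis) simp
      have "matroid_equiv proj_space proj_indep F ?F"
        using fb 1(1) by (subst matroid_equiv_proj_indep) (auto simp: proj_indep_def)
      then have "mvars_prod F - mvars_prod ?F \<in> ?L"
        using 1(1) fb unfolding Lambda_def by blast
      then have "mconst c * (mvars_prod F - mvars_prod ?F) \<in> ?J"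
        by (intro J_mult gen mconst_mem_poly_ring)
      then show ?thesis
        using 1 by (simp add: coords_single_indicator of_coords_axis right_diff_distrib mconst_times_mvars_prod)
    next
      case 2
      have "mvars_prod S \<in> ?L" using 2 unfolding Lambda_def by blast
      then have "mconst c * mvars_prod S \<in> ?J" by (intro J_mult gen mconst_mem_poly_ring)
      moreover have "coords (Poly_Mapping.single m c) = 0"
        using 2 by (intro coords_single_other) (metis finite_class.finite indicator_monom_inject)
      ultimately show ?thesis using 2(3) by (simp add: of_coords_zero mconst_times_mvars_prod)
    next
      case 3
      \<comment> \<open>A monomial with all exponents at most \<open>1\<close> is the indicator of
        its support, so here a square divides it.\<close>
      have "\<exists>e. 2 \<le> Poly_Mapping.lookup m e"
      proof (rule ccontr)
        assume "\<not> ?thesis"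
        then have le: "Poly_Mapping.lookup m e \<le> 1" for e by (metis not_less_eq_eq numeral_2_eq_2 One_nat_def)
        have "m = indicator_monom (Poly_Mapping.keys m)"
        proof (rule poly_mapping_eqI)
          fix e show "Poly_Mapping.lookup m e = Poly_Mapping.lookup (indicator_monom (Poly_Mapping.keys m)) e"
            using le[of e] by (auto simp: lookup_indicator_monom in_keys_iff)
        qed
        then show False using 3 by blast
      qed
      then obtain e where e: "2 \<le> Poly_Mapping.lookup m e" by auto
      then have "e \<in> proj_space" using m by (auto simp: in_keys_iff)
      then have "mvar e ^ 2 \<in> ?L" unfolding Lambda_def by blast
      let ?m = "m - Poly_Mapping.single e 2"
      have "?m + Poly_Mapping.single e 2 = m"
        using e by (intro poly_mapping_eqI) (auto simp: lookup_add lookup_minus lookup_single when_def)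
      then have "Poly_Mapping.single ?m c * mvar e ^ 2 = Poly_Mapping.single m c"
        by (simp add: mvar_power2 mult_single)
      moreover have "Poly_Mapping.single ?m c \<in> carrier ?Q"
        using m by (intro single_mem_poly_ring) (auto simp: in_keys_iff lookup_minus)
      ultimately have "Poly_Mapping.single m c \<in> ?J"
        using J_mult[OF _ gen[OF \<open>mvar e ^ 2 \<in> ?L\<close>]] by metis
      moreover have "coords (Poly_Mapping.single m c) = 0" using 3 by (intro coords_single_other) auto
      ultimately show ?thesis by (simp add: of_coords_zero)
    qed
  qed
  show "?I \<subseteq> ?J"
  proof
    fix p assume p: "p \<in> ?I"
    let ?s = "\<lambda>m. Poly_Mapping.single m (Poly_Mapping.lookup p m)"
    have "p = p - of_coords (coords p)" using p by (simp add: of_coords_zero)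
    also have "\<dots> = (\<Sum>m\<in>Poly_Mapping.keys p. ?s m - of_coords (coords (?s m)))"
      unfolding sum_subtractf of_coords_sum[symmetric] coords_sum[symmetric] sum_single_keys[symmetric] ..
    also have "\<dots> \<in> ?J" using p by (intro J_sum monom) (auto simp: mem_poly_ring)
    finally show "p \<in> ?J" .
  qed
qed

lemma ann_proj:
  "ann proj_space (basis_poly proj_indep) = {p \<in> carrier proj_ring. coords p = 0}"
  by (auto simp: ann_def ann_iff_coords_eq_0)

lemma binomial_ideal_coords_kernel:
  "binomial_ideal proj_ring {p \<in> carrier (proj_ring :: (('f::{field,finite} ^ 'n::finite) set, 'k::field_char_0) mpoly ring). coords p = 0}"
  unfolding binomial_ideal_def
proof (intro exI conjI ballI)
  fix g :: "(('f ^ 'n) set, 'k) mpoly" assume g: "g \<in> Lambda proj_space proj_indep"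
  have le1: "card (Poly_Mapping.keys (Poly_Mapping.single m c)) \<le> 1" for m and c :: 'k by simp
  consider e where "g = mvar e ^ 2" | S where "g = mvars_prod S"
    | F F' where "g = mvars_prod F - mvars_prod F'"
    using g unfolding Lambda_def by blast
  then show "card (Poly_Mapping.keys g) \<le> 2"
  proof cases
    case 3
    have "card (Poly_Mapping.keys g) \<le> card {indicator_monom F, indicator_monom F'}"
      unfolding 3 mvars_prod_eq_single by (intro card_mono) (auto dest: keys_diff[THEN subsetD])
    also have "\<dots> \<le> 2" by (simp add: card_insert_if)
    finally show ?thesis .
  qed (use le1 in \<open>simp_all add: mvar_power2 mvars_prod_eq_single\<close>)
qed (fact Lambda_carrier coords_kernel_eq_Idl_Lambda)+

section \<open>The quotient algebra\<close>

text \<open>Stands for the annihilator and the ideal of relations at once, both having been shown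
  equal to it.\<close>

definition coords_kernel :: "(('f::{field,finite} ^ 'n::finite) set, 'k::field_char_0) mpoly set" where
  "coords_kernel = {p \<in> carrier proj_ring. coords p = 0}"

abbreviation flat_algebra :: "(('f::{field,finite} ^ 'n::finite) set, 'k::field_char_0) mpoly set ring" where
  "flat_algebra \<equiv> proj_ring Quot coords_kernel"

abbreviation flat_coset :: "(('f::{field,finite} ^ 'n::finite) set, 'k::field_char_0) mpoly \<Rightarrow> (('f ^ 'n) set, 'k) mpoly set" where
  "flat_coset p \<equiv> coords_kernel +>\<^bsub>proj_ring\<^esub> p"

text \<open>On \<open>flat_vecs\<close> this is a linear bijection onto the quotient, through which
  grading, dimensions and the Lefschetz map are computed.\<close>

definition of_vec :: "'k ^ ('f ^ 'n) set \<Rightarrow> (('f::{field,finite} ^ 'n::finite) set, 'k::field_char_0) mpoly set" where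
  "of_vec v = flat_coset (of_coords v)"

abbreviation flat_vecs :: "('k::field_char_0 ^ ('f::{field,finite} ^ 'n::finite) set) set" where
  "flat_vecs \<equiv> supported {U. vec.subspace U}"

lemma ideal_kernel: "ideal coords_kernel (proj_ring :: (('f::{field,finite} ^ 'n::finite) set, 'k::field_char_0) mpoly ring)"
  unfolding coords_kernel_def by (rule ideal_coords_kernel)

lemma cring_flat_algebra: "cring (flat_algebra :: (('f::{field,finite} ^ 'n::finite) set, 'k::field_char_0) mpoly set ring)"
  by (rule ideal.quotient_is_cring[OF ideal_kernel cring_poly_ring])

lemma flat_coset_hom:
  "ring_hom_cring (proj_ring :: (('f::{field,finite} ^ 'n::finite) set, 'k::field_char_0) mpoly ring) flat_algebra flat_coset"
  by (rule ideal.rcos_ring_hom_cring[OF ideal_kernel cring_poly_ring])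

lemma flat_coset_mult:
  "p \<in> carrier proj_ring \<Longrightarrow> q \<in> carrier proj_ring \<Longrightarrow> flat_coset p \<otimes>\<^bsub>flat_algebra\<^esub> flat_coset q = flat_coset (p * q)"
  using ring_hom_mult[OF ring_hom_cring.homh[OF flat_coset_hom], of p q] by (simp add: poly_ring_simps)

lemma flat_coset_add:
  "p \<in> carrier proj_ring \<Longrightarrow> q \<in> carrier proj_ring \<Longrightarrow> flat_coset p \<oplus>\<^bsub>flat_algebra\<^esub> flat_coset q = flat_coset (p + q)"
  using ring_hom_add[OF ring_hom_cring.homh[OF flat_coset_hom], of p q] by (simp add: poly_ring_simps)

lemma flat_coset_eq_iff:
  fixes p q :: "(('f::{field,finite} ^ 'n::finite) set, 'k::field_char_0) mpoly"
  assumes "p \<in> carrier proj_ring" "q \<in> carrier proj_ring"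
  shows "flat_coset p = flat_coset q \<longleftrightarrow> coords p = coords q"
proof -
  interpret cring "proj_ring :: (('f ^ 'n) set, 'k) mpoly ring" by (rule cring_poly_ring)
  show ?thesis
    using quotient_eq_iff_same_a_r_cos[OF ideal_kernel assms] assms
    by (simp add: poly_ring_a_minus coords_kernel_def coords_diff diff_mem_poly_ring)
qed

lemma flat_coset_eq_of_vec: "p \<in> carrier proj_ring \<Longrightarrow> flat_coset p = of_vec (coords p)"
  unfolding of_vec_def
  by (subst flat_coset_eq_iff) (auto simp: of_coords_mem coords_of_coords coords_supported)

lemma carrier_flat_algebra: "carrier flat_algebra = of_vec ` flat_vecs"
proof -
  have "carrier flat_algebra = flat_coset ` carrier proj_ring"
    by (auto simp: FactRing_def A_RCOSETS_def')
  also have "\<dots> = of_vec ` flat_vecs"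
  proof (intro equalityI subsetI)
    fix a assume "a \<in> of_vec ` flat_vecs"
    then show "a \<in> flat_coset ` carrier proj_ring" using of_coords_mem by (auto simp: of_vec_def)
  qed (use coords_supported flat_coset_eq_of_vec in blast)
  finally show ?thesis .
qed

lemma inj_on_of_vec: "inj_on of_vec flat_vecs"
  by (rule inj_onI) (simp add: of_vec_def flat_coset_eq_iff of_coords_mem coords_of_coords)

lemma of_vec_add:
  "v \<in> flat_vecs \<Longrightarrow> w \<in> flat_vecs \<Longrightarrow> of_vec v \<oplus>\<^bsub>flat_algebra\<^esub> of_vec w = of_vec (v + w)"
  by (simp add: of_vec_def flat_coset_add of_coords_mem of_coords_add)

lemma of_vec_zero:
  "of_vec (0 :: 'k::field_char_0 ^ ('f::{field,finite} ^ 'n::finite) set) = \<zero>\<^bsub>flat_algebra\<^esub>"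
proof -
  interpret ring_hom_cring "proj_ring :: (('f ^ 'n) set, 'k) mpoly ring" flat_algebra flat_coset
    by (rule flat_coset_hom)
  show ?thesis using hom_zero by (simp add: of_vec_def of_coords_zero poly_ring_simps)
qed

lemma flat_coset_times_of_vec:
  assumes "p \<in> carrier proj_ring" "v \<in> flat_vecs"
  shows "flat_coset p \<otimes>\<^bsub>flat_algebra\<^esub> of_vec v = of_vec (coords (p * of_coords v))"
  unfolding of_vec_def[of v] flat_coset_mult[OF assms(1) of_coords_mem]
  by (intro flat_coset_eq_of_vec mult_mem_poly_ring assms of_coords_mem)

lemma scale_of_vec:
  "v \<in> flat_vecs \<Longrightarrow> flat_coset (mconst c) \<otimes>\<^bsub>flat_algebra\<^esub> of_vec v = of_vec (c *s v)"
  by (simp add: flat_coset_times_of_vec mconst_mem_poly_ring coords_mconst_times coords_of_coords)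

lemma supported_mono: "S \<subseteq> T \<Longrightarrow> supported S \<subseteq> supported T"
  by (auto simp: supported_def)

lemma supported_level_subset: "supported (level d) \<subseteq> flat_vecs"
  by (rule supported_mono) (auto simp: level_def)

lemma quot_graded_eq: "quot_graded proj_ring coords_kernel d = of_vec ` supported (level d)"
proof (intro equalityI subsetI)
  fix a assume "a \<in> quot_graded proj_ring coords_kernel d"
  then obtain p where "p \<in> carrier proj_ring" "homogeneous d p" "a = flat_coset p"
    by (auto simp: quot_graded_def)
  then show "a \<in> of_vec ` supported (level d)" using coords_homogeneous flat_coset_eq_of_vec by blast
next
  fix a assume "a \<in> of_vec ` supported (level d)"
  then show "a \<in> quot_graded proj_ring coords_kernel d"
    using homogeneous_of_coords of_coords_mem by (auto simp: quot_graded_def of_vec_def)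
qed

lemma quot_const_eq: "quot_const proj_ring coords_kernel = flat_coset ` range mconst"
  by (auto simp: quot_const_def)

lemma mconst_mult: "mconst c * mconst d = mconst (c * d)"
  by (simp add: mconst_def mult_single)

lemma mconst_add: "mconst c + mconst d = mconst (c + d)"
  by (simp add: mconst_def single_add)

lemma mconst_one: "mconst 1 = 1"
  by (simp add: mconst_def)

lemma subfield_range_mconst: "subfield (range mconst) (poly_ring E :: ('e, 'k::field) mpoly ring)"
proof -
  let ?Q = "poly_ring E :: ('e, 'k) mpoly ring"
  interpret cring ?Q by (rule cring_poly_ring)
  have inj: "mconst c = mconst d \<longleftrightarrow> c = d" for c d :: 'k by (simp add: mconst_def inj_eq)
  have "mconst (- c) + mconst c = (0 :: ('e, 'k) mpoly)" for c
    by (simp add: mconst_def flip: single_add)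
  then have minus: "\<ominus>\<^bsub>?Q\<^esub> mconst c = mconst (- c)" for c
    by (intro minus_equality) (auto simp: poly_ring_simps mconst_mem_poly_ring)
  show ?thesis
  proof (rule subfieldI)
    show "subcring (range mconst) ?Q"
    proof (rule subcringI)
      show "subring (range mconst) ?Q"
        by (rule subringI) (auto simp: mconst_mem_poly_ring poly_ring_simps mconst_mult mconst_add minus
            mconst_one[symmetric])
    qed (auto simp: poly_ring_simps mult.commute)
    show "Units (?Q\<lparr>carrier := range mconst\<rparr>) = range mconst - {\<zero>\<^bsub>?Q\<^esub>}"
    proof (intro equalityI subsetI)
      fix u assume "u \<in> Units (?Q\<lparr>carrier := range mconst\<rparr>)"
      then obtain c d where "u = mconst c" "mconst d * mconst c = (1 :: ('e, 'k) mpoly)"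
        by (auto simp: Units_def poly_ring_simps)
      moreover from this have "d * c = 1" by (simp only: mconst_mult mconst_one[symmetric] inj)
      ultimately show "u \<in> range mconst - {\<zero>\<^bsub>?Q\<^esub>}"
        by (auto simp: poly_ring_simps mconst_def)
    next
      fix u assume "u \<in> range mconst - {\<zero>\<^bsub>?Q\<^esub>}"
      then obtain c where c: "u = mconst c" "mconst c \<noteq> (0 :: ('e, 'k) mpoly)" by (auto simp: poly_ring_simps)
      then have "c \<noteq> 0" by (auto simp: mconst_def)
      then have "mconst (inverse c) * u = 1" using c by (simp add: mconst_mult mconst_one)
      then show "u \<in> Units (?Q\<lparr>carrier := range mconst\<rparr>)"
        using c by (auto simp: Units_def poly_ring_simps mult.commute)
    qed
  qed
qed

lemma of_vec_eq_zero_iff: "v \<in> flat_vecs \<Longrightarrow> of_vec v = \<zero>\<^bsub>flat_algebra\<^esub> \<longleftrightarrow> v = 0"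
  using inj_onD[OF inj_on_of_vec, of v 0] by (auto simp: of_vec_zero[symmetric] supported_def)

lemma subfield_quot_const:
  "subfield (quot_const proj_ring coords_kernel) (flat_algebra :: (('f::{field,finite} ^ 'n::finite) set, 'k::field_char_0) mpoly set ring)"
proof -
  let ?A = "flat_algebra :: (('f ^ 'n) set, 'k) mpoly set ring"
  interpret ring_hom_cring "proj_ring :: (('f ^ 'n) set, 'k) mpoly ring" ?A flat_coset by (rule flat_coset_hom)
  \<comment> \<open>The monomial \<open>1\<close> belongs to the empty set, the only independent set
    spanning \<open>{0}\<close>. So the quotient is not the zero ring, and the constants embed as a
    field.\<close>
  have "coords (1 :: (('f ^ 'n) set, 'k) mpoly) $ {0} = 1"
  proof -
    have "F = {}" if "F \<in> proj_indep" "psp F = {0}" for F :: "('f ^ 'n) set set"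
      using psp_level[OF that(1)] that(2) by (simp add: level_def)
    moreover have "{} \<in> (proj_indep :: ('f ^ 'n) set set set)" by (simp add: proj_indep_iff_dim)
    ultimately have "{F. F \<in> proj_indep \<and> psp F = ({0} :: ('f ^ 'n) set)} = {{}}" by auto
    then show ?thesis by (simp add: coords_def indicator_monom_def)
  qed
  then have "coords (1 :: (('f ^ 'n) set, 'k) mpoly) \<noteq> 0" by (metis zero_index zero_neq_one)
  moreover have "\<one>\<^bsub>?A\<^esub> = of_vec (coords 1)"
    using hom_one flat_coset_eq_of_vec[OF R.one_closed] by (simp add: poly_ring_simps)
  ultimately have "\<one>\<^bsub>?A\<^esub> \<noteq> \<zero>\<^bsub>?A\<^esub>" by (simp add: of_vec_eq_zero_iff coords_supported)
  then show ?thesis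
    unfolding quot_const_eq by (intro ring.img_is_subfield(2) subfield_range_mconst)
qed

text \<open>The dimension relation is built by extending a subspace by one line at a time; each
  \<open>U\<close> in \<open>T\<close> contributes the line of \<open>axis U 1\<close>.\<close>

lemma dimension_of_vec:
  fixes T :: "('f::{field,finite} ^ 'n::finite) set set"
  assumes "T \<subseteq> {U. vec.subspace U}"
  shows "ring.dimension flat_algebra (card T) (quot_const proj_ring coords_kernel)
    (of_vec ` (supported T :: ('k::field_char_0 ^ ('f ^ 'n) set) set))"
proof -
  let ?A = "flat_algebra :: (('f ^ 'n) set, 'k) mpoly set ring"
  let ?K = "quot_const proj_ring coords_kernel :: (('f ^ 'n) set, 'k) mpoly set set"
  interpret cring ?A by (rule cring_flat_algebra)
  have "finite T" by simp
  then show ?thesis using assms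
  proof (induction T rule: finite_induct)
    case empty
    have "supported {} = {0 :: 'k ^ ('f ^ 'n) set}" by (auto simp: supported_def vec_eq_iff)
    then show ?case by (simp add: of_vec_zero)
  next
    case (insert U T)
    let ?u = "axis U 1 :: 'k ^ ('f ^ 'n) set"
    have u: "?u \<in> flat_vecs" using insert.prems by (auto simp: supported_def axis_def)
    have T: "supported T \<subseteq> (flat_vecs :: ('k ^ ('f ^ 'n) set) set)"
      using insert.prems by (intro supported_mono) auto
    have "?u \<notin> supported T" using insert.hyps by (auto simp: supported_def axis_def)
    then have "of_vec ?u \<notin> of_vec ` supported T"
      using u T inj_on_of_vec by (metis inj_on_image_mem_iff)
    moreover have "of_vec ?u \<in> carrier ?A" using u carrier_flat_algebra by auto
    moreover have "dimension (card T) ?K (of_vec ` (supported T :: ('k ^ ('f ^ 'n) set) set))"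
      using insert by auto
    ultimately have "dimension (Suc (card T)) ?K (line_extension ?K (of_vec ?u) (of_vec ` supported T))"
      by (intro Suc_dim)
    moreover have "line_extension ?K (of_vec ?u) (of_vec ` supported T) = of_vec ` supported (insert U T)"
    proof -
      have "line_extension ?K (of_vec ?u) (of_vec ` supported T)
          = {of_vec (c *s ?u + w) | c w. w \<in> supported T}"
      proof -
        have "flat_coset (mconst c) \<otimes>\<^bsub>?A\<^esub> of_vec ?u \<oplus>\<^bsub>?A\<^esub> of_vec w = of_vec (c *s ?u + w)"
          if "w \<in> supported T" for c w
        proof -
          have "c *s ?u \<in> flat_vecs" using u by (auto simp: supported_def)
          then show ?thesis using that T u by (simp add: scale_of_vec of_vec_add subset_iff)
        qed
        then show ?thesis
          by (auto simp: line_extension_mem_iff quot_const_def) metis+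
      qed
      also have "\<dots> = of_vec ` {c *s ?u + w | c w. w \<in> supported T}" by auto
      also have "{c *s ?u + w | c w. w \<in> supported T} = supported (insert U T)"
      proof (intro equalityI subsetI)
        fix v assume v: "v \<in> (supported (insert U T) :: ('k ^ ('f ^ 'n) set) set)"
        have "v = (v $ U) *s ?u + (v - (v $ U) *s ?u)" by simp
        moreover have "v - (v $ U) *s ?u \<in> supported T"
          using v by (auto simp: supported_def axis_def)
        ultimately show "v \<in> {c *s ?u + w | c w. w \<in> supported T}" by blast
      qed (auto simp: supported_def axis_def split: if_splits)
      finally show ?thesis .
    qed
    ultimately show ?case using insert.hyps by simp
  qed
qed

lemma dimension_quot_graded:
  "ring.dimension (flat_algebra :: (('f::{field,finite} ^ 'n::finite) set, 'k::field_char_0) mpoly set ring)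
    (card (level d :: ('f ^ 'n) set set)) (quot_const proj_ring coords_kernel) (quot_graded proj_ring coords_kernel d)"
  unfolding quot_graded_eq by (rule dimension_of_vec) (auto simp: level_def)

lemma finsum_of_vec:
  fixes w :: "nat \<Rightarrow> 'k::field_char_0 ^ ('f::{field,finite} ^ 'n::finite) set"
  assumes "\<And>d. w d \<in> flat_vecs" "finite X"
  shows "(\<Oplus>\<^bsub>flat_algebra\<^esub>d\<in>X. of_vec (w d)) = of_vec (\<Sum>d\<in>X. w d) \<and> (\<Sum>d\<in>X. w d) \<in> flat_vecs"
proof -
  interpret cring "flat_algebra :: (('f ^ 'n) set, 'k) mpoly set ring" by (rule cring_flat_algebra)
  show ?thesis using assms(2)
  proof (induction X rule: finite_induct)
    case empty
    then show ?case by (simp add: of_vec_zero supported_def)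
  next
    case (insert d X)
    have "of_vec (w d) \<in> carrier flat_algebra" for d using assms(1) carrier_flat_algebra by auto
    then show ?case
      using insert assms(1)[of d] by (auto simp: finsum_insert of_vec_add) (auto simp: supported_def)
  qed
qed

lemma graded_artinian_flat_algebra:
  "graded_artinian (flat_algebra :: (('f::{field,finite} ^ 'n::finite) set, 'k::field_char_0) mpoly set ring)
    (quot_const proj_ring coords_kernel) (quot_graded proj_ring coords_kernel) CARD('n)"
  unfolding graded_artinian_def
proof (intro conjI allI ballI impI)
  let ?A = "flat_algebra :: (('f ^ 'n) set, 'k) mpoly set ring"
  let ?Ad = "quot_graded proj_ring coords_kernel :: nat \<Rightarrow> (('f ^ 'n) set, 'k) mpoly set set"
  interpret A: cring ?A by (rule cring_flat_algebra)
  show "cring ?A" by (rule cring_flat_algebra)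
  show "subfield (quot_const proj_ring coords_kernel) ?A" by (rule subfield_quot_const)
  show "quot_const proj_ring coords_kernel \<subseteq> ?Ad 0"
  proof -
    have "homogeneous 0 (mconst c :: (('f ^ 'n) set, 'k) mpoly)" for c
      by (simp add: mconst_def homogeneous_def mdeg_def)
    then show ?thesis unfolding quot_const_def quot_graded_def using mconst_mem_poly_ring by blast
  qed
  show "\<exists>m. ring.dimension ?A m (quot_const proj_ring coords_kernel) (?Ad d)" for d
    using dimension_quot_graded by blast
  show "a \<otimes>\<^bsub>?A\<^esub> b \<in> ?Ad (i + j)" if "a \<in> ?Ad i" "b \<in> ?Ad j" for i j a b
  proof -
    obtain p q where "p \<in> carrier proj_ring" "homogeneous i p" "a = flat_coset p"
      "q \<in> carrier proj_ring" "homogeneous j q" "b = flat_coset q"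
      using \<open>a \<in> ?Ad i\<close> \<open>b \<in> ?Ad j\<close> unfolding quot_graded_def by blast
    then show ?thesis
      unfolding quot_graded_def using homogeneous_mult mult_mem_poly_ring flat_coset_mult by blast
  qed
  have empty: "supported (level d :: ('f ^ 'n) set set) = {0 :: 'k ^ ('f ^ 'n) set}" if "CARD('n) < d" for d
    unfolding level_empty[OF that] by (auto simp: supported_def vec_eq_iff)
  then show "?Ad d = {\<zero>\<^bsub>?A\<^esub>}" if "CARD('n) < d" for d
    using that by (simp add: quot_graded_eq of_vec_zero)
  show "?Ad CARD('n) \<noteq> {\<zero>\<^bsub>?A\<^esub>}"
  proof
    assume eq: "?Ad CARD('n) = {\<zero>\<^bsub>?A\<^esub>}"
    let ?u = "axis UNIV 1 :: 'k ^ ('f ^ 'n) set"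
    have u: "?u \<in> supported (level CARD('n))"
      using vec_dim_card[where 'a = 'f and 'n = 'n]
      by (auto simp: supported_def axis_def level_def simp del: vec.dim_UNIV)
    then have "of_vec ?u = \<zero>\<^bsub>?A\<^esub>" using eq by (auto simp: quot_graded_eq)
    then have "?u = 0" using of_vec_eq_zero_iff u supported_level_subset by blast
    then have "?u $ UNIV = 0" by simp
    then show False by (simp add: axis_def)
  qed
  show "\<exists>!c. (\<forall>d. c d \<in> ?Ad d) \<and> a = (\<Oplus>\<^bsub>?A\<^esub>d\<in>{..CARD('n)}. c d)" if a: "a \<in> carrier ?A" for a
  proof -
    obtain v where v: "v \<in> flat_vecs" "a = of_vec v" using a carrier_flat_algebra by auto
    define part where "part d = (\<chi> U. if U \<in> level d then v $ U else 0)" for d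
    have part: "part d \<in> supported (level d)" for d by (simp add: part_def supported_def)
    \<comment> \<open>At \<open>U\<close> only the component of degree \<open>vec.dim U\<close> can
      be nonzero, so a sum determines its summands. This serves both existence and uniqueness of the
      decomposition.\<close>
    have sum: "(\<Sum>d\<le>CARD('n). w d) $ U = w (vec.dim U) $ U"
      if "\<And>d. w d \<in> supported (level d)" "vec.subspace U" for w :: "nat \<Rightarrow> 'k ^ ('f ^ 'n) set" and U
    proof -
      have "w d $ U = (if d = vec.dim U then w (vec.dim U) $ U else 0)" for d
        using that by (auto simp: supported_def level_def)
      then have "(\<Sum>d\<le>CARD('n). w d) $ U = (\<Sum>d\<le>CARD('n). if d = vec.dim U then w (vec.dim U) $ U else 0)"
        by (simp add: sum_component)
      then show ?thesis using dim_le_CARD[of U] by simp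
    qed
    have "v $ U = (\<Sum>d\<le>CARD('n). part d) $ U" for U
    proof (cases "vec.subspace U")
      case True
      then show ?thesis by (subst sum) (auto simp: part, simp add: part_def level_def)
    next
      case False
      then show ?thesis using v(1) by (auto simp: supported_def sum_component part_def level_def)
    qed
    then have vsum: "v = (\<Sum>d\<le>CARD('n). part d)" by (simp add: vec_eq_iff)
    have fv: "w \<in> flat_vecs" if "w \<in> supported (level d)" for w :: "'k ^ ('f ^ 'n) set" and d
      using that supported_level_subset by auto
    show ?thesis
    proof (rule ex1I[of _ "\<lambda>d. of_vec (part d)"])
      show "(\<forall>d. of_vec (part d) \<in> ?Ad d) \<and> a = (\<Oplus>\<^bsub>?A\<^esub>d\<in>{..CARD('n)}. of_vec (part d))"
        using finsum_of_vec[of part "{..CARD('n)}"] fv part vsum v by (auto simp: quot_graded_eq)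
    next
      fix c assume c: "(\<forall>d. c d \<in> ?Ad d) \<and> a = (\<Oplus>\<^bsub>?A\<^esub>d\<in>{..CARD('n)}. c d)"
      then have "\<forall>d. \<exists>w. w \<in> supported (level d) \<and> c d = of_vec w" by (auto simp: quot_graded_eq)
      then obtain w where w: "\<And>d. w d \<in> supported (level d)" "\<And>d. c d = of_vec (w d)" by metis
      have ceq: "c = (\<lambda>d. of_vec (w d))" using w(2) by auto
      have wsum: "(\<Oplus>\<^bsub>?A\<^esub>d\<in>{..CARD('n)}. of_vec (w d)) = of_vec (\<Sum>d\<le>CARD('n). w d)"
          "(\<Sum>d\<le>CARD('n). w d) \<in> flat_vecs"
        using finsum_of_vec[of w "{..CARD('n)}"] fv w(1) by auto
      then have "of_vec v = of_vec (\<Sum>d\<le>CARD('n). w d)" using c v(2) unfolding ceq by simp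
      then have veq: "v = (\<Sum>d\<le>CARD('n). w d)" using inj_onD[OF inj_on_of_vec] v(1) wsum(2) by blast
      have "w d = part d" for d
        unfolding vec_eq_iff
      proof
        fix U show "w d $ U = part d $ U"
        proof (cases "U \<in> level d")
          case True
          then show ?thesis using sum[of w U] w(1) veq by (auto simp: part_def level_def)
        next
          case False
          then show ?thesis using w(1)[of d] by (simp add: part_def supported_def)
        qed
      qed
      then show "c = (\<lambda>d. of_vec (part d))" using ceq by simp
    qed
  qed
qed

lemma strong_lefschetz_flat_algebra:
  "strong_lefschetz (flat_algebra :: (('f::{field,finite} ^ 'n::finite) set, 'k::field_char_0) mpoly set ring)
    (quot_const proj_ring coords_kernel) (quot_graded proj_ring coords_kernel)"
  unfolding strong_lefschetz_def
proof (intro exI conjI bexI allI impI)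
  let ?A = "flat_algebra :: (('f ^ 'n) set, 'k) mpoly set ring"
  \<comment> \<open>The sum of all variables is the Lefschetz element because its powers act between
    levels as nonzero multiples of inclusion matrices.\<close>
  let ?l = "\<Sum>e\<in>proj_space. mvar e :: (('f ^ 'n) set, 'k) mpoly"
  let ?L = "flat_coset ?l"
  interpret A: cring ?A by (rule cring_flat_algebra)
  have l: "?l \<in> carrier proj_ring" by (intro sum_mem_poly_ring mvar_mem_poly_ring)
  have L: "?L \<in> carrier ?A" using l coords_supported by (auto simp: carrier_flat_algebra flat_coset_eq_of_vec)
  show "graded_artinian ?A (quot_const proj_ring coords_kernel) (quot_graded proj_ring coords_kernel) CARD('n)"
    by (rule graded_artinian_flat_algebra)
  have "homogeneous 1 ?l" by (intro homogeneous_sum) (simp add: homogeneous_def mvar_def mdeg_def)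
  then show "?L \<in> quot_graded proj_ring coords_kernel 1" using l by (auto simp: quot_graded_def)
  have raise: "?L \<otimes>\<^bsub>?A\<^esub> of_vec v = of_vec (raise v)" "raise v \<in> flat_vecs" if "v \<in> flat_vecs" for v
    using flat_coset_times_of_vec[OF l that] coords_supported[of "?l * of_coords v"] that
    by (simp_all add: coords_sum_mvars_times coords_of_coords)
  have power: "?L [^]\<^bsub>?A\<^esub> h \<otimes>\<^bsub>?A\<^esub> of_vec v = of_vec ((raise ^^ h) v)" if "v \<in> flat_vecs" for h :: nat and v
    using that
  proof (induction h arbitrary: v)
    case 0
    then show ?case by (simp add: carrier_flat_algebra)
  next
    case (Suc h)
    have "of_vec v \<in> carrier ?A" using Suc.prems carrier_flat_algebra by auto
    then show ?case
      using Suc L by (simp add: A.m_assoc raise funpow_swap1)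
  qed
  fix i assume "i \<le> CARD('n) div 2"
  then have i: "2 * i \<le> CARD('n)" by simp
  let ?h = "CARD('n) - 2 * i"
  let ?S = "\<lambda>d. supported (level d) :: ('k ^ ('f ^ 'n) set) set"
  have bij: "bij_betw (raise ^^ ?h) (?S i) (?S (CARD('n) - i))" by (rule bij_betw_funpow_raise[OF i])
  have inj: "inj_on of_vec (?S d)" for d using inj_on_of_vec supported_level_subset by (rule inj_on_subset)
  have *: "?L [^]\<^bsub>?A\<^esub> ?h \<otimes>\<^bsub>?A\<^esub> of_vec v = of_vec ((raise ^^ ?h) v)" if "v \<in> ?S i" for v
    using power that supported_level_subset by blast
  show "bij_betw (\<lambda>a. ?L [^]\<^bsub>?A\<^esub> ?h \<otimes>\<^bsub>?A\<^esub> a) (quot_graded proj_ring coords_kernel i)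
      (quot_graded proj_ring coords_kernel (CARD('n) - i))"
    unfolding quot_graded_eq
  proof (rule bij_betw_imageI)
    have im: "(raise ^^ ?h) v \<in> ?S (CARD('n) - i)" if "v \<in> ?S i" for v using bij_betwE[OF bij] that by auto
    show "inj_on (\<lambda>a. ?L [^]\<^bsub>?A\<^esub> ?h \<otimes>\<^bsub>?A\<^esub> a) (of_vec ` ?S i)"
    proof (rule inj_onI)
      fix a b assume "a \<in> of_vec ` ?S i" "b \<in> of_vec ` ?S i"
        and eq: "?L [^]\<^bsub>?A\<^esub> ?h \<otimes>\<^bsub>?A\<^esub> a = ?L [^]\<^bsub>?A\<^esub> ?h \<otimes>\<^bsub>?A\<^esub> b"
      then obtain v w where vw: "v \<in> ?S i" "w \<in> ?S i" "a = of_vec v" "b = of_vec w" by auto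
      then have "of_vec ((raise ^^ ?h) v) = of_vec ((raise ^^ ?h) w)" using eq * by simp
      then have "(raise ^^ ?h) v = (raise ^^ ?h) w" using inj_onD[OF inj] im vw by blast
      then have "v = w" using bij vw by (meson bij_betw_def inj_onD)
      then show "a = b" using vw by simp
    qed
    have "(\<lambda>a. ?L [^]\<^bsub>?A\<^esub> ?h \<otimes>\<^bsub>?A\<^esub> a) ` of_vec ` ?S i = of_vec ` (raise ^^ ?h) ` ?S i"
      unfolding image_image using * by (intro image_cong) auto
    then show "(\<lambda>a. ?L [^]\<^bsub>?A\<^esub> ?h \<otimes>\<^bsub>?A\<^esub> a) ` of_vec ` ?S i = of_vec ` ?S (CARD('n) - i)"
      using bij by (simp add: bij_betw_def)
  qed
qed

lemma hilbert_series_flat_algebra: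
  "hilbert_series (flat_algebra :: (('f::{field,finite} ^ 'n::finite) set, 'k::field_char_0) mpoly set ring)
    (quot_const proj_ring coords_kernel) (quot_graded proj_ring coords_kernel)
    = (\<Sum>i\<le>CARD('n). fps_const (q_binomial CARD('f) CARD('n) i) * fps_X ^ i)"
proof (rule fps_ext)
  fix d
  let ?A = "flat_algebra :: (('f ^ 'n) set, 'k) mpoly set ring"
  interpret cring ?A by (rule cring_flat_algebra)
  \<comment> \<open>Dimension over a subfield is unique, so the description picks out the size of
    the level.\<close>
  have "(THE m. ring.dimension ?A m (quot_const proj_ring coords_kernel) (quot_graded proj_ring coords_kernel d))
      = card (level d :: ('f ^ 'n) set set)"
    using dimension_quot_graded dimension_is_inj[OF subfield_quot_const] by (intro the_equality) blast+
  moreover have "fps_nth (\<Sum>i\<le>CARD('n). fps_const (q_binomial CARD('f) CARD('n) i) * fps_X ^ i) d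
      = (if d \<le> CARD('n) then q_binomial CARD('f) CARD('n) d else 0)"
    by (simp add: fps_sum_nth fps_X_power_nth if_distrib cong: if_cong)
  ultimately show "fps_nth (hilbert_series ?A (quot_const proj_ring coords_kernel) (quot_graded proj_ring coords_kernel)) d
      = fps_nth (\<Sum>i\<le>CARD('n). fps_const (q_binomial CARD('f) CARD('n) i) * fps_X ^ i) d"
    using card_level[of d, where 'f = 'f and 'n = 'n] level_empty[of d, where 'f = 'f and 'n = 'n]
    by (simp add: hilbert_series_def)
qed

theorem corollary4p3:
  fixes q n :: nat
    and E :: "('f::{field,finite} ^ 'n::finite) set set"
    and \<F> :: "('f ^ 'n) set set set"
    and Q :: "(('f ^ 'n) set, 'k::field_char_0) mpoly ring"
    and \<Phi> :: "(('f ^ 'n) set, 'k) mpoly"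
    and I J :: "(('f ^ 'n) set, 'k) mpoly set"
    and A :: "(('f ^ 'n) set, 'k) mpoly set ring"
  assumes "q = CARD('f)" and "n = CARD('n)"
    and "E = proj_space" and "\<F> = proj_indep"
    and "Q = poly_ring E"
    and "\<Phi> = basis_poly \<F>"
    and "I = ann E \<Phi>"
    and "J = Idl\<^bsub>Q\<^esub> (Lambda E \<F>)"
    and "A = Q Quot I"
  shows
    "strong_lefschetz A (quot_const Q I) (quot_graded Q I)
     \<and> (I = J \<and> binomial_ideal Q I)
     \<and> hilbert_series A (quot_const Q I) (quot_graded Q I)
         = (\<Sum>i\<le>n. fps_const (q_binomial q n i) * fps_X ^ i)
     \<and> sperner_property (subspace_lattice :: ('f ^ 'n) set set) vec.dim"
proof -
  have I: "I = coords_kernel" by (simp only: assms(3,4,6,7) ann_proj coords_kernel_def)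
  have J: "J = coords_kernel"
    by (simp only: assms(3-5,8) coords_kernel_eq_Idl_Lambda coords_kernel_def)
  have "binomial_ideal proj_ring (coords_kernel :: (('f ^ 'n) set, 'k) mpoly set)"
    unfolding coords_kernel_def by (rule binomial_ideal_coords_kernel)
  then show ?thesis
    unfolding assms(1,2,9) I J assms(5) assms(3)
    using strong_lefschetz_flat_algebra hilbert_series_flat_algebra sperner_subspace_lattice by blast
qed

end
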